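(* Let $d\ge3$, $m<1$, $m_c=(d-2)/d$, $p_c=d(1-m)/2$, and let $p\ge1$ if $m>m_c$ or $p>p_c$ if $m\le m_c$. There is a constant $\mathcal{C}_{\mathrm{loc}}>0$ depending only on $m,d,p$ such that the following holds. Let $u$ be a nonnegative weak solution of $\partial_tu=\Delta(u^m/m)$ in a space-time cylinder $Q=(0,T]\times B_R$ with $R,T>0$. For any two finite cylinders $Q_1\subset Q_0\subseteq Q$, $Q_i=(T_i,T]\times B_{R_i}$, with $0<R_1<R_0\le R$ and $0\le T_0<T_1<T$, $$\sup_{Q_1}|u|\le\mathcal{C}_{\mathrm{loc}}\left[\frac1{(R_0-R_1)^2}+\frac1{T_1-T_0}\right]^{\frac{d+2}{2p+d(m-1)}}\left[\iint_{Q_0}u^p\,dx\,dt+\mathrm{Vol}(Q_0)\right]^{\frac{2}{2p+d(m-1)}}.$$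
   Context: $B_R,B_{R_0},B_{R_1}$ are concentric balls in $\mathbb{R}^d$ of the indicated radii; $T$ does not denote an extinction time here. For $m=0$, $u^m/m$ is read as $\log u$. Values $m\le0$ are allowed. By existing theory, solutions are assumed positive and smooth as long as they do not extinguish identically. *)

theory Defs
  imports "HOL-Analysis.Analysis"
begin

text \<open>Points of space-time are pairs \<open>(t, x)\<close> of type \<open>real \<times> (real ^ 'n)\<close>.\<close>

definition m_c :: "real \<Rightarrow> real" where
  "m_c d = (d - 2) / d"

definition p_c :: "real \<Rightarrow> real \<Rightarrow> real" where
  "p_c d m = d * (1 - m) / 2"

text \<open>The nonlinearity \<open>u\<^sup>m/m\<close>, read as \<open>log u\<close> for \<open>m = 0\<close>.  For \<open>m \<le> 0\<close> it has no finite value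
  at \<open>0\<close>; the value \<open>0\<close> assigned there makes the extinct state \<open>u = 0\<close> a trivial solution, so that
  a solution continued by zero after its extinction time is not excluded.\<close>

definition fd_flux :: "real \<Rightarrow> real \<Rightarrow> real" where
  "fd_flux m s = (if s = 0 then 0 else if m = 0 then ln s else s powr m / m)"

definition cyl :: "real \<Rightarrow> real \<Rightarrow> (real ^ 'n) \<Rightarrow> real \<Rightarrow> (real \<times> (real ^ 'n)) set" where
  "cyl a b c r = {a<..b} \<times> ball c r"

text \<open>Derivatives are taken relative to \<open>S\<close>.  On a cylinder \<open>{a<..b} \<times> ball c r\<close> this is the usual
  notion of being \<open>k\<close> times continuously differentiable up to the final time \<open>b\<close> (one-sided in time
  there); relative derivatives are unique on such sets.\<close>

fun Ck_on :: "nat \<Rightarrow> 'a::euclidean_space set \<Rightarrow> ('a \<Rightarrow> real) \<Rightarrow> bool" where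
  "Ck_on 0 S f = continuous_on S f"
| "Ck_on (Suc k) S f =
     (\<exists>f'. (\<forall>x\<in>S. (f has_derivative f' x) (at x within S)) \<and>
           (\<forall>b\<in>Basis. Ck_on k S (\<lambda>x. f' x b)))"

definition smooth_fun_on :: "'a::euclidean_space set \<Rightarrow> ('a \<Rightarrow> real) \<Rightarrow> bool" where
  "smooth_fun_on S f \<longleftrightarrow> (\<forall>k. Ck_on k S f)"

definition test_function :: "'a::euclidean_space set \<Rightarrow> ('a \<Rightarrow> real) \<Rightarrow> bool" where
  "test_function \<Omega> \<phi> \<longleftrightarrow> smooth_fun_on UNIV \<phi> \<and>
     compact (closure {z. \<phi> z \<noteq> 0}) \<and> closure {z. \<phi> z \<noteq> 0} \<subseteq> \<Omega>"

definition L1_loc :: "'a::euclidean_space set \<Rightarrow>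
    ('a \<Rightarrow> 'b::{banach, second_countable_topology}) \<Rightarrow> bool" where
  "L1_loc \<Omega> f \<longleftrightarrow> (\<forall>K. compact K \<and> K \<subseteq> \<Omega> \<longrightarrow> set_integrable lborel K f)"

definition time_deriv :: "(real \<times> (real ^ 'n) \<Rightarrow> real) \<Rightarrow> real \<times> (real ^ 'n) \<Rightarrow> real" where
  "time_deriv \<phi> z = frechet_derivative \<phi> (at z) (1, 0)"

definition space_grad :: "(real \<times> (real ^ 'n) \<Rightarrow> real) \<Rightarrow> real \<times> (real ^ 'n) \<Rightarrow> real ^ 'n" where
  "space_grad \<phi> z = (\<chi> i. frechet_derivative \<phi> (at z) (0, axis i 1))"

definition weak_space_grad :: "(real \<times> (real ^ 'n)) set \<Rightarrow> (real \<times> (real ^ 'n) \<Rightarrow> real) \<Rightarrow>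
    (real \<times> (real ^ 'n) \<Rightarrow> real ^ 'n) \<Rightarrow> bool" where
  "weak_space_grad \<Omega> f V \<longleftrightarrow>
     (\<forall>\<phi>. test_function \<Omega> \<phi> \<longrightarrow>
        (\<forall>i. (LINT z:\<Omega>|lborel. f z * (space_grad \<phi> z $ i)) = - (LINT z:\<Omega>|lborel. (V z $ i) * \<phi> z)))"

text \<open>Nonnegative weak solutions of \<open>\<partial>\<^sub>t u = \<Delta>(u\<^sup>m/m)\<close> in \<open>(0,T] \<times> B\<^sub>R(c)\<close>.  No initial or lateral boundary
  data are prescribed: test functions are supported in the open cylinder.\<close>

definition nonneg_weak_solution ::
    "real \<Rightarrow> real \<Rightarrow> (real ^ 'n) \<Rightarrow> real \<Rightarrow> (real \<times> (real ^ 'n) \<Rightarrow> real) \<Rightarrow> bool" where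
  "nonneg_weak_solution m T c R u \<longleftrightarrow>
     (\<forall>z \<in> cyl 0 T c R. 0 \<le> u z) \<and>
     (let \<Omega> = {0<..<T} \<times> ball c R in
        L1_loc \<Omega> u \<and> L1_loc \<Omega> (\<lambda>z. fd_flux m (u z)) \<and>
        (\<exists>V. L1_loc \<Omega> V \<and> weak_space_grad \<Omega> (\<lambda>z. fd_flux m (u z)) V \<and>
           (\<forall>\<phi>. test_function \<Omega> \<phi> \<longrightarrow>
              (LINT z:\<Omega>|lborel. u z * time_deriv \<phi> z) =
              (LINT z:\<Omega>|lborel. V z \<bullet> space_grad \<phi> z))))"

text \<open>Standing regularity convention: \<open>T\<^sub>e\<close> is the extinction time; \<open>T\<^sub>e > T\<close> means that no extinction
  occurs in the cylinder, and then \<open>u\<close> is smooth up to the final time \<open>T\<close>.\<close>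

definition positive_smooth_until_extinction ::
    "real \<Rightarrow> (real ^ 'n) \<Rightarrow> real \<Rightarrow> (real \<times> (real ^ 'n) \<Rightarrow> real) \<Rightarrow> bool" where
  "positive_smooth_until_extinction T c R u \<longleftrightarrow>
     (\<exists>T\<^sub>e. (\<forall>z \<in> ({0<..T} \<inter> {..<T\<^sub>e}) \<times> ball c R. 0 < u z) \<and>
           smooth_fun_on (({0<..T} \<inter> {..<T\<^sub>e}) \<times> ball c R) u \<and>
           (\<forall>z \<in> ({0<..T} \<inter> {T\<^sub>e..}) \<times> ball c R. u z = 0))"

text \<open>Extended nonnegative powers; used only with exponent \<open>a > 0\<close>.\<close>

definition ennpowr :: "ennreal \<Rightarrow> real \<Rightarrow> ennreal" where
  "ennpowr x a = (if x = \<infinity> then \<infinity> else ennreal (enn2real x powr a))"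

end

theory Submission
  imports Defs
begin

text \<open>The equation regularises on scales that depend on the size of $u$: where $u$ is comparable
with a number $M$ the diffusion coefficient $u^{m-1}$ is comparable with $M^{m-1}$, so that in the cylinder of duration
$\sigma^2$ and radius $\sigma M^{(m-1)/2}$ the function $u/M$ solves the same equation, now uniformly parabolic as long as
it stays between two positive constants. Hence it suffices to know one scale-free fact
(\<open>unit_cylinder_lower_bound\<close>): a positive solution on the unit cylinder which is bounded by a constant $K$ and is at least
$1$ at the final centre has $\iint u^p \ge c(m,d,p,K) > 0$.

To get into that situation at a given point $z_0$ and scale $\rho$, maximise $u\,\omega^\alpha$, where $\omega$ is the
distance to the parabolic boundary (\<open>parabolic_point_picking\<close>). Near the maximum point $u \le 2^\alpha M$, with
$M$ the value there, and $M (2\sigma)^\alpha \ge u(z_0) \rho^\alpha$. Undoing the scaling, the unit cylinder fact gives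
$\iint u^p \ge c\, M^{N/2} \sigma^{d+2}$ with $N = 2p + d(m-1)$. The hypotheses on $p$ guarantee
$N > 0$, and $\alpha = 2(d+2)/N$ is the exponent which turns the right-hand side into
$c\, u(z_0)^{N/2} \rho^{d+2}$ (\<open>classical_solution_lower_bound\<close>). The rescaled cylinder fits into the one
where $u \le 2^\alpha M$ because its radius $\sigma M^{(m-1)/2}$ is at most $\sigma$ for $M \ge 1$, which holds
if $u(z_0) \ge 1$; if $u(z_0) < 1$, the volume of the cylinder takes over the role of the integral. With
$\rho^{-2} = (R_0-R_1)^{-2} + (T_1-T_0)^{-1}$ this is the theorem at all points before the final time and before extinction;
continuity gives the final time, and after extinction nothing is to be shown.

The unit cylinder fact is proved by De Giorgi's level set method. The truncations $s_k = (u - \psi_k)_+$ are taken above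
a barrier $\psi_k$ that exceeds $K$ on the parabolic boundary, so that $s_k$ has compact support and no cut-off functions
are needed. Testing the equation with $s_k^3$ bounds $\sup_t \int s_k^4$ and $\iint s_k^2 |\nabla s_k|^2$, and Nash's
inequality for $s_k^2$ turns this into a superlinear recursion for $\iint s_k^4$ as the level increases
(\<open>mass_decay\<close>). Powers of $s_k$, instead of $s_k$ itself, keep all functions continuously differentiable. Nash's
inequality is used instead of Sobolev's since it follows from translation invariance alone.

The equation holds pointwise wherever $u$ is smooth and positive (\<open>weak_solution_imp_classical\<close>), by integrating
by parts against test functions.\<close>

section \<open>Integration by parts for compactly supported functions\<close>

lemma integral_translate:
  fixes f :: "'a::euclidean_space \<Rightarrow> real"
  assumes "f \<in> borel_measurable borel"
  shows "(\<integral>x. f (x + b) \<partial>lborel) = (\<integral>x. f x \<partial>lborel)"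
proof -
  have "(\<integral>x. f x \<partial>lborel) = (\<integral>x. f x \<partial>distr lborel borel ((+) b))"
    by (simp add: lborel_distr_plus)
  also have "\<dots> = (\<integral>x. f (b + x) \<partial>lborel)"
    using assms by (subst integral_distr) auto
  finally show ?thesis by (simp add: add.commute)
qed

lemma integrable_continuous_compact_support:
  fixes f :: "'a::euclidean_space \<Rightarrow> 'b::{banach, second_countable_topology}"
  assumes "compact K" "continuous_on K f" "\<And>x. x \<notin> K \<Longrightarrow> f x = 0"
  shows "integrable lborel f"
proof -
  have "(\<lambda>x. indicator K x *\<^sub>R f x) = f"
    using assms(3) by (auto simp: indicator_def fun_eq_iff)
  with borel_integrable_compact[OF assms(1,2)] show ?thesis by simp
qed

lemma has_derivative_zero_off_support:
  fixes f :: "'a::real_normed_vector \<Rightarrow> 'b::real_normed_vector"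
  assumes "(f has_derivative f') (at x)" "closed K" "x \<notin> K" "\<And>y. y \<notin> K \<Longrightarrow> f y = 0"
  shows "f' = (\<lambda>_. 0)"
proof -
  have "((\<lambda>_. 0) has_derivative (\<lambda>_. 0)) (at x)" by simp
  then have "(f has_derivative (\<lambda>_. 0)) (at x)"
    by (rule has_derivative_transform_within_open[where s="-K"]) (use assms in auto)
  with assms(1) show ?thesis by (rule has_derivative_unique)
qed

text \<open>The difference quotients have integral zero by translation invariance, and they converge boundedly to the derivative. This avoids any reduction to iterated one-dimensional integrals.\<close>
lemma integral_directional_derivative_eq_0:
  fixes f :: "'a::euclidean_space \<Rightarrow> real"
  assumes der: "\<And>x. (f has_derivative f' x) (at x)"
    and cont: "continuous_on UNIV (\<lambda>x. f' x b)"
    and K: "compact K" "\<And>x. x \<notin> K \<Longrightarrow> f x = 0"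
  shows "(\<integral>x. f' x b \<partial>lborel) = 0"
proof -
  define D where "D = (\<lambda>x. f' x b)"
  have D0: "D x = 0" if "x \<notin> K" for x
    using has_derivative_zero_off_support[OF der compact_imp_closed[OF K(1)] that K(2)]
    by (simp add: D_def)
  obtain r where r: "\<And>x. x \<in> K \<Longrightarrow> norm x \<le> r"
    using compact_imp_bounded[OF K(1)] unfolding bounded_iff by blast
  have "bounded (D ` K)"
    using K(1) cont unfolding D_def
    by (intro compact_imp_bounded compact_continuous_image continuous_on_subset[OF cont]) auto
  then obtain B0 where B0: "\<And>x. x \<in> K \<Longrightarrow> \<bar>D x\<bar> \<le> B0" unfolding bounded_iff by auto
  define B where "B = max B0 0"
  have B: "\<bar>D x\<bar> \<le> B" for x using B0[of x] D0[of x] unfolding B_def by (cases "x \<in> K") auto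
  have contf: "continuous_on UNIV f"
    by (rule has_derivative_continuous_on[OF der])
  define h where "h n = 1 / real (Suc n)" for n
  have h: "0 < h n" "h n \<le> 1" for n by (auto simp: h_def)
  define q where "q n x = (f (x + h n *\<^sub>R b) - f x) / h n" for n x
  have line: "((\<lambda>s. f (x + s *\<^sub>R b)) has_real_derivative D (x + s *\<^sub>R b)) (at s within T)" for x s T
  proof -
    have "((\<lambda>s. f (x + s *\<^sub>R b)) has_derivative (\<lambda>k. f' (x + s *\<^sub>R b) (k *\<^sub>R b))) (at s within T)"
      by (rule has_derivative_compose[where f="\<lambda>s. x + s *\<^sub>R b", OF _ der])
        (auto intro!: derivative_eq_intros)
    moreover have "f' (x + s *\<^sub>R b) (k *\<^sub>R b) = k * D (x + s *\<^sub>R b)" for k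
      using linear_scale[OF has_derivative_linear[OF der]] by (auto simp: D_def)
    ultimately show ?thesis
      unfolding has_field_derivative_def
      by (elim has_derivative_eq_rhs) (auto simp: mult.commute[of "D _"])
  qed
  have qB: "\<bar>q n x\<bar> \<le> B" for n x
  proof -
    have "\<exists>z>0. z < h n \<and> f (x + h n *\<^sub>R b) - f (x + 0 *\<^sub>R b) = (h n - 0) * D (x + z *\<^sub>R b)"
      by (rule MVT2[where f="\<lambda>s. f (x + s *\<^sub>R b)", OF h(1) line])
    then obtain z where "q n x = D (x + z *\<^sub>R b)" using h(1)[of n] by (auto simp: q_def)
    then show ?thesis using B by simp
  qed
  have q0: "q n x = 0" if "norm x > r + norm b" for n x
  proof -
    have "norm (x + h n *\<^sub>R b) \<ge> norm x - norm (h n *\<^sub>R b)"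
      using norm_diff_ineq by blast
    moreover have "norm (h n *\<^sub>R b) \<le> norm b" using h[of n] by (simp add: mult_left_le_one_le)
    ultimately have "norm (x + h n *\<^sub>R b) > r" using that by linarith
    moreover have "norm x > r" using that by (smt (verit) norm_ge_zero)
    ultimately show ?thesis using K(2) r unfolding q_def by (metis diff_self div_0 not_less)
  qed
  have lim: "(\<lambda>n. q n x) \<longlonglongrightarrow> D x" for x
  proof -
    have "((\<lambda>s. f (x + s *\<^sub>R b)) has_real_derivative D x) (at 0)"
      using line[of x 0] by simp
    then have "((\<lambda>s. (f (x + s *\<^sub>R b) - f x) / s) \<longlongrightarrow> D x) (at 0)"
      by (simp add: has_field_derivative_iff)
    moreover have "filterlim h (at 0) sequentially"
      unfolding filterlim_at using h(1) LIMSEQ_inverse_real_of_nat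
      by (auto simp: h_def[abs_def] inverse_eq_divide less_imp_neq[symmetric])
    ultimately show ?thesis unfolding q_def
      by (rule filterlim_compose[where f=h, unfolded o_def])
  qed
  have fi: "integrable lborel f"
    by (rule integrable_continuous_compact_support[OF K(1) continuous_on_subset[OF contf]]) (use K in auto)
  have fm: "f \<in> borel_measurable borel" using contf by (rule borel_measurable_continuous_onI)
  have q_int0: "(\<integral>x. q n x \<partial>lborel) = 0" for n
  proof -
    have "integrable lborel (\<lambda>x. f (x + h n *\<^sub>R b))"
    proof -
      have "integrable (distr lborel borel ((+) (h n *\<^sub>R b))) f"
        using fi by (simp add: lborel_distr_plus)
      then show ?thesis by (subst (asm) integrable_distr_eq) (use fm in \<open>auto simp: add.commute\<close>)
    qed
    then show ?thesis unfolding q_def using fi integral_translate[OF fm] by simp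
  qed
  have "(\<lambda>n. \<integral>x. q n x \<partial>lborel) \<longlonglongrightarrow> (\<integral>x. D x \<partial>lborel)"
  proof (rule integral_dominated_convergence[where w="\<lambda>x. indicator (cball 0 (r + norm b)) x *\<^sub>R B"])
    show "D \<in> borel_measurable lborel"
      using cont by (simp add: D_def borel_measurable_continuous_onI)
    show "q n \<in> borel_measurable lborel" for n
      unfolding q_def using fm by measurable
    show "integrable lborel (\<lambda>x. indicator (cball 0 (r + norm b)) x *\<^sub>R B)"
      by (rule borel_integrable_compact) auto
    show "AE x in lborel. (\<lambda>n. q n x) \<longlonglongrightarrow> D x" using lim by simp
    show "AE x in lborel. norm (q n x) \<le> indicator (cball 0 (r + norm b)) x *\<^sub>R B" for n
      using qB[of n] q0[of _ n] by (intro AE_I2) (auto simp: indicator_def not_le)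
  qed
  then have "(\<integral>x. D x \<partial>lborel) = 0"
    unfolding q_int0 using LIMSEQ_unique tendsto_const by metis
  then show ?thesis by (simp add: D_def)
qed

text \<open>The product of \<open>F\<close> and \<open>\<phi>\<close>, extended by zero outside \<open>D\<close>, is differentiable on the whole space because \<open>\<phi>\<close> vanishes near the boundary of \<open>D\<close>.\<close>
lemma integral_by_parts_compact_support:
  fixes F \<phi> :: "'a::euclidean_space \<Rightarrow> real"
  assumes D: "open D"
    and F: "\<And>x. x \<in> D \<Longrightarrow> (F has_derivative F' x) (at x)" "continuous_on D (\<lambda>x. F' x b)"
    and phi: "\<And>x. (\<phi> has_derivative \<phi>' x) (at x)" "continuous_on UNIV (\<lambda>x. \<phi>' x b)"
    and S: "compact S" "S \<subseteq> D" "\<And>x. x \<notin> S \<Longrightarrow> \<phi> x = 0"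
  shows "(\<integral>x. F x * \<phi>' x b \<partial>lborel) = - (\<integral>x. F' x b * \<phi> x \<partial>lborel)"
    and "integrable lborel (\<lambda>x. F x * \<phi>' x b)"
    and "integrable lborel (\<lambda>x. F' x b * \<phi> x)"
proof -
  have clS: "closed S" using S(1) by (rule compact_imp_closed)
  have phi'0: "\<phi>' x b = 0" if "x \<notin> S" for x
    using has_derivative_zero_off_support[OF phi(1) clS that S(3)] by simp
  have contF: "continuous_on D F"
    by (rule has_derivative_continuous_on) (rule has_derivative_at_withinI[OF F(1)])
  have contphi: "continuous_on UNIV \<phi>"
    by (rule has_derivative_continuous_on[OF phi(1)])
  show i1: "integrable lborel (\<lambda>x. F x * \<phi>' x b)"
    by (rule integrable_continuous_compact_support[OF S(1)])
      (auto intro!: continuous_intros continuous_on_subset[OF contF S(2)]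
        continuous_on_subset[OF phi(2)] simp: phi'0)
  show i2: "integrable lborel (\<lambda>x. F' x b * \<phi> x)"
    by (rule integrable_continuous_compact_support[OF S(1)])
      (auto intro!: continuous_intros continuous_on_subset[OF F(2) S(2)]
        continuous_on_subset[OF contphi] simp: S(3))
  define G where "G = (\<lambda>x. F x * \<phi> x)"
  define G' where "G' x = (\<lambda>k. if x \<in> D then F x * \<phi>' x k + F' x k * \<phi> x else 0)" for x
  have off: "(G has_derivative (\<lambda>_. 0)) (at x)" if "x \<notin> S" for x
    by (rule has_derivative_transform_within_open[where f="\<lambda>_. 0" and s="-S"])
      (use clS that S(3) in \<open>auto simp: G_def\<close>)
  have der: "(G has_derivative G' x) (at x)" for x
  proof (cases "x \<in> D")
    case True
    then show ?thesis unfolding G_def G'_def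
      by (auto intro!: derivative_eq_intros F phi)
  next
    case False
    then have "x \<notin> S" using S(2) by auto
    then show ?thesis using off False unfolding G'_def by auto
  qed
  have G'b0: "G' x b = 0" if "x \<notin> S" for x
    unfolding G'_def using that phi'0 S(3) by auto
  have contG': "continuous_on UNIV (\<lambda>x. G' x b)"
  proof -
    have "continuous_on D (\<lambda>x. F x * \<phi>' x b + F' x b * \<phi> x)"
      by (intro continuous_intros contF continuous_on_subset[OF phi(2)] F(2) continuous_on_subset[OF contphi]) auto
    then have "continuous_on D (\<lambda>x. G' x b)"
      by (rule continuous_on_eq) (auto simp: G'_def)
    moreover have "continuous_on (-S) (\<lambda>x. G' x b)"
      by (rule continuous_on_eq[of _ "\<lambda>_. 0"]) (auto simp: G'b0)
    ultimately have "continuous_on (D \<union> - S) (\<lambda>x. G' x b)"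
      using D clS by (intro continuous_on_open_Un) auto
    moreover have "D \<union> -S = UNIV" using S(2) by auto
    ultimately show ?thesis by simp
  qed
  have "(\<integral>x. G' x b \<partial>lborel) = 0"
    by (rule integral_directional_derivative_eq_0[OF der contG' S(1)]) (auto simp: G_def S(3))
  moreover have "(\<integral>x. G' x b \<partial>lborel) = (\<integral>x. F x * \<phi>' x b + F' x b * \<phi> x \<partial>lborel)"
  proof (rule Bochner_Integration.integral_cong)
    show "G' x b = F x * \<phi>' x b + F' x b * \<phi> x" for x
      using phi'0[of x] S(2) S(3)[of x] by (cases "x \<in> S") (auto simp: G'_def)
  qed simp
  ultimately show "(\<integral>x. F x * \<phi>' x b \<partial>lborel) = - (\<integral>x. F' x b * \<phi> x \<partial>lborel)"
    using i1 i2 by simp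
qed

section \<open>Nash's inequality\<close>

lemma fubini_compact_support:
  fixes f :: "'b::euclidean_space \<times> 'a::euclidean_space \<Rightarrow> real"
  assumes "compact K" "continuous_on K f" "\<And>z. z \<notin> K \<Longrightarrow> f z = 0"
  shows "(\<integral>t. (\<integral>x. f (t, x) \<partial>lborel) \<partial>lborel) = (\<integral>x. (\<integral>t. f (t, x) \<partial>lborel) \<partial>lborel)"
    and "integrable lborel (\<lambda>t. \<integral>x. f (t, x) \<partial>lborel)"
    and "integrable lborel (\<lambda>x. \<integral>t. f (t, x) \<partial>lborel)"
proof -
  have "integrable lborel f" by (rule integrable_continuous_compact_support[OF assms])
  then have *: "integrable (lborel \<Otimes>\<^sub>M lborel) (\<lambda>(t,x). f (t, x))"
    by (simp add: lborel_prod)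
  show "(\<integral>t. (\<integral>x. f (t, x) \<partial>lborel) \<partial>lborel) = (\<integral>x. (\<integral>t. f (t, x) \<partial>lborel) \<partial>lborel)"
    using lborel_pair.Fubini_integral[OF *] by simp
  show "integrable lborel (\<lambda>t. \<integral>x. f (t, x) \<partial>lborel)"
    using lborel_pair.integrable_fst[OF *] by simp
  show "integrable lborel (\<lambda>x. \<integral>t. f (t, x) \<partial>lborel)"
    using lborel_pair.integrable_snd[OF *] by simp
qed

lemma integral_square_ge_square_integral:
  fixes f :: "real \<Rightarrow> real"
  assumes "continuous_on {0..1} f"
  shows "(\<integral>s. indicator {0..1} s *\<^sub>R f s \<partial>lborel)\<^sup>2 \<le> (\<integral>s. indicator {0..1} s *\<^sub>R (f s)\<^sup>2 \<partial>lborel)"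
proof -
  define c where "c = (\<integral>s. indicator {0..1} s *\<^sub>R f s \<partial>lborel)"
  have i: "integrable lborel (\<lambda>s. indicator {0..1} s *\<^sub>R f s)"
      "integrable lborel (\<lambda>s. indicator {0..1} s *\<^sub>R (f s)\<^sup>2)"
      "integrable lborel (\<lambda>s. indicator {0..1::real} s *\<^sub>R (c\<^sup>2))"
    by (intro borel_integrable_compact continuous_intros assms compact_Icc)+
  have "0 \<le> (\<integral>s. indicator {0..1} s *\<^sub>R (f s - c)\<^sup>2 \<partial>lborel)"
    by (rule Bochner_Integration.integral_nonneg) auto
  also have "\<dots> = (\<integral>s. indicator {0..1} s *\<^sub>R (f s)\<^sup>2 - 2 * c * (indicator {0..1} s *\<^sub>R f s)
      + indicator {0..1} s *\<^sub>R c\<^sup>2 \<partial>lborel)"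
    by (rule Bochner_Integration.integral_cong) (auto simp: indicator_def power2_eq_square algebra_simps)
  also have "\<dots> = (\<integral>s. indicator {0..1} s *\<^sub>R (f s)\<^sup>2 \<partial>lborel) - 2 * c * c + c\<^sup>2"
    using i by (simp add: c_def)
  finally show ?thesis by (simp add: c_def power2_eq_square)
qed

text \<open>Write the difference as the integral of the directional derivative along the segment, apply Cauchy-Schwarz on the unit interval, and integrate over all positions: each point of the segment contributes the same amount.\<close>
lemma integral_translation_difference_square_le:
  fixes f :: "'a::euclidean_space \<Rightarrow> real" and g :: "'a \<Rightarrow> 'a"
  assumes der: "\<And>x. (f has_derivative (\<lambda>k. g x \<bullet> k)) (at x)"
    and cont: "continuous_on UNIV g"
    and K: "compact K" "\<And>x. x \<notin> K \<Longrightarrow> f x = 0"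
  shows "(\<integral>x. (f (x + y) - f x)\<^sup>2 \<partial>lborel) \<le> (norm y)\<^sup>2 * (\<integral>x. (norm (g x))\<^sup>2 \<partial>lborel)"
proof -
  have g0: "g x = 0" if "x \<notin> K" for x
    using has_derivative_zero_off_support[OF der compact_imp_closed[OF K(1)] that K(2)]
    by (metis inner_eq_zero_iff)
  obtain r where r: "\<And>x. x \<in> K \<Longrightarrow> norm x \<le> r"
    using compact_imp_bounded[OF K(1)] unfolding bounded_iff by blast
  define H where "H z = (if z \<in> {0..1} \<times> cball 0 (r + norm y) then (norm (g (snd z + fst z *\<^sub>R y)))\<^sup>2 else 0)" for z :: "real \<times> 'a"
  have Heq: "H (s, x) = indicator {0..1} s *\<^sub>R (norm (g (x + s *\<^sub>R y)))\<^sup>2" for s x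
  proof (cases "s \<in> {0..1} \<and> norm x > r + norm y")
    case True
    have "norm (x + s *\<^sub>R y) \<ge> norm x - norm (s *\<^sub>R y)" using norm_diff_ineq by blast
    moreover have "norm (s *\<^sub>R y) \<le> norm y" using True by (simp add: mult_left_le_one_le)
    ultimately have "norm (x + s *\<^sub>R y) > r" using True by linarith
    then have "g (x + s *\<^sub>R y) = 0" using g0 r not_less by blast
    then show ?thesis using True by (auto simp: H_def)
  qed (auto simp: H_def indicator_def)
  have Hc: "compact ({0..1::real} \<times> cball (0::'a) (r + norm y))" "continuous_on ({0..1} \<times> cball 0 (r + norm y)) H"
      "\<And>z. z \<notin> {0..1} \<times> cball 0 (r + norm y) \<Longrightarrow> H z = 0"
  proof -
    show "compact ({0..1::real} \<times> cball (0::'a) (r + norm y))" by (intro compact_Times) auto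
    have "continuous_on ({0..1} \<times> cball 0 (r + norm y)) (\<lambda>z. (norm (g (snd z + fst z *\<^sub>R y)))\<^sup>2)"
      by (intro continuous_intros continuous_on_compose2[OF cont]) auto
    then show "continuous_on ({0..1} \<times> cball 0 (r + norm y)) H"
      by (rule continuous_on_eq) (auto simp: H_def)
  qed (auto simp: H_def)
  note F = fubini_compact_support[OF Hc]
  have contf: "continuous_on UNIV f" by (rule has_derivative_continuous_on[OF der])
  have fm: "f \<in> borel_measurable borel" using contf by (rule borel_measurable_continuous_onI)
  have gm: "(\<lambda>x. (norm (g x))\<^sup>2) \<in> borel_measurable borel"
    by (intro borel_measurable_continuous_onI continuous_intros cont)
  have pw: "(f (x + y) - f x)\<^sup>2 \<le> (norm y)\<^sup>2 * (\<integral>s. H (s, x) \<partial>lborel)" for x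
  proof -
    have line: "((\<lambda>s. f (x + s *\<^sub>R y)) has_vector_derivative g (x + s *\<^sub>R y) \<bullet> y) (at s within T)" for s T
    proof -
      have "((\<lambda>s. f (x + s *\<^sub>R y)) has_derivative (\<lambda>k. g (x + s *\<^sub>R y) \<bullet> (k *\<^sub>R y))) (at s within T)"
        by (rule has_derivative_compose[where f="\<lambda>s. x + s *\<^sub>R y", OF _ der])
          (auto intro!: derivative_eq_intros)
      then show ?thesis unfolding has_vector_derivative_def by simp
    qed
    have cg: "continuous_on {0..1} (\<lambda>s. g (x + s *\<^sub>R y) \<bullet> y)"
      by (intro continuous_intros continuous_on_compose2[OF cont]) auto
    have "(\<integral>s. indicator {0..1} s *\<^sub>R (g (x + s *\<^sub>R y) \<bullet> y) \<partial>lborel) = f (x + 1 *\<^sub>R y) - f (x + 0 *\<^sub>R y)"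
      by (rule integral_FTC_atLeastAtMost[OF _ line cg]) simp
    then have "(f (x + y) - f x)\<^sup>2 \<le> (\<integral>s. indicator {0..1} s *\<^sub>R (g (x + s *\<^sub>R y) \<bullet> y)\<^sup>2 \<partial>lborel)"
      using integral_square_ge_square_integral[OF cg] by simp
    also have "\<dots> \<le> (\<integral>s. (norm y)\<^sup>2 * H (s, x) \<partial>lborel)"
    proof (rule integral_mono)
      show "integrable lborel (\<lambda>s. indicator {0..1} s *\<^sub>R (g (x + s *\<^sub>R y) \<bullet> y)\<^sup>2)"
        by (intro borel_integrable_compact continuous_intros cg) auto
      show "integrable lborel (\<lambda>s. (norm y)\<^sup>2 * H (s, x))"
        unfolding Heq
        by (intro integrable_mult_right borel_integrable_compact continuous_intros continuous_on_compose2[OF cont]) auto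
      show "indicator {0..1} s *\<^sub>R (g (x + s *\<^sub>R y) \<bullet> y)\<^sup>2 \<le> (norm y)\<^sup>2 * H (s, x)" for s
        unfolding Heq using Cauchy_Schwarz_ineq[of "g (x + s *\<^sub>R y)" y]
        by (auto simp: indicator_def power2_norm_eq_inner mult.commute)
    qed
    finally show ?thesis by simp
  qed
  have inner: "(\<integral>x. H (s, x) \<partial>lborel) = indicator {0..1} s *\<^sub>R (\<integral>x. (norm (g x))\<^sup>2 \<partial>lborel)" for s
    unfolding Heq using integral_translate[OF gm, of "s *\<^sub>R y"] by simp
  have "(\<integral>x. (f (x + y) - f x)\<^sup>2 \<partial>lborel) \<le> (\<integral>x. (norm y)\<^sup>2 * (\<integral>s. H (s, x) \<partial>lborel) \<partial>lborel)"
  proof (rule integral_mono)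
    show "integrable lborel (\<lambda>x. (f (x + y) - f x)\<^sup>2)"
    proof (rule integrable_continuous_compact_support[of "cball 0 (r + norm y)"])
      show "continuous_on (cball 0 (r + norm y)) (\<lambda>x. (f (x + y) - f x)\<^sup>2)"
        by (intro continuous_intros continuous_on_compose2[OF contf]) auto
      show "(f (x + y) - f x)\<^sup>2 = 0" if "x \<notin> cball 0 (r + norm y)" for x
      proof -
        have "norm (x + y) > r" using that norm_diff_ineq[of x y] by auto
        moreover have "norm x > r" using that norm_ge_zero[of y] by (auto simp del: norm_ge_zero)
        ultimately show ?thesis using K(2) r by (metis diff_self not_less power_zero_numeral)
      qed
    qed simp
    show "integrable lborel (\<lambda>x. (norm y)\<^sup>2 * (\<integral>s. H (s, x) \<partial>lborel))" using F(3) by simp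
  qed (rule pw)
  also have "\<dots> = (norm y)\<^sup>2 * (\<integral>x. (norm (g x))\<^sup>2 \<partial>lborel)"
    using F(1) by (simp add: inner)
  finally show ?thesis .
qed

text \<open>Translation invariance gives $\int f^2 = \int f\, f(\cdot + y) + \frac12 \int (f(\cdot + y) - f)^2$ for every $y$. Averaging over $y$ in the ball of
radius $r$ bounds the first term by $(\int f)^2$ over the volume of the ball and the second one by the gradient. Minimising over $r$ would give the usual multiplicative form; the free radius is more convenient for the recursion below.\<close>
lemma Nash_inequality_parametric:
  fixes f :: "'a::euclidean_space \<Rightarrow> real" and g :: "'a \<Rightarrow> 'a"
  assumes der: "\<And>x. (f has_derivative (\<lambda>k. g x \<bullet> k)) (at x)"
    and cont: "continuous_on UNIV g"
    and K: "compact K" "\<And>x. x \<notin> K \<Longrightarrow> f x = 0"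
    and nonneg: "\<And>x. 0 \<le> f x" and "0 < r"
  shows "(\<integral>x. (f x)\<^sup>2 \<partial>lborel)
    \<le> r\<^sup>2 / 2 * (\<integral>x. (norm (g x))\<^sup>2 \<partial>lborel) + (\<integral>x. f x \<partial>lborel)\<^sup>2 / measure lborel (cball (0::'a) r)"
proof -
  define I where "I = (\<integral>x. (f x)\<^sup>2 \<partial>lborel)"
  define J where "J = (\<integral>x. f x \<partial>lborel)"
  define E where "E = (\<integral>x. (norm (g x))\<^sup>2 \<partial>lborel)"
  define V where "V = measure lborel (cball (0::'a) r)"
  have V: "0 < V" unfolding V_def using \<open>0 < r\<close> by (simp add: content_cball_pos)
  have contf: "continuous_on UNIV f" by (rule has_derivative_continuous_on[OF der])
  have fm[measurable]: "f \<in> borel_measurable borel" using contf by (rule borel_measurable_continuous_onI)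
  have fi: "integrable lborel f" "integrable lborel (\<lambda>x. (f x)\<^sup>2)"
    by (rule integrable_continuous_compact_support[OF K(1)],
        auto intro!: continuous_intros continuous_on_subset[OF contf] simp: K(2))+
  have tr: "integrable lborel (\<lambda>x. (f (x + y))\<^sup>2)" for y
  proof -
    have "integrable (distr lborel borel ((+) y)) (\<lambda>x. (f x)\<^sup>2)" using fi by (simp add: lborel_distr_plus)
    then show ?thesis by (subst (asm) integrable_distr_eq) (auto simp: add.commute)
  qed
  have pr: "integrable lborel (\<lambda>x. f x * f (x + y))" for y
    by (rule integrable_continuous_compact_support[OF K(1)])
      (auto intro!: continuous_intros continuous_on_compose2[OF contf] continuous_on_subset[OF contf] simp: K(2))
  have step: "I \<le> r\<^sup>2 / 2 * E + (\<integral>x. f x * f (x + y) \<partial>lborel)" if "y \<in> cball 0 r" for y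
  proof -
    have "(\<integral>x. (f (x + y) - f x)\<^sup>2 \<partial>lborel) = (\<integral>x. (f (x + y))\<^sup>2 - 2 * (f x * f (x + y)) + (f x)\<^sup>2 \<partial>lborel)"
      by (rule Bochner_Integration.integral_cong) (auto simp: power2_eq_square algebra_simps)
    also have "\<dots> = (\<integral>x. (f (x + y))\<^sup>2 \<partial>lborel) - 2 * (\<integral>x. f x * f (x + y) \<partial>lborel) + I"
      using tr pr fi by (simp add: I_def)
    also have "(\<integral>x. (f (x + y))\<^sup>2 \<partial>lborel) = I"
      unfolding I_def by (rule integral_translate) simp
    finally have "I = (\<integral>x. (f (x + y) - f x)\<^sup>2 \<partial>lborel) / 2 + (\<integral>x. f x * f (x + y) \<partial>lborel)"
      by (simp add: field_simps)
    moreover have "(\<integral>x. (f (x + y) - f x)\<^sup>2 \<partial>lborel) \<le> (norm y)\<^sup>2 * E"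
      unfolding E_def by (rule integral_translation_difference_square_le[OF der cont K])
    moreover have "(norm y)\<^sup>2 * E \<le> r\<^sup>2 * E"
      using that by (intro mult_right_mono power_mono) (auto simp: E_def intro!: Bochner_Integration.integral_nonneg)
    ultimately show ?thesis by linarith
  qed
  define F where "F z = (if z \<in> cball 0 r \<times> K then f (snd z) * f (snd z + fst z) else 0)" for z :: "'a \<times> 'a"
  have Feq: "F (y, x) = indicator (cball 0 r) y *\<^sub>R (f x * f (x + y))" for y x
    using K(2) by (auto simp: F_def indicator_def)
  have Fc: "compact (cball (0::'a) r \<times> K)" "continuous_on (cball 0 r \<times> K) F"
      "\<And>z. z \<notin> cball 0 r \<times> K \<Longrightarrow> F z = 0"
  proof -
    show "compact (cball (0::'a) r \<times> K)" by (intro compact_Times K(1) compact_cball)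
    have "continuous_on (cball 0 r \<times> K) (\<lambda>z. f (snd z) * f (snd z + fst z))"
      by (intro continuous_intros continuous_on_compose2[OF contf]) auto
    then show "continuous_on (cball 0 r \<times> K) F"
      by (rule continuous_on_eq) (auto simp: F_def)
  qed (auto simp: F_def)
  note Fub = fubini_compact_support[OF Fc]
  have ind: "integrable lborel (\<lambda>y. indicator (cball (0::'a) r) y *\<^sub>R c)" for c :: real
    by (rule borel_integrable_compact) auto
  have "(\<integral>y. indicator (cball (0::'a) r) y *\<^sub>R I \<partial>lborel)
      \<le> (\<integral>y. indicator (cball (0::'a) r) y *\<^sub>R (r\<^sup>2 / 2 * E) + (\<integral>x. F (y, x) \<partial>lborel) \<partial>lborel)"
  proof (rule integral_mono)
    show "integrable lborel (\<lambda>y. indicator (cball 0 r) y *\<^sub>R (r\<^sup>2 / 2 * E) + (\<integral>x. F (y, x) \<partial>lborel))"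
      using Fub(2) ind by simp
    show "indicator (cball 0 r) y *\<^sub>R I \<le> indicator (cball 0 r) y *\<^sub>R (r\<^sup>2 / 2 * E) + (\<integral>x. F (y, x) \<partial>lborel)" for y
      using step[of y] by (auto simp: Feq indicator_def)
  qed (rule ind)
  also have "\<dots> = V * (r\<^sup>2 / 2 * E) + (\<integral>x. (\<integral>y. F (y, x) \<partial>lborel) \<partial>lborel)"
    using Fub(1,2) ind[of "r\<^sup>2 / 2 * E"] by (simp add: V_def)
  also have "(\<integral>x. (\<integral>y. F (y, x) \<partial>lborel) \<partial>lborel) \<le> (\<integral>x. f x * J \<partial>lborel)"
  proof (rule integral_mono)
    show "integrable lborel (\<lambda>x. f x * J)" using fi by simp
    show "(\<integral>y. F (y, x) \<partial>lborel) \<le> f x * J" for x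
    proof -
      have "(\<integral>y. F (y, x) \<partial>lborel) = f x * (\<integral>y. indicator (cball 0 r) y *\<^sub>R f (y + x) \<partial>lborel)"
        unfolding Feq by (subst integral_mult_right_zero[symmetric]) (simp add: algebra_simps)
      also have "(\<integral>y. indicator (cball 0 r) y *\<^sub>R f (y + x) \<partial>lborel) \<le> (\<integral>y. f (y + x) \<partial>lborel)"
      proof (rule integral_mono)
        show "integrable lborel (\<lambda>y. indicator (cball 0 r) y *\<^sub>R f (y + x))"
          by (intro borel_integrable_compact continuous_on_compose2[OF contf] continuous_intros) auto
        have "integrable (distr lborel borel ((+) x)) f" using fi by (simp add: lborel_distr_plus)
        then show "integrable lborel (\<lambda>y. f (y + x))"
          by (subst (asm) integrable_distr_eq) (auto simp: add.commute)
      qed (auto simp: indicator_def nonneg)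
      also have "\<dots> = J" unfolding J_def by (rule integral_translate) simp
      finally show ?thesis using nonneg by (simp add: mult_left_mono)
    qed
  qed (rule Fub(3))
  also have "(\<integral>x. f x * J \<partial>lborel) = J\<^sup>2" by (simp add: J_def power2_eq_square)
  finally have "I * V \<le> V * (r\<^sup>2 / 2 * E) + J\<^sup>2" by (simp add: V_def mult.commute)
  then have "I \<le> r\<^sup>2 / 2 * E + J\<^sup>2 / V" using V by (simp add: field_simps)
  then show ?thesis by (simp add: I_def E_def J_def V_def)
qed

section \<open>Tools for level set iteration\<close>

lemma has_derivative_positive_part_power:
  "((\<lambda>y::real. max y 0 ^ Suc (Suc n)) has_real_derivative real (Suc (Suc n)) * max y 0 ^ Suc n) (at y)"
proof (cases y "0::real" rule: linorder_cases)
  case less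
  have "((\<lambda>y::real. max y 0 ^ Suc (Suc n)) has_real_derivative 0) (at y)"
    by (rule has_field_derivative_transform_within_open[OF DERIV_const, where S="{..<0}"])
      (use less in \<open>auto simp: max_absorb2\<close>)
  then show ?thesis using less by (simp add: max_absorb2)
next
  case greater
  have "((\<lambda>y::real. y ^ Suc (Suc n)) has_real_derivative real (Suc (Suc n)) * y ^ Suc n) (at y)"
    by (rule DERIV_cong[OF DERIV_pow]) simp
  then have "((\<lambda>y::real. max y 0 ^ Suc (Suc n)) has_real_derivative real (Suc (Suc n)) * y ^ Suc n) (at y)"
    by (rule has_field_derivative_transform_within_open[where S="{0<..}"])
      (use greater in \<open>auto simp: max_absorb1\<close>)
  then show ?thesis using greater by (simp add: max_absorb1)
next
  case equal
  have "((\<lambda>h::real. max h 0 ^ Suc (Suc n) / h) \<longlongrightarrow> 0) (at 0)"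
  proof (rule Lim_null_comparison)
    have "norm (max h 0 ^ Suc (Suc n) / h) \<le> \<bar>h\<bar> ^ Suc n" for h :: real
    proof (cases "0 < h")
      case False
      then have "max h 0 ^ Suc (Suc n) / h = 0" by (simp add: max_absorb2)
      then show ?thesis using zero_le_power[of "\<bar>h\<bar>" "Suc n"] by (simp only: norm_zero abs_ge_zero)
    qed (simp add: max_absorb1)
    then show "\<forall>\<^sub>F h in at 0. norm (max h 0 ^ Suc (Suc n) / h) \<le> \<bar>h::real\<bar> ^ Suc n"
      by (intro always_eventually) blast
    have "((\<lambda>h::real. \<bar>h\<bar> ^ Suc n) \<longlongrightarrow> \<bar>0\<bar> ^ Suc n) (at 0)"
      by (intro tendsto_intros)
    then show "((\<lambda>h::real. \<bar>h\<bar> ^ Suc n) \<longlongrightarrow> 0) (at 0)" by simp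
  qed
  then show ?thesis unfolding equal has_field_derivative_iff by simp
qed

text \<open>De Giorgi's lemma: the superlinear power beats the geometric factor once the start is small. The bound $D\, b^{-j/e}$ with $C D^e = b^{-1/e}$ is the sequence which satisfies the recursion with equality.\<close>
lemma fast_geometric_convergence:
  fixes Y :: "nat \<Rightarrow> real"
  assumes C: "0 < C" and b: "1 < b" and e: "0 < e"
    and step: "\<And>j. Y (Suc j) \<le> C * b ^ j * Y j powr (1 + e)" and nonneg: "\<And>j. 0 \<le> Y j"
    and init: "Y 0 \<le> C powr (- (1 / e)) * b powr (- (1 / e\<^sup>2))"
  shows "Y \<longlonglongrightarrow> 0"
proof -
  define D where "D = C powr (- (1 / e)) * b powr (- (1 / e\<^sup>2))"
  have D: "0 < D" using C b by (simp add: D_def)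
  have De: "C * D powr e = b powr (- (1 / e))"
  proof -
    have "D powr e = C powr (- (1 / e) * e) * b powr (- (1 / e\<^sup>2) * e)"
      using C b by (simp add: D_def powr_mult powr_powr)
    also have "- (1 / e) * e = -1" using e by simp
    also have "- (1 / e\<^sup>2) * e = - (1 / e)" using e by (simp add: power2_eq_square)
    finally show ?thesis using C by (simp add: powr_minus)
  qed
  have bound: "Y j \<le> D * b powr (- (real j / e))" for j
  proof (induction j)
    case 0
    then show ?case using init b by (simp add: D_def)
  next
    case (Suc j)
    have "Y (Suc j) \<le> C * b ^ j * (D * b powr (- (real j / e))) powr (1 + e)"
      by (rule order_trans[OF step]) (use C b e Suc nonneg in \<open>auto intro!: mult_left_mono powr_mono2\<close>)
    also have "\<dots> = C * b powr real j * (D powr (1 + e) * b powr (- (real j / e) * (1 + e)))"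
      using b D by (simp add: powr_mult powr_powr powr_realpow)
    also have "\<dots> = (C * D powr e) * D * (b powr real j * b powr (- (real j / e) * (1 + e)))"
      using D by (simp add: powr_add)
    also have "\<dots> = D * b powr (- (1 / e) + (real j + - (real j / e) * (1 + e)))"
      unfolding De powr_add by (simp only: mult_ac)
    also have "- (1 / e) + (real j + - (real j / e) * (1 + e)) = - (real (Suc j) / e)"
      using e by (simp add: field_simps)
    finally show ?case .
  qed
  have "(\<lambda>j. D * (b powr (- (1 / e))) ^ j) \<longlonglongrightarrow> D * 0"
  proof (intro tendsto_mult tendsto_const LIMSEQ_power_zero)
    have "- (1 / e) < 0" using e by simp
    from powr_less_mono[OF this b] have "b powr (- (1 / e)) < 1" using b by (simp only: powr_zero_eq_one) simp
    then show "norm (b powr (- (1 / e))) < 1"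
      by (simp only: real_norm_def abs_of_nonneg[OF powr_ge_zero])
  qed
  moreover have "(b powr (- (1 / e))) ^ j = b powr (- (real j / e))" for j
  proof -
    have "(b powr (- (1 / e))) ^ j = (b powr (- (1 / e))) powr real j"
      using b by (subst powr_realpow) auto
    also have "\<dots> = b powr (- (real j / e))" unfolding powr_powr by simp
    finally show ?thesis .
  qed
  ultimately have lim: "(\<lambda>j. D * b powr (- (real j / e))) \<longlonglongrightarrow> 0"
    by (simp only: mult_zero_right)
  show ?thesis
  proof (rule tendsto_sandwich[OF _ _ tendsto_const lim])
    show "\<forall>\<^sub>F j in sequentially. 0 \<le> Y j" by (rule always_eventually) (simp add: nonneg)
    show "\<forall>\<^sub>F j in sequentially. Y j \<le> D * b powr (- (real j / e))"
      by (rule always_eventually) (use bound in blast)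
  qed
qed

lemma continuous_on_slices:
  fixes F :: "'a::topological_space \<Rightarrow> 'b::topological_space \<Rightarrow> 'c::topological_space"
  assumes "continuous_on (T \<times> X) (\<lambda>z. F (fst z) (snd z))"
  shows "t \<in> T \<Longrightarrow> continuous_on X (F t)" and "x \<in> X \<Longrightarrow> continuous_on T (\<lambda>t. F t x)"
proof -
  assume "t \<in> T"
  then have "continuous_on X ((\<lambda>z. F (fst z) (snd z)) \<circ> (\<lambda>x. (t, x)))"
    by (intro continuous_on_compose continuous_intros continuous_on_subset[OF assms]) auto
  then show "continuous_on X (F t)" by (simp add: comp_def)
next
  assume "x \<in> X"
  then have "continuous_on T ((\<lambda>z. F (fst z) (snd z)) \<circ> (\<lambda>t. (t, x)))"
    by (intro continuous_on_compose continuous_intros continuous_on_subset[OF assms]) auto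
  then show "continuous_on T (\<lambda>t. F t x)" by (simp add: comp_def)
qed

lemma time_slab_fubini:
  fixes H :: "real \<Rightarrow> 'a::euclidean_space \<Rightarrow> real"
  assumes K: "compact K" and cont: "continuous_on ({a..b} \<times> K) (\<lambda>z. H (fst z) (snd z))"
    and zero: "\<And>t x. t \<in> {a..b} \<Longrightarrow> x \<notin> K \<Longrightarrow> H t x = 0"
  shows "integrable lborel (\<lambda>t. indicator {a..b} t *\<^sub>R (\<integral>x. H t x \<partial>lborel))"
    and "(\<integral>x. (\<integral>t. indicator {a..b} t *\<^sub>R H t x \<partial>lborel) \<partial>lborel)
      = (\<integral>t. indicator {a..b} t *\<^sub>R (\<integral>x. H t x \<partial>lborel) \<partial>lborel)"
    and "\<And>t. t \<in> {a..b} \<Longrightarrow> integrable lborel (H t)"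
proof -
  define F where "F z = (if z \<in> {a..b} \<times> K then H (fst z) (snd z) else 0)" for z
  have F: "F (t, x) = indicator {a..b} t *\<^sub>R H t x" for t x
    using zero by (auto simp: F_def indicator_def)
  have c: "compact ({a..b} \<times> K)" by (intro compact_Times K compact_Icc)
  have cF: "continuous_on ({a..b} \<times> K) F"
    by (rule continuous_on_eq[OF cont]) (auto simp: F_def)
  have F0: "F z = 0" if "z \<notin> {a..b} \<times> K" for z using that by (simp add: F_def)
  note fub = fubini_compact_support[OF c cF F0, unfolded F]
  show "integrable lborel (\<lambda>t. indicator {a..b} t *\<^sub>R (\<integral>x. H t x \<partial>lborel))"
    using fub(2) by simp
  show "(\<integral>x. (\<integral>t. indicator {a..b} t *\<^sub>R H t x \<partial>lborel) \<partial>lborel)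
      = (\<integral>t. indicator {a..b} t *\<^sub>R (\<integral>x. H t x \<partial>lborel) \<partial>lborel)"
    using fub(1) by simp
  show "integrable lborel (H t)" if "t \<in> {a..b}" for t
  proof (rule integrable_continuous_compact_support[OF K])
    show "continuous_on K (H t)"
      by (rule continuous_on_slices(1)[OF cont that])
  qed (use zero that in auto)
qed

section \<open>Truncated solutions on the unit cylinder\<close>

definition energy_const :: "real \<Rightarrow> real \<Rightarrow> real" where
  "energy_const m K = 384 * K\<^sup>2 * (1/4) powr (m - 1) + 4 * K"

text \<open>Bounded positive classical solutions on the unit cylinder: \<open>g\<close> is the spatial gradient of \<open>u\<close> and \<open>Q\<close> the derivative of
the flux $u^{m-1} \nabla u = \nabla (u^m/m)$, whose divergence appears in \<open>eq\<close>.\<close>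
locale fast_diffusion_unit_cylinder =
  fixes m K :: real and u ut :: "real \<Rightarrow> 'a::euclidean_space \<Rightarrow> real"
    and g :: "real \<Rightarrow> 'a \<Rightarrow> 'a" and Q :: "real \<Rightarrow> 'a \<Rightarrow> 'a \<Rightarrow> 'a"
  assumes m: "m < 1" and K: "1 \<le> K"
    and pos: "\<And>t x. t \<in> {-1..0} \<Longrightarrow> x \<in> ball 0 1 \<Longrightarrow> 0 < u t x"
    and le_K: "\<And>t x. t \<in> {-1..0} \<Longrightarrow> x \<in> ball 0 1 \<Longrightarrow> u t x \<le> K"
    and ut: "\<And>t x. t \<in> {-1..0} \<Longrightarrow> x \<in> ball 0 1 \<Longrightarrow>
        ((\<lambda>t. u t x) has_real_derivative ut t x) (at t within {-1..0})"
    and g: "\<And>t x. t \<in> {-1..0} \<Longrightarrow> x \<in> ball 0 1 \<Longrightarrow>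
        ((\<lambda>x. u t x) has_derivative (\<lambda>v. g t x \<bullet> v)) (at x)"
    and Q: "\<And>t x. t \<in> {-1..0} \<Longrightarrow> x \<in> ball 0 1 \<Longrightarrow>
        ((\<lambda>x. u t x powr (m - 1) *\<^sub>R g t x) has_derivative Q t x) (at x)"
    and eq: "\<And>t x. t \<in> {-1..0} \<Longrightarrow> x \<in> ball 0 1 \<Longrightarrow> ut t x = (\<Sum>b\<in>Basis. Q t x b \<bullet> b)"
    and cont_u: "continuous_on ({-1..0} \<times> ball 0 1) (\<lambda>z. u (fst z) (snd z))"
    and cont_ut: "continuous_on ({-1..0} \<times> ball 0 1) (\<lambda>z. ut (fst z) (snd z))"
    and cont_g: "continuous_on ({-1..0} \<times> ball 0 1) (\<lambda>z. g (fst z) (snd z))"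
    and cont_Q: "\<And>b. b \<in> Basis \<Longrightarrow> continuous_on ({-1..0} \<times> ball 0 1) (\<lambda>z. Q (fst z) (snd z) b \<bullet> b)"
begin

text \<open>The barrier: it exceeds the upper bound \<open>K\<close> of the solution at time $-1$ and for $|x| \ge 1/2$, and it is at least \<open>k\<close> for $t \le 0$.\<close>
definition \<psi> :: "real \<Rightarrow> real \<Rightarrow> 'a \<Rightarrow> real" where
  "\<psi> k t x = k + 4 * K * (norm x)\<^sup>2 - K * t"

definition s :: "real \<Rightarrow> real \<Rightarrow> 'a \<Rightarrow> real" where
  "s k t x = (if x \<in> ball 0 1 then max (u t x - \<psi> k t x) 0 else 0)"

text \<open>The spatial gradient of \<open>s\<close> on the set where \<open>s\<close> is positive.\<close>
definition G :: "real \<Rightarrow> 'a \<Rightarrow> 'a" where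
  "G t x = (if x \<in> ball 0 1 then g t x - (8 * K) *\<^sub>R x else 0)"

definition q :: "real \<Rightarrow> 'a \<Rightarrow> 'a" where "q t x = u t x powr (m - 1) *\<^sub>R g t x"

definition mass :: "real \<Rightarrow> real" where
  "mass k = (\<integral>t. indicator {-1..0} t *\<^sub>R (\<integral>x. s k t x ^ 4 \<partial>lborel) \<partial>lborel)"

lemma s_nonneg [simp]: "0 \<le> s k t x" by (simp add: s_def)

lemma s_pos: "s k t x \<noteq> 0 \<Longrightarrow> 0 < s k t x"
  by (rule le_neq_trans[OF s_nonneg not_sym])

lemma s_neq_0D:
  assumes "s k t x \<noteq> 0"
  shows "x \<in> ball 0 1" "0 < u t x - \<psi> k t x" "s k t x = u t x - \<psi> k t x"
proof -
  show x: "x \<in> ball 0 1" using assms by (rule contrapos_np) (simp add: s_def)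
  show *: "0 < u t x - \<psi> k t x"
  proof (rule ccontr)
    assume "\<not> 0 < u t x - \<psi> k t x"
    then have "max (u t x - \<psi> k t x) 0 = 0" by (intro max_absorb2) simp
    then have "s k t x = 0" unfolding s_def by (simp only: if_cancel)
    then show False using assms by contradiction
  qed
  show "s k t x = u t x - \<psi> k t x"
    unfolding s_def if_P[OF x] by (rule max_absorb1[OF less_imp_le[OF *]])
qed

text \<open>The three effects of the barrier: \<open>s\<close> is supported well inside the cylinder, it vanishes at the initial time, and \<open>u\<close> is bounded below on its support, so that the equation is uniformly parabolic there.\<close>
lemma s_posD:
  assumes "0 < s k t x" "1/4 \<le> k" "t \<in> {-1..0}"
  shows "x \<in> ball 0 (1/2)" "1/4 \<le> u t x" "s k t x \<le> K" "-1 < t" "s k t x = u t x - \<psi> k t x"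
proof -
  have x: "x \<in> ball 0 1" and *: "0 < u t x - \<psi> k t x" and e: "s k t x = u t x - \<psi> k t x"
    using s_neq_0D[of k t x] assms(1) by simp_all
  have uK: "u t x \<le> K" using le_K assms x by auto
  have Kt: "K * t \<le> 0" using K assms(3) by (simp add: mult_le_0_iff)
  have nx: "0 \<le> 4 * K * (norm x)\<^sup>2" using K by simp
  show "s k t x = u t x - \<psi> k t x" by (rule e)
  show "1/4 \<le> u t x" using * assms(2) Kt nx unfolding \<psi>_def by linarith
  show "s k t x \<le> K" using e uK assms(2) Kt nx unfolding \<psi>_def by linarith
  have "4 * K * (norm x)\<^sup>2 < K * 1" using * uK assms(2) Kt unfolding \<psi>_def by linarith
  then have "K * (4 * (norm x)\<^sup>2) < K * 1" by (simp add: mult_ac)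
  then have "(norm x)\<^sup>2 < (1/2)\<^sup>2" using K by (simp add: mult_less_cancel_left_disj power2_eq_square)
  then show "x \<in> ball 0 (1/2)" using power_less_imp_less_base[of "norm x" 2 "1/2"] by simp
  show "-1 < t"
  proof (rule ccontr)
    assume "\<not> -1 < t"
    then have "t = -1" using assms(3) by auto
    then show False using * uK assms(2) nx unfolding \<psi>_def by simp
  qed
qed

lemma s_eq_0: "\<lbrakk>x \<notin> ball 0 (1/2) \<or> t = -1; 1/4 \<le> k; t \<in> {-1..0}\<rbrakk> \<Longrightarrow> s k t x = 0"
  using s_posD(1,4)[OF s_pos, of k t x] by fastforce

lemma s_zero_outside: "\<lbrakk>x \<notin> cball 0 (1/2); 1/4 \<le> k; t \<in> {-1..0}\<rbrakk> \<Longrightarrow> s k t x = 0"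
  by (rule s_eq_0) auto

lemma s_antimono: "k \<le> k' \<Longrightarrow> s k' t x \<le> s k t x"
  by (auto simp: s_def \<psi>_def)

text \<open>Where the higher truncation is positive, the lower one is at least \<open>h\<close>; each missing power may be paid for by a factor $1/h$.\<close>
lemma s_chebyshev: "0 < h \<Longrightarrow> s (k + h) t x ^ 2 \<le> s k t x ^ 4 / h\<^sup>2"
  and s_chebyshev3: "0 < h \<Longrightarrow> h \<le> 1 \<Longrightarrow> s (k + h) t x ^ 3 \<le> s k t x ^ 4 / h\<^sup>2"
proof -
  assume h: "0 < h"
  have le: "s (k + h) t x \<le> s k t x" using h by (intro s_antimono) simp
  have big: "h \<le> s k t x" if "s (k + h) t x \<noteq> 0"
  proof -
    have "h \<le> u t x - \<psi> k t x" using s_neq_0D(2)[OF that] by (simp add: \<psi>_def)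
    then show ?thesis unfolding s_def if_P[OF s_neq_0D(1)[OF that]] by (rule max.coboundedI1)
  qed
  show "s (k + h) t x ^ 2 \<le> s k t x ^ 4 / h\<^sup>2"
  proof (cases "s (k + h) t x = 0")
    case False
    have "s (k + h) t x ^ 2 * h ^ 2 \<le> s k t x ^ 2 * s k t x ^ 2"
      using le big[OF False] h by (intro mult_mono power_mono) auto
    also have "\<dots> = s k t x ^ 4" by (simp only: power2_eq_square power4_eq_xxxx mult.assoc)
    finally show ?thesis using h by (simp add: pos_le_divide_eq)
  qed simp
  assume h1: "h \<le> 1"
  show "s (k + h) t x ^ 3 \<le> s k t x ^ 4 / h\<^sup>2"
  proof (cases "s (k + h) t x = 0")
    case False
    have "s (k + h) t x ^ 3 * h ^ 2 \<le> s (k + h) t x ^ 3 * h"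
      using h h1 by (intro mult_left_mono) (auto simp: power2_eq_square)
    also have "\<dots> \<le> s k t x ^ 3 * s k t x"
      using le big[OF False] h by (intro mult_mono power_mono) auto
    also have "\<dots> = s k t x ^ 4" by (simp only: power3_eq_cube power4_eq_xxxx mult.assoc)
    finally show ?thesis using h by (simp add: pos_le_divide_eq)
  qed simp
qed

lemma cball_half_subset: "cball 0 (1/2) \<subseteq> ball (0::'a) 1" by auto

lemma cont_s: "continuous_on ({-1..0} \<times> ball 0 1) (\<lambda>z. s k (fst z) (snd z))"
proof -
  have "continuous_on ({-1..0} \<times> ball 0 1) (\<lambda>z. max (u (fst z) (snd z) - \<psi> k (fst z) (snd z)) 0)"
    unfolding \<psi>_def by (intro continuous_intros cont_u)
  then show ?thesis by (rule continuous_on_eq) (auto simp: s_def)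
qed

lemma cont_G: "continuous_on ({-1..0} \<times> ball 0 1) (\<lambda>z. G (fst z) (snd z))"
proof -
  have "continuous_on ({-1..0} \<times> ball 0 1) (\<lambda>z. g (fst z) (snd z) - (8 * K) *\<^sub>R snd z)"
    by (intro continuous_intros cont_g)
  then show ?thesis by (rule continuous_on_eq) (auto simp: G_def)
qed

lemma cont_q: "continuous_on ({-1..0} \<times> ball 0 1) (\<lambda>z. q (fst z) (snd z))"
  unfolding q_def by (intro continuous_intros cont_g cont_u) (use pos in force)

lemma power_s_has_derivative:
  assumes t: "t \<in> {-1..0}" and k: "1/4 \<le> k"
  shows "((\<lambda>x. s k t x ^ Suc (Suc n)) has_derivative
    (\<lambda>v. (real (Suc (Suc n)) * s k t x ^ Suc n) *\<^sub>R G t x \<bullet> v)) (at x)"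
proof (cases "x \<in> ball 0 1")
  case True
  have sq: "((\<lambda>x::'a. 4 * K * (norm x)\<^sup>2) has_derivative (\<lambda>v. (8 * K) *\<^sub>R x \<bullet> v)) (at x)"
    unfolding power2_norm_eq_inner
    by (rule has_derivative_eq_rhs[OF has_derivative_mult_right[OF
          has_derivative_inner[OF has_derivative_ident has_derivative_ident]]])
      (simp add: fun_eq_iff inner_commute)
  have "((\<lambda>x. u t x - (k + 4 * K * (norm x)\<^sup>2 - K * t)) has_derivative
      (\<lambda>v. g t x \<bullet> v - (0 + (8 * K) *\<^sub>R x \<bullet> v - 0))) (at x)"
    by (intro has_derivative_diff has_derivative_add has_derivative_const g[OF t True] sq)
  then have "((\<lambda>x. u t x - \<psi> k t x) has_derivative (\<lambda>v. G t x \<bullet> v)) (at x)"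
    unfolding \<psi>_def G_def if_P[OF True] by (simp add: inner_diff_left)
  from has_derivative_compose[OF this has_derivative_positive_part_power[unfolded has_field_derivative_def]]
  have "((\<lambda>x. max (u t x - \<psi> k t x) 0 ^ Suc (Suc n)) has_derivative
    (\<lambda>v. (real (Suc (Suc n)) * s k t x ^ Suc n) *\<^sub>R G t x \<bullet> v)) (at x)"
    by (simp only: s_def if_P[OF True] inner_scaleR_left)
  then show ?thesis
    by (rule has_derivative_transform_within_open[OF _ open_ball True]) (simp add: s_def)
next
  case False
  then have x: "x \<in> - cball 0 (1/2)" by auto
  have "((\<lambda>x. s k t x ^ Suc (Suc n)) has_derivative (\<lambda>v. 0)) (at x)"
  proof (rule has_derivative_transform_within_open[OF has_derivative_const _ x])
    show "open (- cball (0::'a) (1/2))" by (rule open_Compl[OF closed_cball])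
    show "0 = s k t y ^ Suc (Suc n)" if "y \<in> - cball 0 (1/2)" for y
      using s_zero_outside[OF ComplD[OF that] k t] by simp
  qed
  then show ?thesis unfolding G_def if_not_P[OF False] by simp
qed

lemma cont_power_s_G:
  assumes t: "t \<in> {-1..0}" and k: "1/4 \<le> k"
  shows "continuous_on UNIV (\<lambda>x. (c * s k t x ^ Suc n) *\<^sub>R G t x)"
proof -
  have "continuous_on (ball 0 1) (\<lambda>x. (c * s k t x ^ Suc n) *\<^sub>R G t x)"
    by (intro continuous_intros continuous_on_slices(1)[OF cont_s t] continuous_on_slices(1)[OF cont_G t])
  moreover have "continuous_on (- cball 0 (1/2)) (\<lambda>x. (c * s k t x ^ Suc n) *\<^sub>R G t x)"
  proof (rule continuous_on_eq[OF continuous_on_const])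
    show "0 = (c * s k t x ^ Suc n) *\<^sub>R G t x" if "x \<in> - cball 0 (1/2)" for x
      using s_zero_outside[OF ComplD[OF that] k t] by simp
  qed
  ultimately have "continuous_on (ball 0 1 \<union> - cball 0 (1/2)) (\<lambda>x. (c * s k t x ^ Suc n) *\<^sub>R G t x)"
    by (intro continuous_on_open_Un open_Compl closed_cball open_ball)
  moreover have "ball 0 1 \<union> - cball 0 (1/2) = (UNIV :: 'a set)" by auto
  ultimately show ?thesis by simp
qed

lemma power_s_has_time_derivative:
  assumes t: "t \<in> {-1..0}" and x: "x \<in> ball 0 1"
  shows "((\<lambda>t. s k t x ^ Suc (Suc n)) has_real_derivative
    real (Suc (Suc n)) * s k t x ^ Suc n * (ut t x + K)) (at t within {-1..0})"
proof -
  have "((\<lambda>t. u t x - \<psi> k t x) has_real_derivative ut t x + K) (at t within {-1..0})"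
    unfolding \<psi>_def by (auto intro!: derivative_eq_intros ut[OF t x])
  from DERIV_chain2[OF has_derivative_positive_part_power this]
  show ?thesis using x by (simp add: s_def)
qed

lemmas unit_slab_fubini = time_slab_fubini[where K="cball 0 (1/2)", OF compact_cball]

lemma cont_half:
  "continuous_on ({-1..0::real} \<times> ball 0 1) F \<Longrightarrow> \<tau> \<le> 0 \<Longrightarrow> continuous_on ({-1..\<tau>} \<times> cball (0::'a) (1/2)) F"
  by (erule continuous_on_subset, intro Sigma_mono) auto

section \<open>The energy inequality\<close>

lemma integral_divergence_term:
  assumes t: "t \<in> {-1..0}" and k: "1/4 \<le> k"
  shows "(\<integral>x. s k t x ^ 3 * ut t x \<partial>lborel) = - (\<integral>x. 3 * s k t x ^ 2 * (G t x \<bullet> q t x) \<partial>lborel)"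
proof -
  have ibp: "(\<integral>x. (q t x \<bullet> b) * ((3 * s k t x ^ 2) *\<^sub>R G t x \<bullet> b) \<partial>lborel)
      = - (\<integral>x. (Q t x b \<bullet> b) * s k t x ^ 3 \<partial>lborel)"
    "integrable lborel (\<lambda>x. (q t x \<bullet> b) * ((3 * s k t x ^ 2) *\<^sub>R G t x \<bullet> b))"
    "integrable lborel (\<lambda>x. (Q t x b \<bullet> b) * s k t x ^ 3)" if b: "b \<in> Basis" for b
  proof -
    have F: "((\<lambda>x. q t x \<bullet> b) has_derivative (\<lambda>v. Q t x v \<bullet> b)) (at x)" if "x \<in> ball 0 1" for x
      unfolding q_def by (intro has_derivative_inner_left Q[OF t that])
    have cF: "continuous_on (ball 0 1) (\<lambda>x. Q t x b \<bullet> b)"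
      by (rule continuous_on_slices(1)[OF cont_Q[OF b] t])
    have P: "((\<lambda>x. s k t x ^ 3) has_derivative (\<lambda>v. (3 * s k t x ^ 2) *\<^sub>R G t x \<bullet> v)) (at x)" for x
      using power_s_has_derivative[OF t k, of 1 x] by (simp add: numeral_eq_Suc)
    have cP: "continuous_on UNIV (\<lambda>x. (3 * s k t x ^ 2) *\<^sub>R G t x \<bullet> b)"
      using continuous_on_inner[OF cont_power_s_G[OF t k, of 3 1] continuous_on_const, of b]
      by (simp only: power_Suc numeral_2_eq_2 One_nat_def)
    note I = integral_by_parts_compact_support[OF open_ball F cF P cP compact_cball cball_half_subset]
    have z: "s k t x ^ 3 = 0" if "x \<notin> cball 0 (1/2)" for x using s_zero_outside[OF that k t] by simp
    show "(\<integral>x. (q t x \<bullet> b) * ((3 * s k t x ^ 2) *\<^sub>R G t x \<bullet> b) \<partial>lborel)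
      = - (\<integral>x. (Q t x b \<bullet> b) * s k t x ^ 3 \<partial>lborel)" using z by (intro I)
    show "integrable lborel (\<lambda>x. (q t x \<bullet> b) * ((3 * s k t x ^ 2) *\<^sub>R G t x \<bullet> b))" using z by (intro I)
    show "integrable lborel (\<lambda>x. (Q t x b \<bullet> b) * s k t x ^ 3)" using z by (intro I)
  qed
  have "(\<integral>x. s k t x ^ 3 * ut t x \<partial>lborel) = (\<integral>x. (\<Sum>b\<in>Basis. (Q t x b \<bullet> b) * s k t x ^ 3) \<partial>lborel)"
  proof (rule Bochner_Integration.integral_cong)
    show "s k t x ^ 3 * ut t x = (\<Sum>b\<in>Basis. (Q t x b \<bullet> b) * s k t x ^ 3)" for x
    proof (cases "x \<in> ball 0 1")
      case True
      then show ?thesis using eq[OF t True] by (simp add: sum_distrib_right mult.commute[of "s k t x ^ 3"])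
    qed (simp add: s_def)
  qed simp
  also have "\<dots> = (\<Sum>b\<in>Basis. (\<integral>x. (Q t x b \<bullet> b) * s k t x ^ 3 \<partial>lborel))"
    by (rule Bochner_Integration.integral_sum) (use ibp in auto)
  also have "\<dots> = - (\<Sum>b\<in>Basis. (\<integral>x. (q t x \<bullet> b) * ((3 * s k t x ^ 2) *\<^sub>R G t x \<bullet> b) \<partial>lborel))"
    using ibp(1) by (simp add: sum_negf)
  also have "(\<Sum>b\<in>Basis. (\<integral>x. (q t x \<bullet> b) * ((3 * s k t x ^ 2) *\<^sub>R G t x \<bullet> b) \<partial>lborel))
     = (\<integral>x. (\<Sum>b\<in>Basis. (q t x \<bullet> b) * ((3 * s k t x ^ 2) *\<^sub>R G t x \<bullet> b)) \<partial>lborel)"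
    by (rule Bochner_Integration.integral_sum[symmetric]) (use ibp in auto)
  also have "(\<lambda>x. \<Sum>b\<in>Basis. (q t x \<bullet> b) * ((3 * s k t x ^ 2) *\<^sub>R G t x \<bullet> b))
      = (\<lambda>x. 3 * s k t x ^ 2 * (G t x \<bullet> q t x))"
    by (auto simp: euclidean_inner[of "G t _" "q t _"] sum_distrib_left mult_ac)
  finally show ?thesis .
qed


text \<open>Here $q = u^{m-1}(G + 8Kx)$; the term linear in $G$ that comes from the barrier is absorbed by half of the quadratic one, and $K^{m-1} \le u^{m-1} \le (1/4)^{m-1}$ because $m < 1$.\<close>
lemma energy_integrand:
  assumes t: "t \<in> {-1..0}" and k: "1/4 \<le> k"
  shows "- 12 * (s k t x ^ 2 * (G t x \<bullet> q t x)) + 4 * K * s k t x ^ 3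
    \<le> - 6 * K powr (m - 1) * (s k t x ^ 2 * (norm (G t x))\<^sup>2) + energy_const m K * (s k t x ^ 2 + s k t x ^ 3)"
proof (cases "s k t x = 0")
  case False
  then have "0 < s k t x" by (rule s_pos)
  note S = s_posD[OF this k t]
  have x: "x \<in> ball 0 1" and nx: "norm x \<le> 1" using S(1) by auto
  define a where "a = u t x powr (m - 1)"
  have a0: "0 \<le> a" by (simp add: a_def)
  have a1: "K powr (m - 1) \<le> a" unfolding a_def
    using pos[OF t x] le_K[OF t x] m by (intro powr_mono2') auto
  have a2: "a \<le> (1/4) powr (m - 1)" unfolding a_def
    using S(2) m by (intro powr_mono2') auto
  have q: "q t x = a *\<^sub>R G t x + (a * 8 * K) *\<^sub>R x"
    using x by (simp add: q_def G_def a_def algebra_simps)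
  have cs: "\<bar>G t x \<bullet> x\<bar> \<le> norm (G t x)"
    using Cauchy_Schwarz_ineq2[of "G t x" x] nx mult_left_le[of "norm x" "norm (G t x)"] by simp
  have "- (G t x \<bullet> q t x) = - a * (norm (G t x))\<^sup>2 - a * (8 * K * (G t x \<bullet> x))"
    by (simp add: q inner_add_right power2_norm_eq_inner algebra_simps)
  also have "\<dots> \<le> - a * (norm (G t x))\<^sup>2 + a * ((norm (G t x))\<^sup>2 / 2 + 32 * K\<^sup>2)"
  proof -
    have "- (8 * K * (G t x \<bullet> x)) \<le> 8 * K * norm (G t x)"
      using mult_left_mono[of "- (G t x \<bullet> x)" "norm (G t x)" "8 * K"] cs K by (simp add: abs_le_iff)
    also have "\<dots> \<le> (norm (G t x))\<^sup>2 / 2 + 32 * K\<^sup>2"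
      using zero_le_power2[of "norm (G t x) - 8 * K"] by (simp add: power2_eq_square algebra_simps)
    finally show ?thesis using mult_left_mono[OF _ a0] by fastforce
  qed
  also have "\<dots> = - (1/2) * (a * (norm (G t x))\<^sup>2) + a * (32 * K\<^sup>2)" by (simp add: algebra_simps)
  also have "\<dots> \<le> - (1/2) * (K powr (m - 1) * (norm (G t x))\<^sup>2) + (1/4) powr (m - 1) * (32 * K\<^sup>2)"
    using mult_right_mono[OF a1, of "(norm (G t x))\<^sup>2"] mult_right_mono[OF a2, of "32 * K\<^sup>2"] by simp
  finally have "12 * s k t x ^ 2 * - (G t x \<bullet> q t x)
    \<le> 12 * s k t x ^ 2 * (- (1/2) * (K powr (m - 1) * (norm (G t x))\<^sup>2) + (1/4) powr (m - 1) * (32 * K\<^sup>2))"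
    by (intro mult_left_mono) auto
  moreover have "0 \<le> 4 * K * s k t x ^ 2" "0 \<le> 384 * K\<^sup>2 * (1/4) powr (m - 1) * s k t x ^ 3"
    using K by (auto intro!: mult_nonneg_nonneg)
  ultimately show ?thesis unfolding energy_const_def by (simp only: algebra_simps mult_minus_right mult_minus_left)
qed simp

text \<open>Differentiate $s^4$ in time, integrate over the slab and exchange the integrals; the truncation vanishes at the initial time, hence there is no initial term.\<close>
lemma energy_inequality:
  assumes \<tau>: "\<tau> \<in> {-1..0}" and k: "1/4 \<le> k"
  shows "(\<integral>x. s k \<tau> x ^ 4 \<partial>lborel)
      + 6 * K powr (m - 1) * (\<integral>t. indicator {-1..\<tau>} t *\<^sub>R (\<integral>x. s k t x ^ 2 * (norm (G t x))\<^sup>2 \<partial>lborel) \<partial>lborel)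
    \<le> energy_const m K * (\<integral>t. indicator {-1..\<tau>} t *\<^sub>R (\<integral>x. s k t x ^ 2 + s k t x ^ 3 \<partial>lborel) \<partial>lborel)"
proof -
  have \<tau>0: "\<tau> \<le> 0" using \<tau> by simp
  have sub: "t \<in> {-1..0}" if "t \<in> {-1..\<tau>}" for t using that \<tau> by auto
  have z: "s k t x = 0" if "t \<in> {-1..\<tau>}" "x \<notin> cball 0 (1/2)" for t x
    by (rule s_zero_outside[OF that(2) k sub[OF that(1)]])
  let ?H = "\<lambda>t x. 4 * s k t x ^ 3 * (ut t x + K)"
  have cH: "continuous_on ({-1..\<tau>} \<times> cball 0 (1/2)) (\<lambda>z. ?H (fst z) (snd z))"
    by (intro cont_half \<tau>0 continuous_intros cont_s cont_ut)
  let ?E = "\<lambda>t x. s k t x ^ 2 * (norm (G t x))\<^sup>2"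
  have cE: "continuous_on ({-1..\<tau>} \<times> cball 0 (1/2)) (\<lambda>z. ?E (fst z) (snd z))"
    by (intro cont_half \<tau>0 continuous_intros cont_s cont_G)
  let ?B = "\<lambda>t x. s k t x ^ 2 + s k t x ^ 3"
  have cB: "continuous_on ({-1..\<tau>} \<times> cball 0 (1/2)) (\<lambda>z. ?B (fst z) (snd z))"
    by (intro cont_half \<tau>0 continuous_intros cont_s)
  let ?D = "\<lambda>t x. s k t x ^ 2 * (G t x \<bullet> q t x)"
  have cD: "continuous_on ({-1..\<tau>} \<times> cball 0 (1/2)) (\<lambda>z. ?D (fst z) (snd z))"
    by (intro cont_half \<tau>0 continuous_intros cont_s cont_G cont_q)
  let ?S = "\<lambda>t x. s k t x ^ 3"
  have cS: "continuous_on ({-1..\<tau>} \<times> cball 0 (1/2)) (\<lambda>z. ?S (fst z) (snd z))"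
    by (intro cont_half \<tau>0 continuous_intros cont_s)
  let ?U = "\<lambda>t x. s k t x ^ 3 * ut t x"
  have cU: "continuous_on ({-1..\<tau>} \<times> cball 0 (1/2)) (\<lambda>z. ?U (fst z) (snd z))"
    by (intro cont_half \<tau>0 continuous_intros cont_s cont_ut)
  note fH = unit_slab_fubini[OF cH] and fE = unit_slab_fubini[OF cE] and fB = unit_slab_fubini[OF cB] and fD = unit_slab_fubini[OF cD] and fS = unit_slab_fubini[OF cS]
    and fU = unit_slab_fubini[OF cU]
  have iE: "integrable lborel (\<lambda>t. indicator {-1..\<tau>} t *\<^sub>R (\<integral>x. ?E t x \<partial>lborel))"
    by (rule fE(1)) (use z in auto)
  have iB: "integrable lborel (\<lambda>t. indicator {-1..\<tau>} t *\<^sub>R (\<integral>x. ?B t x \<partial>lborel))"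
    by (rule fB(1)) (use z in auto)
  have time: "s k \<tau> x ^ 4 = (\<integral>t. indicator {-1..\<tau>} t *\<^sub>R ?H t x \<partial>lborel)" for x
  proof (cases "x \<in> ball 0 1")
    case True
    have "(\<integral>t. indicator {-1..\<tau>} t *\<^sub>R ?H t x \<partial>lborel) = s k \<tau> x ^ 4 - s k (-1) x ^ 4"
    proof (rule integral_FTC_atLeastAtMost)
      show "-1 \<le> \<tau>" using \<tau> by simp
      show "((\<lambda>t. s k t x ^ 4) has_vector_derivative ?H t x) (at t within {-1..\<tau>})" if "-1 \<le> t" "t \<le> \<tau>" for t
      proof -
        have "((\<lambda>t. s k t x ^ 4) has_real_derivative ?H t x) (at t within {-1..0})"
          using power_s_has_time_derivative[OF _ True, of t k 2] that \<tau>0 by (simp add: numeral_eq_Suc)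
        then have "((\<lambda>t. s k t x ^ 4) has_real_derivative ?H t x) (at t within {-1..\<tau>})"
          by (rule DERIV_subset) (use \<tau>0 in auto)
        then show ?thesis by (simp add: has_real_derivative_iff_has_vector_derivative)
      qed
      have "continuous_on ({-1..0} \<times> ball 0 1) (\<lambda>z. ?H (fst z) (snd z))"
        by (intro continuous_intros cont_s cont_ut)
      from continuous_on_subset[OF continuous_on_slices(2)[OF this True]]
      show "continuous_on {-1..\<tau>} (\<lambda>t. ?H t x)" using \<tau>0 by auto
    qed
    also have "s k (-1) x = 0" by (rule s_eq_0) (use k in auto)
    finally show ?thesis by simp
  qed (simp add: s_def)
  have "(\<integral>x. s k \<tau> x ^ 4 \<partial>lborel) = (\<integral>x. (\<integral>t. indicator {-1..\<tau>} t *\<^sub>R ?H t x \<partial>lborel) \<partial>lborel)"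
    by (rule Bochner_Integration.integral_cong[OF refl time])
  also have "\<dots> = (\<integral>t. indicator {-1..\<tau>} t *\<^sub>R (\<integral>x. ?H t x \<partial>lborel) \<partial>lborel)"
    by (rule fH(2)) (use z in auto)
  also have "\<dots> \<le> (\<integral>t. (- 6 * K powr (m - 1)) * (indicator {-1..\<tau>} t *\<^sub>R (\<integral>x. ?E t x \<partial>lborel))
      + energy_const m K * (indicator {-1..\<tau>} t *\<^sub>R (\<integral>x. ?B t x \<partial>lborel)) \<partial>lborel)"
  proof (rule integral_mono)
    show "integrable lborel (\<lambda>t. indicator {-1..\<tau>} t *\<^sub>R (\<integral>x. ?H t x \<partial>lborel))"
      by (rule fH(1)) (use z in auto)
    show "integrable lborel (\<lambda>t. (- 6 * K powr (m - 1)) * (indicator {-1..\<tau>} t *\<^sub>R (\<integral>x. ?E t x \<partial>lborel))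
      + energy_const m K * (indicator {-1..\<tau>} t *\<^sub>R (\<integral>x. ?B t x \<partial>lborel)))"
      by (intro Bochner_Integration.integrable_add integrable_mult_right iE iB)
    show "indicator {-1..\<tau>} t *\<^sub>R (\<integral>x. ?H t x \<partial>lborel)
      \<le> (- 6 * K powr (m - 1)) * (indicator {-1..\<tau>} t *\<^sub>R (\<integral>x. ?E t x \<partial>lborel))
      + energy_const m K * (indicator {-1..\<tau>} t *\<^sub>R (\<integral>x. ?B t x \<partial>lborel))" for t
    proof (cases "t \<in> {-1..\<tau>}")
      case True
      have iU: "integrable lborel (?U t)" and iS: "integrable lborel (?S t)" and iD: "integrable lborel (?D t)"
        and iE: "integrable lborel (?E t)" and iB: "integrable lborel (?B t)"
        by (rule fU(3) fS(3) fD(3) fE(3) fB(3), use z True in auto)+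
      have "(\<integral>x. ?H t x \<partial>lborel) = (\<integral>x. 4 * ?U t x + 4 * K * ?S t x \<partial>lborel)"
        by (simp add: algebra_simps)
      also have "\<dots> = 4 * (\<integral>x. ?U t x \<partial>lborel) + 4 * K * (\<integral>x. ?S t x \<partial>lborel)"
        using iU iS by simp
      also have "(\<integral>x. ?U t x \<partial>lborel) = - 3 * (\<integral>x. ?D t x \<partial>lborel)"
        using integral_divergence_term[OF sub[OF True] k] by (simp add: mult.assoc)
      also have "4 * (- 3 * (\<integral>x. ?D t x \<partial>lborel)) + 4 * K * (\<integral>x. ?S t x \<partial>lborel)
          = (\<integral>x. - 12 * ?D t x + 4 * K * ?S t x \<partial>lborel)"
        using iD iS by simp
      also have "\<dots> \<le> (\<integral>x. - 6 * K powr (m - 1) * ?E t x + energy_const m K * ?B t x \<partial>lborel)"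
        by (rule integral_mono) (use iD iS iE iB energy_integrand[OF sub[OF True] k] in auto)
      also have "\<dots> = - 6 * K powr (m - 1) * (\<integral>x. ?E t x \<partial>lborel) + energy_const m K * (\<integral>x. ?B t x \<partial>lborel)"
        using iE iB by simp
      finally show ?thesis using True by simp
    qed simp
  qed
  also have "\<dots> = - 6 * K powr (m - 1) * (\<integral>t. indicator {-1..\<tau>} t *\<^sub>R (\<integral>x. ?E t x \<partial>lborel) \<partial>lborel)
      + energy_const m K * (\<integral>t. indicator {-1..\<tau>} t *\<^sub>R (\<integral>x. ?B t x \<partial>lborel) \<partial>lborel)"
    by (simp only: Bochner_Integration.integral_add[OF integrable_mult_right[OF iE] integrable_mult_right[OF iB]]
      integral_mult_right_zero)
  finally show ?thesis by simp
qed

end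

section \<open>Decay of the truncated mass\<close>

lemma continuous_nonneg_integral_le_0_imp_0:
  fixes f :: "'a::euclidean_space \<Rightarrow> real"
  assumes cont: "continuous_on UNIV f" and int: "integrable lborel f" and nonneg: "\<And>x. 0 \<le> f x"
    and le: "(\<integral>x. f x \<partial>lborel) \<le> 0"
  shows "f x = 0"
proof (rule ccontr)
  assume "f x \<noteq> 0"
  then have pos: "0 < f x" by (rule le_neq_trans[OF nonneg not_sym])
  have "open {y. f x / 2 < f y}"
    by (rule open_Collect_less[OF continuous_on_const cont])
  then obtain r where r: "0 < r" "ball x r \<subseteq> {y. f x / 2 < f y}"
    using pos by (elim openE[of _ x]) auto
  have "0 < f x / 2 * measure lborel (ball x r)" using pos r(1) by simp
  also have "\<dots> = (\<integral>y. indicator (ball x r) y *\<^sub>R (f x / 2) \<partial>lborel)" by simp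
  also have "\<dots> \<le> (\<integral>y. f y \<partial>lborel)"
  proof (rule integral_mono[OF _ int])
    have "emeasure lborel (ball x r) < \<infinity>"
      using emeasure_bounded_finite[OF bounded_ball] by (simp add: less_top)
    then show "integrable lborel (\<lambda>y. indicator (ball x r) y *\<^sub>R (f x / 2))"
      by (intro integrable_scaleR_left integrable_real_indicator) auto
    show "indicator (ball x r) y *\<^sub>R (f x / 2) \<le> f y" for y
    proof (cases "y \<in> ball x r")
      case True
      then show ?thesis using r(2) by fastforce
    qed (simp add: nonneg)
  qed
  finally show False using le by simp
qed

context fast_diffusion_unit_cylinder begin

lemma energy_const_pos: "0 < energy_const m K"
  using K unfolding energy_const_def by (intro add_nonneg_pos mult_nonneg_nonneg) auto

lemma integrable_over_slab:
  assumes "1/4 \<le> k" and \<tau>: "\<tau> \<in> {-1..0}"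
    and cont: "continuous_on ({-1..0} \<times> ball 0 1) (\<lambda>z. F (fst z) (snd z))"
  shows "integrable lborel (\<lambda>t. indicator {-1..\<tau>} t *\<^sub>R (\<integral>x. s k t x ^ Suc n * F t x \<partial>lborel))"
    and "\<And>t. t \<in> {-1..\<tau>} \<Longrightarrow> integrable lborel (\<lambda>x. s k t x ^ Suc n * F t x)"
proof -
  have c: "continuous_on ({-1..\<tau>} \<times> cball 0 (1/2)) (\<lambda>z. s k (fst z) (snd z) ^ Suc n * F (fst z) (snd z))"
    by (intro cont_half continuous_intros cont_s cont) (use \<tau> in auto)
  have z: "s k t x ^ Suc n * F t x = 0" if "t \<in> {-1..\<tau>}" "x \<notin> cball 0 (1/2)" for t x
    using s_zero_outside[OF that(2) assms(1), of t] that(1) \<tau> by simp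
  show "integrable lborel (\<lambda>t. indicator {-1..\<tau>} t *\<^sub>R (\<integral>x. s k t x ^ Suc n * F t x \<partial>lborel))"
    by (rule unit_slab_fubini(1)[OF c]) (rule z)
  show "\<And>t. t \<in> {-1..\<tau>} \<Longrightarrow> integrable lborel (\<lambda>x. s k t x ^ Suc n * F t x)"
    by (rule unit_slab_fubini(3)[OF c]) (rule z)
qed

lemma integrable_powers:
  assumes "1/4 \<le> k" and \<tau>: "\<tau> \<in> {-1..0}"
  shows "integrable lborel (\<lambda>x. s k \<tau> x ^ 2)" "integrable lborel (\<lambda>x. s k \<tau> x ^ 3)" "integrable lborel (\<lambda>x. s k \<tau> x ^ 4)"
    "integrable lborel (\<lambda>t. indicator {-1..\<tau>} t *\<^sub>R (\<integral>x. s k t x ^ 2 \<partial>lborel))"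
    "integrable lborel (\<lambda>t. indicator {-1..\<tau>} t *\<^sub>R (\<integral>x. s k t x ^ 3 \<partial>lborel))"
    "integrable lborel (\<lambda>t. indicator {-1..\<tau>} t *\<^sub>R (\<integral>x. s k t x ^ 4 \<partial>lborel))"
proof -
  note facts = integrable_over_slab[where F="\<lambda>_ _. 1", OF assms continuous_on_const, unfolded mult_1_right]
  have "\<tau> \<in> {-1..\<tau>}" using \<tau> by simp
  note facts2 = facts(2)[OF this]
  show "integrable lborel (\<lambda>x. s k \<tau> x ^ 2)" "integrable lborel (\<lambda>x. s k \<tau> x ^ 3)" "integrable lborel (\<lambda>x. s k \<tau> x ^ 4)"
    using facts2[of 1] facts2[of 2] facts2[of 3] by (simp_all only: eval_nat_numeral BitM.simps One_nat_def)
  show "integrable lborel (\<lambda>t. indicator {-1..\<tau>} t *\<^sub>R (\<integral>x. s k t x ^ 2 \<partial>lborel))"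
    "integrable lborel (\<lambda>t. indicator {-1..\<tau>} t *\<^sub>R (\<integral>x. s k t x ^ 3 \<partial>lborel))"
    "integrable lborel (\<lambda>t. indicator {-1..\<tau>} t *\<^sub>R (\<integral>x. s k t x ^ 4 \<partial>lborel))"
    using facts(1)[of 1] facts(1)[of 2] facts(1)[of 3] by (simp_all only: eval_nat_numeral BitM.simps One_nat_def)
qed

lemma mass_antimono:
  assumes "1/4 \<le> k" "k \<le> k'"
  shows "mass k' \<le> mass k"
  unfolding mass_def
proof (rule integral_mono)
  show "indicator {-1..0} t *\<^sub>R (\<integral>x. s k' t x ^ 4 \<partial>lborel) \<le> indicator {-1..0} t *\<^sub>R (\<integral>x. s k t x ^ 4 \<partial>lborel)" for t
  proof (cases "t \<in> {-1..0}")
    case True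
    have "(\<integral>x. s k' t x ^ 4 \<partial>lborel) \<le> (\<integral>x. s k t x ^ 4 \<partial>lborel)"
      by (intro integral_mono integrable_powers power_mono s_antimono s_nonneg True) (use assms in auto)
    then show ?thesis using True by simp
  qed simp
qed (use integrable_powers(6)[of _ 0] assms in auto)

lemma mass_nonneg: "0 \<le> mass k"
  unfolding mass_def by (intro Bochner_Integration.integral_nonneg scaleR_nonneg_nonneg) auto

text \<open>Raising the level by \<open>h\<close> makes the lower order right-hand side of the energy inequality controllable by the mass at the lower level.\<close>
lemma energy_le_mass:
  assumes k: "1/4 \<le> k" and h: "0 < h" "h \<le> 1" and \<tau>: "\<tau> \<in> {-1..0}"
  shows "(\<integral>x. s (k + h) \<tau> x ^ 4 \<partial>lborel)
      + 6 * K powr (m - 1) * (\<integral>t. indicator {-1..\<tau>} t *\<^sub>R (\<integral>x. s (k + h) t x ^ 2 * (norm (G t x))\<^sup>2 \<partial>lborel) \<partial>lborel)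
    \<le> 2 * energy_const m K / h\<^sup>2 * mass k"
proof -
  have k': "1/4 \<le> k + h" using k h by simp
  have "(\<integral>t. indicator {-1..\<tau>} t *\<^sub>R (\<integral>x. s (k+h) t x ^ 2 + s (k+h) t x ^ 3 \<partial>lborel) \<partial>lborel)
      \<le> (\<integral>t. 2 / h\<^sup>2 * (indicator {-1..0} t *\<^sub>R (\<integral>x. s k t x ^ 4 \<partial>lborel)) \<partial>lborel)"
  proof (rule integral_mono)
    have "indicator {-1..\<tau>} t *\<^sub>R (\<integral>x. s (k+h) t x ^ 2 + s (k+h) t x ^ 3 \<partial>lborel)
       = indicator {-1..\<tau>} t *\<^sub>R (\<integral>x. s (k+h) t x ^ 2 \<partial>lborel) + indicator {-1..\<tau>} t *\<^sub>R (\<integral>x. s (k+h) t x ^ 3 \<partial>lborel)" for t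
    proof (cases "t \<in> {-1..\<tau>}")
      case True
      then have "t \<in> {-1..0}" using \<tau> by auto
      then show ?thesis using True integrable_powers(1,2)[OF k'] by simp
    qed simp
    then show "integrable lborel (\<lambda>t. indicator {-1..\<tau>} t *\<^sub>R (\<integral>x. s (k+h) t x ^ 2 + s (k+h) t x ^ 3 \<partial>lborel))"
      using Bochner_Integration.integrable_add[OF integrable_powers(4,5)[OF k' \<tau>]] by simp
    show "integrable lborel (\<lambda>t. 2 / h\<^sup>2 * (indicator {-1..0} t *\<^sub>R (\<integral>x. s k t x ^ 4 \<partial>lborel)))"
      by (intro integrable_mult_right integrable_powers(6) k) auto
    show "indicator {-1..\<tau>} t *\<^sub>R (\<integral>x. s (k+h) t x ^ 2 + s (k+h) t x ^ 3 \<partial>lborel)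
      \<le> 2 / h\<^sup>2 * (indicator {-1..0} t *\<^sub>R (\<integral>x. s k t x ^ 4 \<partial>lborel))" for t
    proof (cases "t \<in> {-1..\<tau>}")
      case True
      then have t: "t \<in> {-1..0}" using \<tau> by auto
      have "(\<integral>x. s (k+h) t x ^ 2 + s (k+h) t x ^ 3 \<partial>lborel) \<le> (\<integral>x. 2 / h\<^sup>2 * s k t x ^ 4 \<partial>lborel)"
      proof (rule integral_mono)
        show "s (k+h) t x ^ 2 + s (k+h) t x ^ 3 \<le> 2 / h\<^sup>2 * s k t x ^ 4" for x
          using s_chebyshev[OF h(1), of k t x] s_chebyshev3[OF h, of k t x] by simp
      qed (intro Bochner_Integration.integrable_add integrable_mult_right integrable_powers k k' t)+
      then show ?thesis using True t by simp
    next
      case False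
      have "0 \<le> 2 / h\<^sup>2 * (indicator {-1..0} t *\<^sub>R (\<integral>x. s k t x ^ 4 \<partial>lborel))"
        by (intro mult_nonneg_nonneg scaleR_nonneg_nonneg Bochner_Integration.integral_nonneg) auto
      then show ?thesis using False by simp
    qed
  qed
  also have "\<dots> = 2 / h\<^sup>2 * mass k" by (simp only: integral_mult_right_zero mass_def)
  finally have "energy_const m K * (\<integral>t. indicator {-1..\<tau>} t *\<^sub>R (\<integral>x. s (k+h) t x ^ 2 + s (k+h) t x ^ 3 \<partial>lborel) \<partial>lborel)
      \<le> energy_const m K * (2 / h\<^sup>2 * mass k)"
    using energy_const_pos by (intro mult_left_mono) auto
  with energy_inequality[OF \<tau> k'] show ?thesis by (simp add: mult.assoc mult.left_commute)
qed


text \<open>Two level increases are used: one for the bound on $\sup_t \int s^4$, which controls the $L^1$ norm in Nash's inequality at the next level, and one for the gradient.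
With $r^{d+2}$ equal to the mass $A$ both terms of Nash's inequality become multiples of $A^{1 + 2/(d+2)}$.\<close>
lemma mass_decay:
  fixes n :: nat and V :: real
  assumes k: "1/4 \<le> k" and h: "0 < h" "h \<le> 1"
  defines "n \<equiv> DIM('a)" and "V \<equiv> measure lborel (cball (0::'a) 1)"
  shows "mass (k + 2 * h) \<le> (4 * energy_const m K / (6 * K powr (m - 1)) + 4 * (energy_const m K)\<^sup>2 / V) / h ^ 8
     * mass k powr (1 + 2 / (real n + 2))"
proof (cases "mass k = 0")
  case True
  have "mass (k + 2 * h) \<le> mass k" using k h by (intro mass_antimono) auto
  also note True
  finally show ?thesis unfolding True powr_0 by simp
next
  case False
  define A where "A = mass k"
  have A: "0 < A" unfolding A_def by (rule le_neq_trans[OF mass_nonneg not_sym[OF False]])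
  define c where "c = energy_const m K"
  have c: "0 < c" unfolding c_def by (rule energy_const_pos)
  define l where "l = 6 * K powr (m - 1)"
  have l: "0 < l" using K by (simp add: l_def)
  have V: "0 < V" unfolding V_def by (simp add: content_cball_pos)
  \<comment> \<open>The radius that balances the two terms of Nash's inequality.\<close>
  define r where "r = A powr (1 / (real n + 2))"
  have r: "0 < r" using A by (simp add: r_def)
  have Vr: "measure lborel (cball (0::'a) r) = V * r ^ n"
    using r by (simp add: V_def n_def content_cball)
  have k1: "1/4 \<le> k + h" and k2: "1/4 \<le> k + 2 * h" and kk: "k + 2 * h = (k + h) + h" using k h by auto
  define E where "E t = (\<integral>x. s (k + 2 * h) t x ^ 2 * (norm (G t x))\<^sup>2 \<partial>lborel)" for t
  have zero_in: "0 \<in> {-1..0::real}" by simp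
  have cG: "continuous_on ({-1..0} \<times> ball 0 1) (\<lambda>z. (norm (G (fst z) (snd z)))\<^sup>2)"
    by (intro continuous_intros cont_G)
  have iE: "integrable lborel (\<lambda>t. indicator {-1..0} t *\<^sub>R E t)"
    unfolding E_def
    using integrable_over_slab(1)[where F="\<lambda>t x. (norm (G t x))\<^sup>2" and n=1, OF k2 zero_in cG]
    by (simp only: numeral_2_eq_2 One_nat_def)
  have Ebound: "l * (\<integral>t. indicator {-1..0} t *\<^sub>R E t \<partial>lborel) \<le> 2 * c / h\<^sup>2 * A"
  proof -
    have "0 \<le> (\<integral>x. s (k + 2 * h) 0 x ^ 4 \<partial>lborel)" by (rule Bochner_Integration.integral_nonneg) simp
    then have "l * (\<integral>t. indicator {-1..0} t *\<^sub>R E t \<partial>lborel) \<le> 2 * c / h\<^sup>2 * mass (k + h)"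
      using energy_le_mass[OF k1 h, of 0] unfolding E_def c_def l_def kk by (simp only: atLeastAtMost_iff) linarith
    also have "\<dots> \<le> 2 * c / h\<^sup>2 * A"
      unfolding A_def using c h k by (intro mult_left_mono mass_antimono) auto
    finally show ?thesis .
  qed
  have nash: "(\<integral>x. s (k + 2 * h) t x ^ 4 \<partial>lborel) \<le> 2 * r\<^sup>2 * E t + (2 * c / h ^ 4 * A)\<^sup>2 / (V * r ^ n)"
    if t: "t \<in> {-1..0}" for t
  proof -
    define f where "f x = s (k + 2 * h) t x ^ 2" for x
    have der: "(f has_derivative (\<lambda>v. (2 * s (k + 2 * h) t x) *\<^sub>R G t x \<bullet> v)) (at x)" for x
      using power_s_has_derivative[OF t k2, of 0 x] unfolding f_def by (simp add: numeral_2_eq_2)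
    have "continuous_on UNIV (\<lambda>x. (2 * s (k + 2 * h) t x) *\<^sub>R G t x)"
      using cont_power_s_G[OF t k2, of 2 0] by simp
    from Nash_inequality_parametric[OF der this compact_cball, of 0 "1/2" r]
    have N: "(\<integral>x. (f x)\<^sup>2 \<partial>lborel) \<le> r\<^sup>2 / 2 * (\<integral>x. (norm ((2 * s (k + 2 * h) t x) *\<^sub>R G t x))\<^sup>2 \<partial>lborel)
        + (\<integral>x. f x \<partial>lborel)\<^sup>2 / (V * r ^ n)"
      using s_zero_outside[OF _ k2 t] r unfolding Vr by (simp add: f_def)
    have e1: "(f x)\<^sup>2 = s (k + 2 * h) t x ^ 4" for x by (simp add: f_def flip: power_mult)
    have e2: "(norm ((2 * s (k + 2 * h) t x) *\<^sub>R G t x))\<^sup>2 = 4 * (s (k + 2 * h) t x ^ 2 * (norm (G t x))\<^sup>2)" for x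
      by (simp add: power_mult_distrib)
    have "0 \<le> (\<integral>t'. indicator {-1..t} t' *\<^sub>R (\<integral>x. s (k + h) t' x ^ 2 * (norm (G t' x))\<^sup>2 \<partial>lborel) \<partial>lborel)"
      by (intro Bochner_Integration.integral_nonneg scaleR_nonneg_nonneg mult_nonneg_nonneg) auto
    from mult_nonneg_nonneg[OF less_imp_le[OF l] this]
    have I4: "(\<integral>x. s (k + h) t x ^ 4 \<partial>lborel) \<le> 2 * c / h\<^sup>2 * A"
      using energy_le_mass[OF k h t] unfolding A_def c_def l_def by linarith
    moreover have "(\<integral>x. f x \<partial>lborel) \<le> (\<integral>x. s (k + h) t x ^ 4 / h\<^sup>2 \<partial>lborel)"
    proof (rule integral_mono)
      show "integrable lborel f" unfolding f_def[abs_def] by (rule integrable_powers(1)[OF k2 t])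
      show "integrable lborel (\<lambda>x. s (k + h) t x ^ 4 / h\<^sup>2)"
        by (rule Bochner_Integration.integrable_divide) (rule integrable_powers(3)[OF k1 t])
      show "f x \<le> s (k + h) t x ^ 4 / h\<^sup>2" for x
        unfolding f_def kk by (rule s_chebyshev[OF h(1)])
    qed
    moreover have "(\<integral>x. s (k + h) t x ^ 4 / h\<^sup>2 \<partial>lborel) = (\<integral>x. s (k + h) t x ^ 4 \<partial>lborel) / h\<^sup>2"
      by simp
    ultimately have "(\<integral>x. f x \<partial>lborel) \<le> (2 * c / h\<^sup>2 * A) / h\<^sup>2"
      using divide_right_mono[OF I4 zero_le_power2[of h]] by linarith
    also have "\<dots> = 2 * c / h ^ 4 * A" by (simp add: power2_eq_square power4_eq_xxxx)
    finally have "(\<integral>x. f x \<partial>lborel)\<^sup>2 \<le> (2 * c / h ^ 4 * A)\<^sup>2"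
      by (intro power_mono Bochner_Integration.integral_nonneg) (auto simp: f_def)
    then have "(\<integral>x. f x \<partial>lborel)\<^sup>2 / (V * r ^ n) \<le> (2 * c / h ^ 4 * A)\<^sup>2 / (V * r ^ n)"
      using V r by (intro divide_right_mono) auto
    with N show ?thesis unfolding e1 e2 E_def by simp
  qed
  have iConst: "integrable lborel (\<lambda>t. indicator {-1..0::real} t *\<^sub>R y)" for y :: real
    by (rule borel_integrable_compact) auto
  have "mass (k + 2 * h) \<le> (\<integral>t. 2 * r\<^sup>2 * (indicator {-1..0} t *\<^sub>R E t)
      + indicator {-1..0} t *\<^sub>R ((2 * c / h ^ 4 * A)\<^sup>2 / (V * r ^ n)) \<partial>lborel)"
    unfolding mass_def
  proof (rule integral_mono)
    show "integrable lborel (\<lambda>t. indicator {-1..0} t *\<^sub>R (\<integral>x. s (k + 2 * h) t x ^ 4 \<partial>lborel))"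
      by (rule integrable_powers(6)[OF k2]) simp
    show "integrable lborel (\<lambda>t. 2 * r\<^sup>2 * (indicator {-1..0} t *\<^sub>R E t)
      + indicator {-1..0} t *\<^sub>R ((2 * c / h ^ 4 * A)\<^sup>2 / (V * r ^ n)))"
      by (intro Bochner_Integration.integrable_add integrable_mult_right iE iConst)
    show "indicator {-1..0} t *\<^sub>R (\<integral>x. s (k + 2 * h) t x ^ 4 \<partial>lborel)
      \<le> 2 * r\<^sup>2 * (indicator {-1..0} t *\<^sub>R E t) + indicator {-1..0} t *\<^sub>R ((2 * c / h ^ 4 * A)\<^sup>2 / (V * r ^ n))" for t
      using nash[of t] by (cases "t \<in> {-1..0}") simp_all
  qed
  also have "\<dots> = 2 * r\<^sup>2 * (\<integral>t. indicator {-1..0} t *\<^sub>R E t \<partial>lborel) + (2 * c / h ^ 4 * A)\<^sup>2 / (V * r ^ n)"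
    by (subst Bochner_Integration.integral_add[OF integrable_mult_right[OF iE] iConst])
      (simp add: integral_mult_right_zero)
  also have "2 * r\<^sup>2 * (\<integral>t. indicator {-1..0} t *\<^sub>R E t \<partial>lborel) \<le> 2 * r\<^sup>2 * (2 * c / h\<^sup>2 * A / l)"
  proof (rule mult_left_mono)
    show "(\<integral>t. indicator {-1..0} t *\<^sub>R E t \<partial>lborel) \<le> 2 * c / h\<^sup>2 * A / l"
      unfolding pos_le_divide_eq[OF l] using Ebound by (simp only: mult.commute)
  qed simp
  also have "\<dots> = 4 * c / l / h\<^sup>2 * (r\<^sup>2 * A)" by (simp add: mult_ac)
  also have "\<dots> \<le> 4 * c / l / h ^ 8 * (r\<^sup>2 * A)"
  proof (intro mult_right_mono divide_left_mono)
    show "h ^ 8 \<le> h\<^sup>2" using h by (intro power_decreasing) auto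
  qed (use c l A h in auto)
  also have "(2 * c / h ^ 4 * A)\<^sup>2 / (V * r ^ n) = 4 * c\<^sup>2 / V / h ^ 8 * (A\<^sup>2 / r ^ n)"
  proof -
    have "(2 * c / h ^ 4 * A)\<^sup>2 = 4 * c\<^sup>2 / h ^ 8 * A\<^sup>2"
      by (simp add: power_mult_distrib power_divide power_mult[symmetric] del: power_mult)
    then show ?thesis by simp
  qed
  also have "r\<^sup>2 * A = A powr (1 + 2 / (real n + 2))"
  proof -
    have "r\<^sup>2 = A powr (2 / (real n + 2))"
    proof -
      have "r\<^sup>2 = r powr real 2" by (rule powr_realpow[OF r, symmetric])
      then show ?thesis unfolding r_def powr_powr by simp
    qed
    then show ?thesis using A by (simp only: powr_add powr_one' mult.commute)
  qed
  also have "A\<^sup>2 / r ^ n = A powr (1 + 2 / (real n + 2))"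
  proof -
    have "r ^ n = A powr (real n / (real n + 2))"
    proof -
      have "r ^ n = r powr real n" by (rule powr_realpow[OF r, symmetric])
      then show ?thesis unfolding r_def powr_powr by simp
    qed
    moreover have "A\<^sup>2 = A powr 2" using A by (simp add: powr_numeral)
    ultimately have "A\<^sup>2 / r ^ n = A powr (2 - real n / (real n + 2))" by (simp add: powr_diff)
    also have "2 - real n / (real n + 2) = 1 + 2 / (real n + 2)" by (simp add: field_simps)
    finally show ?thesis .
  qed
  finally show ?thesis
    unfolding A_def c_def l_def by (simp only: add_divide_distrib distrib_right)
qed

end

section \<open>A lower bound on the unit cylinder\<close>

definition decay_const :: "real \<Rightarrow> real \<Rightarrow> real \<Rightarrow> real" where
  "decay_const m K V = 16 ^ 8 * (4 * energy_const m K / (6 * K powr (m - 1)) + 4 * (energy_const m K)\<^sup>2 / V)"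

text \<open>The smallness condition of \<open>fast_geometric_convergence\<close> for the exponent $2/(n+2)$ and the base $256 = 2^8$; the latter comes from the power $h^{-8}$ for increments that are halved in each step.\<close>
definition mass_threshold :: "real \<Rightarrow> real \<Rightarrow> real \<Rightarrow> nat \<Rightarrow> real" where
  "mass_threshold m K V n = decay_const m K V powr (- (1 / (2 / (real n + 2)))) * 256 powr (- (1 / (2 / (real n + 2))\<^sup>2))"

context fast_diffusion_unit_cylinder begin

lemma decay_const_pos:
  assumes "0 < V" shows "0 < decay_const m K V"
  unfolding decay_const_def using energy_const_pos K assms
  by (intro mult_pos_pos add_pos_pos divide_pos_pos) auto

text \<open>The levels $1/2 - 2^{-j}/4$ increase from $1/4$ to $1/2$, so that the mass at level $1/2$ vanishes. One more application of the energy inequality turns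
this into a statement at the final time, where continuity yields a pointwise bound.\<close>
lemma small_mass_imp_bound:
  assumes small: "mass (1/4) \<le> mass_threshold m K (measure lborel (cball (0::'a) 1)) DIM('a)"
  shows "u 0 0 \<le> 3/4"
proof -
  define V where "V = measure lborel (cball (0::'a) 1)"
  define e where "e = 2 / (real DIM('a) + 2)"
  define Y where "Y j = mass (1/2 - (1/2) ^ j / 4)" for j :: nat
  have V: "0 < V" unfolding V_def by (simp add: content_cball_pos)
  have kj: "1/4 \<le> 1/2 - (1/2) ^ j / (4::real)" for j :: nat
    using power_le_one[of "1/2::real" j] by simp
  have "Y \<longlonglongrightarrow> 0"
  proof (rule fast_geometric_convergence)
    show "0 < decay_const m K V" by (rule decay_const_pos[OF V])
    show "(1::real) < 256" "0 < e" by (simp_all add: e_def)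
    show "Y (Suc j) \<le> decay_const m K V * 256 ^ j * Y j powr (1 + e)" for j
    proof -
      define h :: real where "h = (1/2) ^ j / 16"
      have h: "0 < h" "h \<le> 1"
        using power_le_one[of "1/2::real" j] by (auto simp: h_def)
      have "1/2 - (1/2) ^ Suc j / 4 = (1/2 - (1/2) ^ j / 4) + 2 * h" by (simp add: h_def)
      then have "Y (Suc j) \<le> (4 * energy_const m K / (6 * K powr (m - 1)) + 4 * (energy_const m K)\<^sup>2 / V) / h ^ 8
          * Y j powr (1 + e)"
        unfolding Y_def e_def V_def using mass_decay[OF kj h, of j] by (simp only:)
      moreover have "h ^ 8 = 1 / (16 ^ 8 * 256 ^ j)"
      proof -
        have "((1/2) ^ j) ^ 8 = ((1/2::real) ^ 8) ^ j" by (simp only: power_mult[symmetric] mult.commute)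
        also have "\<dots> = 1 / 256 ^ j" by (simp add: power_one_over)
        finally show ?thesis unfolding h_def power_divide by (simp only: divide_divide_eq_left mult.commute)
      qed
      ultimately show ?thesis unfolding decay_const_def by (simp add: mult_ac)
    qed
    show "0 \<le> Y j" for j unfolding Y_def by (rule mass_nonneg)
    show "Y 0 \<le> decay_const m K V powr (- (1 / e)) * 256 powr (- (1 / e\<^sup>2))"
      using small unfolding mass_threshold_def Y_def e_def V_def by simp
  qed
  moreover have "mass (1/2) \<le> Y j" for j
    unfolding Y_def by (rule mass_antimono[OF kj]) simp
  ultimately have m0: "mass (1/2) \<le> 0" by (intro LIMSEQ_le_const) auto
  have zero: "0 \<in> {-1..0::real}" by simp
  have q14: "(1/4::real) \<le> 1/2" "1/4 \<le> 1/2 + (1/4::real)" "0 < (1/4::real)" "1/4 \<le> (1::real)"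
    and k34: "1/2 + 1/4 = (3/4::real)" "1/4 \<le> (3/4::real)" by simp_all
  have "0 \<le> 6 * K powr (m - 1) * (\<integral>t. indicator {-1..0} t *\<^sub>R (\<integral>x. s (3/4) t x ^ 2 * (norm (G t x))\<^sup>2 \<partial>lborel) \<partial>lborel)"
    by (intro mult_nonneg_nonneg Bochner_Integration.integral_nonneg scaleR_nonneg_nonneg) auto
  moreover have "2 * energy_const m K / (1/4)\<^sup>2 * mass (1/2) \<le> 0"
    using m0 energy_const_pos by (intro mult_nonneg_nonpos) auto
  ultimately have I: "(\<integral>x. s (3/4) 0 x ^ 4 \<partial>lborel) \<le> 0"
    using energy_le_mass[OF q14(1,3,4) zero] unfolding k34(1) by linarith
  have "s (3/4) 0 0 ^ 4 = 0"
  proof (rule continuous_nonneg_integral_le_0_imp_0[OF _ integrable_powers(3)[OF k34(2) zero] _ I])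
    have "((\<lambda>x. s (3/4) 0 x ^ 4) has_derivative
        (\<lambda>v. (real 4 * s (3/4) 0 x ^ 3) *\<^sub>R G 0 x \<bullet> v)) (at x)" for x
      using power_s_has_derivative[OF zero k34(2), of 2 x]
      by (simp only: eval_nat_numeral BitM.simps One_nat_def)
    then show "continuous_on UNIV (\<lambda>x. s (3/4) 0 x ^ 4)" by (rule has_derivative_continuous_on)
  qed simp
  then have "max (u 0 0 - 3/4) 0 = 0" by (simp add: s_def \<psi>_def)
  then show ?thesis by linarith
qed

lemma mass_le_nn_integral_power:
  assumes p: "0 \<le> p"
  shows "ennreal (mass (1/4)) \<le> ennreal (K ^ 4 * 4 powr p)
    * (\<integral>\<^sup>+z \<in> {-1..0} \<times> ball 0 1. ennreal (u (fst z) (snd z) powr p) \<partial>lborel)"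
proof -
  define F where "F z = (if z \<in> {-1..0} \<times> cball 0 (1/2) then s (1/4) (fst z) (snd z) ^ 4 else 0)" for z
  have F: "F (t, x) = indicator {-1..0} t *\<^sub>R s (1/4) t x ^ 4" for t x
    using s_zero_outside[of x "1/4" t] by (cases "x \<in> cball 0 (1/2)"; cases "t \<in> {-1..0}") (simp_all add: F_def indicator_def)
  have c: "compact ({-1..0::real} \<times> cball (0::'a) (1/2))" by (intro compact_Times compact_cball compact_Icc)
  have "continuous_on ({-1..0} \<times> cball 0 (1/2)) (\<lambda>z. s (1/4) (fst z) (snd z) ^ 4)"
    by (intro cont_half continuous_intros cont_s) simp
  then have cF: "continuous_on ({-1..0} \<times> cball 0 (1/2)) F"
    by (rule continuous_on_eq) (simp add: F_def)
  have iF: "integrable lborel F"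
    by (rule integrable_continuous_compact_support[OF c cF]) (simp add: F_def)
  then have iF2: "integrable (lborel \<Otimes>\<^sub>M lborel) F" by (simp add: lborel_prod)
  have "mass (1/4) = (\<integral>t. (\<integral>x. F (t, x) \<partial>lborel) \<partial>lborel)" unfolding mass_def F by simp
  also have "\<dots> = (\<integral>z. F z \<partial>lborel)"
    using lborel_pair.integral_fst'[OF iF2] by (simp add: lborel_prod)
  also have "ennreal \<dots> = (\<integral>\<^sup>+z. ennreal (F z) \<partial>lborel)"
    by (rule nn_integral_eq_integral[symmetric, OF iF]) (simp add: F_def)
  also have "\<dots> \<le> (\<integral>\<^sup>+z. ennreal (K ^ 4 * 4 powr p)
    * (ennreal (u (fst z) (snd z) powr p) * indicator ({-1..0} \<times> ball 0 1) z) \<partial>lborel)"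
  proof (rule nn_integral_mono)
    fix z :: "real \<times> 'a"
    obtain t x where z: "z = (t, x)" by (cases z)
    show "ennreal (F z) \<le> ennreal (K ^ 4 * 4 powr p)
      * (ennreal (u (fst z) (snd z) powr p) * indicator ({-1..0} \<times> ball 0 1) z)"
    proof (cases "t \<in> {-1..0} \<and> s (1/4) t x \<noteq> 0")
      case True
      note S = s_posD[OF s_pos order_refl, of t x]
      have x: "x \<in> ball 0 1" using S(1) True by auto
      have "F z = s (1/4) t x ^ 4" using True by (simp add: z F)
      also have "\<dots> \<le> K ^ 4" using S(3) True by (intro power_mono) auto
      also have "1 \<le> (4 * u t x) powr p" using S(2) True p by (intro ge_one_powr_ge_zero) auto
      then have "K ^ 4 \<le> K ^ 4 * (4 * u t x) powr p" using K by simp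
      also have "(4 * u t x) powr p = 4 powr p * u t x powr p"
        by (rule powr_mult)
      finally have "F z \<le> (K ^ 4 * 4 powr p) * u t x powr p" by (simp add: mult.assoc)
      then have "ennreal (F z) \<le> ennreal (K ^ 4 * 4 powr p) * ennreal (u t x powr p)"
        using K by (subst ennreal_mult[symmetric]) (auto intro!: ennreal_leI)
      then show ?thesis using True x by (simp add: z)
    next
      case False
      then have "F z = 0" by (auto simp: z F)
      then show ?thesis by simp
    qed
  qed
  also have "\<dots> = ennreal (K ^ 4 * 4 powr p)
    * (\<integral>\<^sup>+z \<in> {-1..0} \<times> ball 0 1. ennreal (u (fst z) (snd z) powr p) \<partial>lborel)"
  proof (rule nn_integral_cmult)
    have "(\<lambda>z. indicator ({-1..0} \<times> ball 0 1) z *\<^sub>R (u (fst z) (snd z) powr p)) \<in> borel_measurable borel"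
    proof (rule borel_measurable_continuous_on_indicator)
      show "{-1..0::real} \<times> ball (0::'a) 1 \<in> sets borel" by (intro borel_Times) auto
      show "continuous_on ({-1..0} \<times> ball 0 1) (\<lambda>z. u (fst z) (snd z) powr p)"
        by (intro continuous_intros cont_u) (use pos in force)
    qed
    then have "(\<lambda>z. ennreal (indicator ({-1..0} \<times> ball 0 1) z *\<^sub>R (u (fst z) (snd z) powr p))) \<in> borel_measurable lborel"
      by measurable
    also have "(\<lambda>z. ennreal (indicator ({-1..0} \<times> ball 0 1) z *\<^sub>R (u (fst z) (snd z) powr p)))
       = (\<lambda>z. ennreal (u (fst z) (snd z) powr p) * indicator ({-1..0} \<times> ball 0 1) z)"
      by (auto simp: fun_eq_iff indicator_def)
    finally show "(\<lambda>z. ennreal (u (fst z) (snd z) powr p) * indicator ({-1..0} \<times> ball 0 1) z) \<in> borel_measurable lborel" .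
  qed
  finally show ?thesis .
qed

end

lemma unit_cylinder_lower_bound:
  fixes m K p :: real
  assumes m: "m < 1" and K: "1 \<le> K" and p: "0 \<le> p"
  obtains c where "0 < c" "\<And>u ut g Q. fast_diffusion_unit_cylinder m K u ut g (Q :: real \<Rightarrow> 'a::euclidean_space \<Rightarrow> 'a \<Rightarrow> 'a) \<Longrightarrow> 1 \<le> u 0 0 \<Longrightarrow>
     ennreal c \<le> (\<integral>\<^sup>+z \<in> {-1..0} \<times> ball 0 1. ennreal (u (fst z) (snd z) powr p) \<partial>lborel)"
proof
  let ?V = "measure lborel (cball (0::'a) 1)"
  define c where "c = mass_threshold m K ?V DIM('a) / (K ^ 4 * 4 powr p)"
  show "0 < c"
  proof -
    have "0 < energy_const m K"
      using K unfolding energy_const_def by (intro add_nonneg_pos mult_nonneg_nonneg) auto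
    moreover have "0 < ?V" by (simp add: content_cball_pos)
    ultimately have "0 < decay_const m K ?V"
      unfolding decay_const_def using K by (intro mult_pos_pos add_pos_pos divide_pos_pos) auto
    then show ?thesis unfolding c_def mass_threshold_def using K by simp
  qed
  fix u ut :: "real \<Rightarrow> 'a \<Rightarrow> real" and g :: "real \<Rightarrow> 'a \<Rightarrow> 'a" and Q :: "real \<Rightarrow> 'a \<Rightarrow> 'a \<Rightarrow> 'a"
  assume U: "fast_diffusion_unit_cylinder m K u ut g Q" and u0: "1 \<le> u 0 0"
  interpret fast_diffusion_unit_cylinder m K u ut g Q by (rule U)
  let ?I = "\<integral>\<^sup>+z \<in> {-1..0} \<times> ball 0 1. ennreal (u (fst z) (snd z) powr p) \<partial>lborel"
  have P: "0 < K ^ 4 * 4 powr p" using K by simp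
  have "mass_threshold m K ?V DIM('a) < mass (1/4)"
    using small_mass_imp_bound u0 by (rule_tac ccontr) auto
  then have "ennreal (c * (K ^ 4 * 4 powr p)) \<le> ennreal (mass (1/4))"
  proof (intro ennreal_leI)
    have "mass_threshold m K ?V DIM('a) = c * (K ^ 4 * 4 powr p)"
      unfolding c_def by (rule nonzero_divide_eq_eq[THEN iffD1, OF _ refl]) (use P in linarith)
    then show "c * (K ^ 4 * 4 powr p) \<le> mass (1/4)"
      using \<open>mass_threshold m K ?V DIM('a) < mass (1/4)\<close> by linarith
  qed
  also have "\<dots> \<le> ennreal (K ^ 4 * 4 powr p) * ?I" by (rule mass_le_nn_integral_power[OF p])
  finally have le: "ennreal (K ^ 4 * 4 powr p) * ennreal c \<le> ennreal (K ^ 4 * 4 powr p) * ?I"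
    using P \<open>0 < c\<close> by (simp add: ennreal_mult mult.commute)
  show "ennreal c \<le> ?I"
    using le P by (subst (asm) ennreal_mult_le_mult_iff) auto
qed

section \<open>Test functions\<close>

lemma Ck_on_subset: "Ck_on k S f \<Longrightarrow> D \<subseteq> S \<Longrightarrow> Ck_on k D f"
proof (induction k arbitrary: f)
  case 0
  then show ?case by (auto intro: continuous_on_subset)
next
  case (Suc k)
  then obtain f' where f': "\<forall>x\<in>S. (f has_derivative f' x) (at x within S)" "\<forall>b\<in>Basis. Ck_on k S (\<lambda>x. f' x b)"
    by auto
  have "\<forall>x\<in>D. (f has_derivative f' x) (at x within D)"
    using f'(1) Suc.prems(2) by (blast intro: has_derivative_subset)
  moreover have "\<forall>b\<in>Basis. Ck_on k D (\<lambda>x. f' x b)" using f'(2) Suc by blast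
  ultimately show ?case by auto
qed

lemma Ck_on_SucD: "Ck_on (Suc k) S f \<Longrightarrow> Ck_on k S f"
proof (induction k arbitrary: f)
  case 0
  then show ?case by (auto intro: has_derivative_continuous_on)
next
  case (Suc k)
  then obtain f' where f': "\<forall>x\<in>S. (f has_derivative f' x) (at x within S)" "\<forall>b\<in>Basis. Ck_on (Suc k) S (\<lambda>x. f' x b)"
    by (subst (asm) Ck_on.simps(2)) blast
  then have "\<forall>b\<in>Basis. Ck_on k S (\<lambda>x. f' x b)" using Suc.IH by blast
  with f'(1) show ?case by (subst Ck_on.simps(2)) blast
qed

lemma Ck_on_const: "Ck_on k S (\<lambda>_. a)"
proof (induction k arbitrary: a)
  case (Suc k)
  show ?case unfolding Ck_on.simps
    by (rule exI[of _ "\<lambda>_ _. 0"]) (simp add: Suc)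
qed simp

lemma Ck_on_inner: "Ck_on k S (\<lambda>x. (x - a) \<bullet> b)"
proof (cases k)
  case (Suc j)
  show ?thesis unfolding Suc Ck_on.simps
    by (rule exI[of _ "\<lambda>x v. v \<bullet> b"]) (auto intro!: derivative_eq_intros Ck_on_const)
qed (auto intro!: continuous_intros)

lemma Ck_on_add: "Ck_on k S f \<Longrightarrow> Ck_on k S g \<Longrightarrow> Ck_on k S (\<lambda>x. f x + g x)"
proof (induction k arbitrary: f g)
  case 0
  then show ?case by (auto intro: continuous_intros)
next
  case (Suc k)
  obtain f' where f': "\<forall>x\<in>S. (f has_derivative f' x) (at x within S)" "\<forall>b\<in>Basis. Ck_on k S (\<lambda>x. f' x b)"
    using Suc.prems(1) by auto
  obtain g' where g': "\<forall>x\<in>S. (g has_derivative g' x) (at x within S)" "\<forall>b\<in>Basis. Ck_on k S (\<lambda>x. g' x b)"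
    using Suc.prems(2) by auto
  show ?case unfolding Ck_on.simps
    by (rule exI[of _ "\<lambda>x v. f' x v + g' x v"]) (use f' g' in \<open>auto intro!: has_derivative_add Suc.IH\<close>)
qed

lemma Ck_on_mult: "Ck_on k S f \<Longrightarrow> Ck_on k S g \<Longrightarrow> Ck_on k S (\<lambda>x. f x * g x)"
proof (induction k arbitrary: f g)
  case 0
  then show ?case by (auto intro: continuous_intros)
next
  case (Suc k)
  obtain f' where f': "\<forall>x\<in>S. (f has_derivative f' x) (at x within S)" "\<forall>b\<in>Basis. Ck_on k S (\<lambda>x. f' x b)"
    using Suc.prems(1) by auto
  obtain g' where g': "\<forall>x\<in>S. (g has_derivative g' x) (at x within S)" "\<forall>b\<in>Basis. Ck_on k S (\<lambda>x. g' x b)"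
    using Suc.prems(2) by auto
  have k: "Ck_on k S f" "Ck_on k S g" using Suc.prems Ck_on_SucD by auto
  show ?case unfolding Ck_on.simps
    by (rule exI[of _ "\<lambda>x v. f x * g' x v + f' x v * g x"])
      (use f' g' k in \<open>auto intro!: has_derivative_mult Ck_on_add Suc.IH\<close>)
qed

text \<open>The functions $s^{-n} e^{-1/s}$, extended by zero: their derivatives are combinations of functions of the same kind, which makes smoothness an induction.\<close>
definition flat_exp :: "nat \<Rightarrow> real \<Rightarrow> real" where
  "flat_exp n s = (if 0 < s then inverse s ^ n / exp (inverse s) else 0)"

lemma flat_exp_has_derivative:
  "(flat_exp n has_real_derivative flat_exp (n + 2) s + (- real n) * flat_exp (n + 1) s) (at s)"
proof (cases s "0::real" rule: linorder_cases)
  case less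
  have "(flat_exp n has_real_derivative 0) (at s)"
    by (rule has_field_derivative_transform_within_open[OF DERIV_const, where S="{..<0}"])
      (use less in \<open>auto simp: flat_exp_def\<close>)
  then show ?thesis using less by (simp add: flat_exp_def)
next
  case greater
  have "((\<lambda>y. y ^ n * exp (- y)) has_real_derivative
      y ^ n * (exp (- y) * - 1) + real n * y ^ (n - Suc 0) * exp (- y)) (at y)" for y :: real
    by (rule DERIV_cong[OF DERIV_mult[OF DERIV_pow DERIV_fun_exp[OF DERIV_minus[OF DERIV_ident]]]]) (simp add: mult_ac)
  from DERIV_chain2[OF this DERIV_inverse[of s]]
  have "((\<lambda>s. inverse s ^ n * exp (- inverse s)) has_real_derivative
      (inverse s ^ n * (exp (- inverse s) * - 1) + real n * inverse s ^ (n - Suc 0) * exp (- inverse s))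
        * - (inverse s ^ Suc (Suc 0))) (at s)"
    using greater by simp
  moreover have "(inverse s ^ n * (exp (- inverse s) * - 1) + real n * inverse s ^ (n - Suc 0) * exp (- inverse s))
        * - (inverse s ^ Suc (Suc 0)) = flat_exp (n + 2) s + (- real n) * flat_exp (n + 1) s"
    using greater by (cases n) (simp_all add: flat_exp_def exp_minus divide_inverse algebra_simps)
  ultimately have der: "((\<lambda>s. inverse s ^ n * exp (- inverse s)) has_real_derivative
      flat_exp (n + 2) s + (- real n) * flat_exp (n + 1) s) (at s)" by (simp only:)
  show ?thesis
  proof (rule has_field_derivative_transform_within_open[OF der])
    show "open {0::real<..}" "s \<in> {0<..}" using greater by simp_all
    show "inverse x ^ n * exp (- inverse x) = flat_exp n x" if "x \<in> {0<..}" for x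
      using that by (simp add: flat_exp_def exp_minus divide_inverse)
  qed
next
  case equal
  have "((\<lambda>h. flat_exp n h / h) \<longlongrightarrow> 0) (at 0)"
  proof (rule filterlim_split_at)
    have "\<forall>\<^sub>F h in at_left 0. flat_exp n h / h = 0"
      by (rule eventually_at_leftI[of "-1"]) (simp_all add: flat_exp_def)
    then show "((\<lambda>h. flat_exp n h / h) \<longlongrightarrow> 0) (at_left 0)" by (rule tendsto_eventually)
    have lim: "((\<lambda>h::real. inverse h ^ Suc n / exp (inverse h)) \<longlongrightarrow> 0) (at_right 0)"
      by (rule filterlim_compose[OF tendsto_power_div_exp_0 filterlim_inverse_at_top_right])
    have "\<forall>\<^sub>F h in at_right 0. inverse h ^ Suc n / exp (inverse h) = flat_exp n h / h"
      by (rule eventually_mono[OF eventually_at_right_less]) (simp add: flat_exp_def divide_inverse)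
    with lim show "((\<lambda>h. flat_exp n h / h) \<longlongrightarrow> 0) (at_right 0)"
      by (rule Lim_transform_eventually)
  qed
  then show ?thesis unfolding equal has_field_derivative_iff by (simp add: flat_exp_def)
qed

lemma Ck_on_flat_exp_bump: "Ck_on k UNIV (\<lambda>z::'a::euclidean_space. flat_exp n (r - (z - a) \<bullet> (z - a)))"
proof (induction k arbitrary: n)
  case 0
  have "continuous_on UNIV (flat_exp n)"
    by (meson DERIV_continuous_on flat_exp_has_derivative has_field_derivative_at_within)
  then show ?case unfolding Ck_on.simps
    by (rule continuous_on_compose2) (auto intro!: continuous_intros)
next
  case (Suc k)
  define h where "h s = flat_exp (n + 2) s + (- real n) * flat_exp (n + 1) s" for s
  have "((\<lambda>z. flat_exp n (r - (z - a) \<bullet> (z - a))) has_derivative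
      (\<lambda>v. h (r - (z - a) \<bullet> (z - a)) * (- 2 * ((z - a) \<bullet> v)))) (at z)" for z
  proof -
    have "((\<lambda>z. r - (z - a) \<bullet> (z - a)) has_derivative (\<lambda>v. - 2 * ((z - a) \<bullet> v))) (at z)"
      by (auto intro!: derivative_eq_intros simp: inner_commute)
    from has_derivative_compose[OF this flat_exp_has_derivative[unfolded has_field_derivative_def]]
    show ?thesis by (simp add: h_def)
  qed
  moreover have "Ck_on k UNIV (\<lambda>z. h (r - (z - a) \<bullet> (z - a)) * (- 2 * ((z - a) \<bullet> b)))" for b
    unfolding h_def by (intro Ck_on_mult Ck_on_add Ck_on_const Ck_on_inner Suc.IH)
  ultimately show ?case unfolding Ck_on.simps
    by (intro exI[of _ "\<lambda>z v. h (r - (z - a) \<bullet> (z - a)) * (- 2 * ((z - a) \<bullet> v))"]) auto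
qed

lemma exists_bump_function:
  fixes a :: "'a::euclidean_space"
  assumes "open D" "a \<in> D"
  obtains \<phi> where "test_function D \<phi>" "\<And>z. 0 \<le> \<phi> z" "0 < \<phi> a"
proof -
  obtain r where r: "0 < r" "cball a r \<subseteq> D" using assms open_contains_cball by blast
  define \<phi> where "\<phi> z = flat_exp 0 (r\<^sup>2 - (z - a) \<bullet> (z - a))" for z
  have "\<phi> z = 0" if "z \<notin> cball a r" for z
  proof -
    have "r < norm (z - a)" using that by (simp add: dist_norm norm_minus_commute)
    then have "r\<^sup>2 < (norm (z - a))\<^sup>2" using r(1) by (intro power_strict_mono) auto
    then show ?thesis by (simp add: \<phi>_def flat_exp_def power2_norm_eq_inner)
  qed
  then have "closure {z. \<phi> z \<noteq> 0} \<subseteq> cball a r"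
    by (intro closure_minimal closed_cball) blast
  moreover from this have "compact (closure {z. \<phi> z \<noteq> 0})"
    by (meson bounded_cball bounded_subset closed_closure compact_eq_bounded_closed)
  ultimately have "test_function D \<phi>"
    unfolding test_function_def smooth_fun_on_def using r(2) Ck_on_flat_exp_bump
    unfolding \<phi>_def[abs_def] by blast
  moreover have "0 \<le> \<phi> z" for z by (simp add: \<phi>_def flat_exp_def)
  moreover have "0 < \<phi> a" using r(1) by (simp add: \<phi>_def flat_exp_def)
  ultimately show ?thesis using that by blast
qed

text \<open>The derivatives provided by \<open>Ck_on\<close> for different orders are all the Frechet derivative, by uniqueness; therefore partial derivatives of test functions are test functions.\<close>
lemma test_functionD:
  assumes "test_function D \<phi>"
  shows "\<And>z. (\<phi> has_derivative frechet_derivative \<phi> (at z)) (at z)"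
    and "\<And>b. b \<in> Basis \<Longrightarrow> continuous_on UNIV (\<lambda>z. frechet_derivative \<phi> (at z) b)"
    and "compact (closure {z. \<phi> z \<noteq> 0})" "closure {z. \<phi> z \<noteq> 0} \<subseteq> D"
    and "\<And>z. z \<notin> closure {z. \<phi> z \<noteq> 0} \<Longrightarrow> \<phi> z = 0"
    and "\<And>z. z \<notin> closure {z. \<phi> z \<noteq> 0} \<Longrightarrow> frechet_derivative \<phi> (at z) = (\<lambda>_. 0)"
    and "\<And>b. b \<in> Basis \<Longrightarrow> test_function D (\<lambda>z. frechet_derivative \<phi> (at z) b)"
proof -
  have smooth: "Ck_on k UNIV \<phi>" for k using assms by (auto simp: test_function_def smooth_fun_on_def)
  have der: "(\<phi> has_derivative frechet_derivative \<phi> (at z)) (at z)" for z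
  proof -
    obtain f' where "\<forall>x\<in>UNIV. (\<phi> has_derivative f' x) (at x within UNIV)"
      using smooth[of "Suc 0"] unfolding Ck_on.simps by blast
    then have "\<phi> differentiable at z" by (auto intro: differentiableI)
    then show ?thesis by (rule frechet_derivative_works[THEN iffD1])
  qed
  then show "\<And>z. (\<phi> has_derivative frechet_derivative \<phi> (at z)) (at z)" by blast
  have Ck: "Ck_on k UNIV (\<lambda>z. frechet_derivative \<phi> (at z) b)" if "b \<in> Basis" for k b
  proof -
    obtain f' where f': "\<forall>x. (\<phi> has_derivative f' x) (at x)" "\<forall>b\<in>Basis. Ck_on k UNIV (\<lambda>x. f' x b)"
      using smooth[of "Suc k"] by auto
    then have "f' = (\<lambda>z. frechet_derivative \<phi> (at z))"
      using der has_derivative_unique by blast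
    then show ?thesis using f'(2) that by simp
  qed
  show "\<And>b. b \<in> Basis \<Longrightarrow> continuous_on UNIV (\<lambda>z. frechet_derivative \<phi> (at z) b)"
    using Ck[of _ 0] by simp
  show cpt: "compact (closure {z. \<phi> z \<noteq> 0})" and sub: "closure {z. \<phi> z \<noteq> 0} \<subseteq> D"
    using assms by (auto simp: test_function_def)
  show zero: "\<And>z. z \<notin> closure {z. \<phi> z \<noteq> 0} \<Longrightarrow> \<phi> z = 0"
    using closure_subset[of "{z. \<phi> z \<noteq> 0}"] by blast
  show zero': "\<And>z. z \<notin> closure {z. \<phi> z \<noteq> 0} \<Longrightarrow> frechet_derivative \<phi> (at z) = (\<lambda>_. 0)"
    by (rule has_derivative_zero_off_support[OF der closed_closure _ zero])
  show "\<And>b. b \<in> Basis \<Longrightarrow> test_function D (\<lambda>z. frechet_derivative \<phi> (at z) b)"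
  proof -
    fix b :: 'a assume b: "b \<in> Basis"
    have *: "closure {z. frechet_derivative \<phi> (at z) b \<noteq> 0} \<subseteq> closure {z. \<phi> z \<noteq> 0}"
    proof (rule closure_minimal[OF _ closed_closure], rule subsetI)
      fix z assume z: "z \<in> {z. frechet_derivative \<phi> (at z) b \<noteq> 0}"
      show "z \<in> closure {z. \<phi> z \<noteq> 0}"
      proof (rule ccontr)
        assume "z \<notin> closure {z. \<phi> z \<noteq> 0}"
        from zero'[OF this] z show False by simp
      qed
    qed
    then have "compact (closure {z. frechet_derivative \<phi> (at z) b \<noteq> 0})"
      using compact_Int_closed[OF cpt closed_closure, of "{z. frechet_derivative \<phi> (at z) b \<noteq> 0}"]
      by (simp only: Int_absorb1)
    then show "test_function D (\<lambda>z. frechet_derivative \<phi> (at z) b)"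
      unfolding test_function_def smooth_fun_on_def using Ck[OF b] order_trans[OF * sub] by blast
  qed
qed

section \<open>From weak to classical solutions\<close>

lemma Ck_on_2_open:
  assumes D: "open D" and C: "Ck_on 2 D f"
  obtains f' f'' where "\<And>z. z \<in> D \<Longrightarrow> (f has_derivative f' z) (at z)"
    "\<And>z b. z \<in> D \<Longrightarrow> b \<in> Basis \<Longrightarrow> ((\<lambda>z. f' z b) has_derivative f'' b z) (at z)"
    "\<And>b. b \<in> Basis \<Longrightarrow> continuous_on D (\<lambda>z. f' z b)"
    "\<And>b b'. b \<in> Basis \<Longrightarrow> b' \<in> Basis \<Longrightarrow> continuous_on D (\<lambda>z. f'' b z b')"
proof -
  obtain f' where f': "\<forall>z\<in>D. (f has_derivative f' z) (at z within D)" "\<forall>b\<in>Basis. Ck_on (Suc 0) D (\<lambda>z. f' z b)"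
    using C by (subst (asm) numeral_2_eq_2) auto
  from f'(2) have "\<forall>b\<in>Basis. \<exists>h. (\<forall>z\<in>D. ((\<lambda>z. f' z b) has_derivative h z) (at z within D)) \<and>
      (\<forall>b'\<in>Basis. continuous_on D (\<lambda>z. h z b'))" by simp
  then obtain f'' where f'': "\<forall>b\<in>Basis. (\<forall>z\<in>D. ((\<lambda>z. f' z b) has_derivative f'' b z) (at z within D)) \<and>
      (\<forall>b'\<in>Basis. continuous_on D (\<lambda>z. f'' b z b'))" by metis
  show thesis
  proof (rule that)
    show "(f has_derivative f' z) (at z)" if "z \<in> D" for z
      using f'(1)[rule_format, OF that] by (simp only: at_within_open[OF that D])
    show "((\<lambda>z. f' z b) has_derivative f'' b z) (at z)" if "z \<in> D" "b \<in> Basis" for z b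
      using f''[rule_format, OF that(2), THEN conjunct1, rule_format, OF that(1)]
      by (simp only: at_within_open[OF that(1) D])
    show "continuous_on D (\<lambda>z. f' z b)" if "b \<in> Basis" for b
      by (rule has_derivative_continuous_on)
        (rule f''[rule_format, OF that, THEN conjunct1, rule_format])
    show "continuous_on D (\<lambda>z. f'' b z b')" if "b \<in> Basis" "b' \<in> Basis" for b b'
      by (rule f''[rule_format, OF that(1), THEN conjunct2, rule_format, OF that(2)])
  qed
qed

lemma fd_flux_has_derivative:
  assumes "0 < s"
  shows "(fd_flux m has_real_derivative s powr (m - 1)) (at s)"
proof (cases "m = 0")
  case True
  have "(ln has_real_derivative s powr (m - 1)) (at s)"
    using DERIV_ln[OF assms] assms True by (simp add: powr_neg_one inverse_eq_divide)
  then show ?thesis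
    by (rule has_field_derivative_transform_within_open[where S="{0<..}"])
      (use assms True in \<open>simp_all add: fd_flux_def\<close>)
next
  case False
  have "((\<lambda>s. s powr m / m) has_real_derivative m * s powr (m - 1) / m) (at s)"
    by (rule DERIV_cdivide[OF has_real_derivative_powr[OF assms]])
  then have "((\<lambda>s. s powr m / m) has_real_derivative s powr (m - 1)) (at s)" using False by simp
  then show ?thesis
    by (rule has_field_derivative_transform_within_open[where S="{0<..}"])
      (use assms False in \<open>simp_all add: fd_flux_def\<close>)
qed

lemma Basis_vec_eq_axis: "(Basis :: (real ^ 'n) set) = range (\<lambda>i. axis i 1)"
  by (auto simp: Basis_vec_def)

lemma spacetime_Basis:
  "(1, 0) \<in> (Basis :: (real \<times> 'a::euclidean_space) set)"
  "b \<in> Basis \<Longrightarrow> (0, b) \<in> (Basis :: (real \<times> 'a::euclidean_space) set)"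
  by (auto simp: Basis_prod_def)

text \<open>If \<open>N z\<close> were nonzero, a bump supported where \<open>N\<close> keeps its sign would give a nonzero integral.\<close>
lemma vanishing_of_test_integrals:
  fixes N :: "'a::euclidean_space \<Rightarrow> real"
  assumes D: "open D" and N: "continuous_on D N" and z: "z \<in> D"
    and test: "\<And>\<phi>. test_function D \<phi> \<Longrightarrow> (\<integral>z. N z * \<phi> z \<partial>lborel) = 0"
  shows "N z = 0"
proof (rule ccontr)
  assume nz: "N z \<noteq> 0"
  define \<sigma> where "\<sigma> = sgn (N z)"
  define D' where "D' = D \<inter> (\<lambda>y. \<sigma> * N y) -` {0<..}"
  have "open D'" unfolding D'_def
    by (rule continuous_open_preimage[OF _ D open_greaterThan]) (intro continuous_intros N)
  moreover have "z \<in> D'" using z nz by (cases "N z > 0") (simp_all add: D'_def \<sigma>_def)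
  ultimately obtain \<phi> where \<phi>: "test_function D' \<phi>" "\<And>y. 0 \<le> \<phi> y" "0 < \<phi> z"
    using exists_bump_function by blast
  note T = test_functionD[OF \<phi>(1)]
  let ?S = "closure {z. \<phi> z \<noteq> 0}"
  have sub: "D' \<subseteq> D" by (auto simp: D'_def)
  have tD: "test_function D \<phi>" using \<phi>(1) sub unfolding test_function_def by blast
  define f where "f y = \<sigma> * N y * \<phi> y" for y
  have cphi: "continuous_on UNIV \<phi>" by (rule has_derivative_continuous_on[OF T(1)])
  have cf: "continuous_on UNIV f"
  proof -
    have "continuous_on D f" unfolding f_def
      by (intro continuous_intros N continuous_on_subset[OF cphi]) auto
    moreover have "continuous_on (- ?S) f"
    proof (rule continuous_on_eq[OF continuous_on_const])
      show "0 = f y" if "y \<in> - ?S" for y using T(5)[OF ComplD[OF that]] by (simp add: f_def)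
    qed
    ultimately have "continuous_on (D \<union> - ?S) f"
      using D by (intro continuous_on_open_Un open_Compl closed_closure)
    moreover have "D \<union> - ?S = UNIV" using T(4) sub by blast
    ultimately show ?thesis by simp
  qed
  have "f z = 0"
  proof (rule continuous_nonneg_integral_le_0_imp_0[OF cf])
    show "integrable lborel f"
    proof (rule integrable_continuous_compact_support[OF T(3) continuous_on_subset[OF cf subset_UNIV]])
      show "f y = 0" if "y \<notin> ?S" for y using T(5)[OF that] by (simp add: f_def)
    qed
    show "0 \<le> f y" for y
    proof (cases "y \<in> D'")
      case True
      then have "0 < \<sigma> * N y" by (simp add: D'_def)
      then show ?thesis unfolding f_def by (rule mult_nonneg_nonneg[OF less_imp_le \<phi>(2)])
    next
      case False
      then have "y \<notin> ?S" using T(4) by (rule contra_subsetD[rotated])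
      from T(5)[OF this] show ?thesis by (simp add: f_def)
    qed
    show "(\<integral>y. f y \<partial>lborel) \<le> 0" using test[OF tD] by (simp add: f_def mult.assoc)
  qed
  moreover have "0 < f z" using \<open>z \<in> D'\<close> \<phi>(3) by (simp add: f_def D'_def)
  ultimately show False by simp
qed

text \<open>The weak gradient \<open>V\<close> is eliminated by using the partial derivatives of a test function as test functions. What remains is an identity between \<open>u\<close> and
\<open>fd_flux m\<close> of \<open>u\<close>, where all derivatives can be moved back from the test function. The sum on the right-hand side is the Laplacian of \<open>fd_flux m\<close> of \<open>u\<close>, written out by the chain rule.\<close>
lemma weak_solution_imp_classical:
  fixes u :: "real \<times> (real ^ 'n) \<Rightarrow> real"
  assumes sol: "nonneg_weak_solution m T c R u"
    and D: "open D" "D \<subseteq> {0<..<T} \<times> ball c R"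
    and pos: "\<And>z. z \<in> D \<Longrightarrow> 0 < u z"
    and u': "\<And>z. z \<in> D \<Longrightarrow> (u has_derivative u' z) (at z)"
    and u'': "\<And>z b. z \<in> D \<Longrightarrow> b \<in> Basis \<Longrightarrow> ((\<lambda>z. u' z b) has_derivative u'' b z) (at z)"
    and cu': "\<And>b. b \<in> Basis \<Longrightarrow> continuous_on D (\<lambda>z. u' z b)"
    and cu'': "\<And>b b'. b \<in> Basis \<Longrightarrow> b' \<in> Basis \<Longrightarrow> continuous_on D (\<lambda>z. u'' b z b')"
    and z: "z \<in> D"
  shows "u' z (1, 0) = (\<Sum>b\<in>Basis. u z powr (m - 1) * u'' (0, b) z (0, b)
           + (m - 1) * u z powr (m - 2) * u' z (0, b) * u' z (0, b))"
proof -
  define \<Omega> where "\<Omega> = {0<..<T} \<times> ball c R"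
  define w where "w z = fd_flux m (u z)" for z
  define w' where "w' z v = u z powr (m - 1) * u' z v" for z v
  define w'' where "w'' b z v = u z powr (m - 1) * u'' b z v + (m - 1) * u z powr (m - 2) * u' z v * u' z b" for b z v
  have cu: "continuous_on D u"
    by (rule has_derivative_continuous_on) (rule has_derivative_at_withinI[OF u'])
  have w': "(w has_derivative w' z) (at z)" if "z \<in> D" for z
    using has_derivative_compose[OF u'[OF that] fd_flux_has_derivative[OF pos[OF that], unfolded has_field_derivative_def]]
    unfolding w_def w'_def[abs_def] .
  have w'': "((\<lambda>z. w' z b) has_derivative w'' b z) (at z)" if "z \<in> D" "b \<in> Basis" for z b
  proof -
    have p: "((\<lambda>s. s powr (m - 1)) has_derivative (*) ((m - 1) * u z powr (m - 1 - 1))) (at (u z))"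
      using has_real_derivative_powr[OF pos[OF that(1)], of "m - 1"] by (simp add: has_field_derivative_def)
    have "((\<lambda>z. u z powr (m - 1) * u' z b) has_derivative
        (\<lambda>v. u z powr (m - 1) * u'' b z v + ((m - 1) * u z powr (m - 1 - 1) * u' z v) * u' z b)) (at z)"
      by (rule has_derivative_mult[OF has_derivative_compose[OF u'[OF that(1)] p] u''[OF that]])
    then show ?thesis unfolding w'_def w''_def[abs_def] by (simp add: diff_diff_eq)
  qed
  have cw': "continuous_on D (\<lambda>z. w' z b)" if "b \<in> Basis" for b
    unfolding w'_def by (intro continuous_intros cu cu' that) (use pos in force)
  have cw'': "continuous_on D (\<lambda>z. w'' b z b)" if "b \<in> Basis" for b
    unfolding w''_def by (intro continuous_intros cu cu' cu'' that) (use pos in force)+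
  from sol obtain V where V: "L1_loc \<Omega> V" "weak_space_grad \<Omega> w V"
    "\<And>\<phi>. test_function \<Omega> \<phi> \<Longrightarrow> (LINT z:\<Omega>|lborel. u z * time_deriv \<phi> z) = (LINT z:\<Omega>|lborel. V z \<bullet> space_grad \<phi> z)"
    unfolding nonneg_weak_solution_def Let_def \<Omega>_def w_def[abs_def] by blast
  have restrict: "(LINT z:\<Omega>|lborel. F z) = (\<integral>z. F z \<partial>lborel)" if "\<And>z. z \<notin> D \<Longrightarrow> F z = 0" for F
    unfolding set_lebesgue_integral_def
  proof (rule Bochner_Integration.integral_cong[OF refl])
    show "indicator \<Omega> z *\<^sub>R F z = F z" for z
      using that[of z] D(2) by (cases "z \<in> \<Omega>") (auto simp: \<Omega>_def)
  qed
  define N where "N z = u' z (1, 0) - (\<Sum>b\<in>Basis. w'' (0, b) z (0, b))" for z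
  have "N z = 0"
  proof (rule vanishing_of_test_integrals[OF D(1) _ z])
    show "continuous_on D N" unfolding N_def
      by (intro continuous_on_diff continuous_on_sum cu' cw'' spacetime_Basis)
    fix \<phi> :: "real \<times> (real ^ 'n) \<Rightarrow> real" assume \<phi>: "test_function D \<phi>"
    note T = test_functionD[OF \<phi>]
    define \<phi>' where "\<phi>' z = frechet_derivative \<phi> (at z)" for z
    note T' = T[folded \<phi>'_def]
    have \<phi>\<Omega>: "test_function \<Omega> \<phi>" using \<phi> D(2) unfolding test_function_def \<Omega>_def by blast
    have off: "\<phi> z = 0" "\<phi>' z v = 0" if "z \<notin> D" for z v
    proof -
      have "z \<notin> closure {z. \<phi> z \<noteq> 0}" using T(4) that by (rule contra_subsetD)
      from T(5)[OF this] T(6)[OF this] show "\<phi> z = 0" "\<phi>' z v = 0" by (simp_all add: \<phi>'_def)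
    qed
    have time: "(LINT z:\<Omega>|lborel. u z * time_deriv \<phi> z) = - (\<integral>z. u' z (1, 0) * \<phi> z \<partial>lborel)"
      "integrable lborel (\<lambda>z. u' z (1, 0) * \<phi> z)"
    proof -
      note ibp = integral_by_parts_compact_support[OF D(1) u' cu'[OF spacetime_Basis(1)] T'(1) T'(2)[OF spacetime_Basis(1)] T(3,4,5)]
      show "integrable lborel (\<lambda>z. u' z (1, 0) * \<phi> z)" by (rule ibp(3))
      have "(LINT z:\<Omega>|lborel. u z * time_deriv \<phi> z) = (\<integral>z. u z * \<phi>' z (1, 0) \<partial>lborel)"
        unfolding time_deriv_def \<phi>'_def[symmetric] by (rule restrict) (simp add: off)
      also have "\<dots> = - (\<integral>z. u' z (1, 0) * \<phi> z \<partial>lborel)" by (rule ibp(1))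
      finally show "(LINT z:\<Omega>|lborel. u z * time_deriv \<phi> z) = - (\<integral>z. u' z (1, 0) * \<phi> z \<partial>lborel)" .
    qed
    have space: "(LINT z:\<Omega>|lborel. (V z $ i) * \<phi>' z (0, axis i 1)) = - (\<integral>z. w'' (0, axis i 1) z (0, axis i 1) * \<phi> z \<partial>lborel)"
      "integrable lborel (\<lambda>z. w'' (0, axis i 1) z (0, axis i 1) * \<phi> z)" for i
    proof -
      define b :: "real \<times> (real ^ 'n)" where "b = (0, axis i 1)"
      have b: "b \<in> Basis" unfolding b_def by (rule spacetime_Basis(2)) (simp add: Basis_vec_eq_axis)
      define \<eta> where "\<eta> = (\<lambda>z. \<phi>' z b)"
      have T2: "test_function D \<eta>" unfolding \<eta>_def by (rule T'(7)[OF b])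
      define \<eta>' where "\<eta>' z = frechet_derivative \<eta> (at z)" for z
      note S' = test_functionD[OF T2, folded \<eta>'_def]
      have \<eta>off: "\<eta>' z v = 0" if "z \<notin> D" for z v       using S'(6)[OF contra_subsetD[OF S'(4) that]] by simp
      have \<eta>\<Omega>: "test_function \<Omega> \<eta>"
        using T2 D(2) unfolding test_function_def \<Omega>_def by blast
      note ibp1 = integral_by_parts_compact_support[OF D(1) w' cw'[OF b] S'(1) S'(2)[OF b] S'(3,4,5)]
      note ibp2 = integral_by_parts_compact_support[OF D(1) w''[OF _ b] cw''[OF b] T'(1) T'(2)[OF b] T(3,4,5)]
      have "(LINT z:\<Omega>|lborel. w z * (space_grad \<eta> z $ i)) = - (LINT z:\<Omega>|lborel. (V z $ i) * \<eta> z)"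
        using V(2) \<eta>\<Omega> unfolding weak_space_grad_def by blast
      moreover have "(LINT z:\<Omega>|lborel. w z * (space_grad \<eta> z $ i)) = (\<integral>z. w z * \<eta>' z b \<partial>lborel)"
        unfolding space_grad_def vec_lambda_beta b_def[symmetric] \<eta>'_def[symmetric] by (rule restrict) (simp add: \<eta>off)
      moreover have "(\<integral>z. w z * \<eta>' z b \<partial>lborel) = - (\<integral>z. w' z b * \<eta> z \<partial>lborel)"
        by (rule ibp1(1))
      moreover have "(\<integral>z. w' z b * \<eta> z \<partial>lborel) = - (\<integral>z. w'' b z b * \<phi> z \<partial>lborel)"
        unfolding \<eta>_def by (rule ibp2(1))
      ultimately show "(LINT z:\<Omega>|lborel. (V z $ i) * \<phi>' z (0, axis i 1)) = - (\<integral>z. w'' (0, axis i 1) z (0, axis i 1) * \<phi> z \<partial>lborel)"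
        unfolding b_def[symmetric] \<eta>_def by simp
      show "integrable lborel (\<lambda>z. w'' (0, axis i 1) z (0, axis i 1) * \<phi> z)"
        unfolding b_def[symmetric] by (rule ibp2(3))
    qed
    have int_V: "set_integrable lborel \<Omega> (\<lambda>z. (V z $ i) * \<phi>' z (0, axis i 1))" for i
    proof -
      let ?S = "closure {z. \<phi> z \<noteq> 0}"
      have b: "(0, axis i 1) \<in> (Basis :: (real \<times> (real ^ 'n)) set)"
        by (rule spacetime_Basis(2)) (simp add: Basis_vec_eq_axis)
      have c: "continuous_on UNIV (\<lambda>z. \<phi>' z (0, axis i 1))" by (rule T'(2)[OF b])
      have "set_integrable lborel ?S V"
        using V(1) T(3,4) D(2) unfolding L1_loc_def \<Omega>_def by blast
      then have iV: "integrable lborel (\<lambda>z. (indicator ?S z *\<^sub>R V z) $ i)"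
        unfolding set_integrable_def by (rule integrable_bounded_linear[OF bounded_linear_vec_nth])
      have "bounded ((\<lambda>z. \<phi>' z (0, axis i 1)) ` ?S)"
        by (intro compact_imp_bounded compact_continuous_image T(3) continuous_on_subset[OF c]) simp
      then obtain B where B: "\<And>z. z \<in> ?S \<Longrightarrow> \<bar>\<phi>' z (0, axis i 1)\<bar> \<le> B" unfolding bounded_iff by auto
      have "integrable lborel (\<lambda>z. (indicator ?S z *\<^sub>R V z) $ i * \<phi>' z (0, axis i 1))"
      proof (rule Bochner_Integration.integrable_bound[OF integrable_mult_left[OF integrable_norm[OF iV], of B]])
        show "(\<lambda>z. (indicator ?S z *\<^sub>R V z) $ i * \<phi>' z (0, axis i 1)) \<in> borel_measurable lborel"
          using borel_measurable_integrable[OF iV] borel_measurable_continuous_onI[OF c]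
          by (intro borel_measurable_times) simp_all
        show "AE z in lborel. norm ((indicator ?S z *\<^sub>R V z) $ i * \<phi>' z (0, axis i 1))
            \<le> norm (norm ((indicator ?S z *\<^sub>R V z) $ i) * B)"
        proof (rule AE_I2)
          fix z
          show "norm ((indicator ?S z *\<^sub>R V z) $ i * \<phi>' z (0, axis i 1))
            \<le> norm (norm ((indicator ?S z *\<^sub>R V z) $ i) * B)"
          proof (cases "z \<in> ?S")
            case True
            have "\<bar>\<phi>' z (0, axis i 1)\<bar> \<le> \<bar>B\<bar>" using B[OF True] by linarith
            then show ?thesis by (simp add: abs_mult mult_left_mono)
          qed simp
        qed
      qed
      moreover have "(indicator ?S z *\<^sub>R V z) $ i * \<phi>' z (0, axis i 1) = indicator \<Omega> z *\<^sub>R ((V z $ i) * \<phi>' z (0, axis i 1))" for z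
      proof (cases "z \<in> ?S")
        case True
        then have "z \<in> \<Omega>" using T(4) D(2) unfolding \<Omega>_def by blast
        then show ?thesis using True by simp
      next
        case False
        then show ?thesis using T(6)[OF False] by (simp add: \<phi>'_def)
      qed
      ultimately show ?thesis unfolding set_integrable_def by (simp only:)
    qed
    have "(LINT z:\<Omega>|lborel. V z \<bullet> space_grad \<phi> z) = (LINT z:\<Omega>|lborel. (\<Sum>i\<in>UNIV. (V z $ i) * \<phi>' z (0, axis i 1)))"
      unfolding space_grad_def inner_vec_def \<phi>'_def by simp
    also have "\<dots> = (\<Sum>i\<in>UNIV. (LINT z:\<Omega>|lborel. (V z $ i) * \<phi>' z (0, axis i 1)))"
      unfolding set_lebesgue_integral_def scaleR_sum_right
      by (rule Bochner_Integration.integral_sum) (rule int_V[unfolded set_integrable_def])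
    also have "\<dots> = - (\<Sum>i\<in>UNIV. (\<integral>z. w'' (0, axis i 1) z (0, axis i 1) * \<phi> z \<partial>lborel))"
      by (simp add: space(1) sum_negf)
    also have "(\<Sum>i\<in>UNIV. (\<integral>z. w'' (0, axis i 1) z (0, axis i 1) * \<phi> z \<partial>lborel))
      = (\<integral>z. (\<Sum>i\<in>UNIV. w'' (0, axis i 1) z (0, axis i 1) * \<phi> z) \<partial>lborel)"
      by (rule Bochner_Integration.integral_sum[symmetric]) (rule space(2))
    finally have "(\<integral>z. u' z (1, 0) * \<phi> z \<partial>lborel) = (\<integral>z. (\<Sum>i\<in>UNIV. w'' (0, axis i 1) z (0, axis i 1) * \<phi> z) \<partial>lborel)"
      using V(3)[OF \<phi>\<Omega>] time(1) by simp
    then have "0 = (\<integral>z. u' z (1, 0) * \<phi> z - (\<Sum>i\<in>UNIV. w'' (0, axis i 1) z (0, axis i 1) * \<phi> z) \<partial>lborel)"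
      using time(2) space(2) by (subst Bochner_Integration.integral_diff) (auto intro!: Bochner_Integration.integrable_sum)
    also have "(\<lambda>z. u' z (1, 0) * \<phi> z - (\<Sum>i\<in>UNIV. w'' (0, axis i 1) z (0, axis i 1) * \<phi> z)) = (\<lambda>z. N z * \<phi> z)"
    proof
      fix z
      have "(\<Sum>b\<in>(Basis::(real^'n) set). w'' (0, b) z (0, b)) = (\<Sum>i\<in>(UNIV::'n set). w'' (0, axis i 1) z (0, axis i 1))"
        unfolding Basis_vec_eq_axis by (subst sum.reindex) (auto simp: inj_on_def axis_eq_axis)
      then show "u' z (1, 0) * \<phi> z - (\<Sum>i\<in>UNIV. w'' (0, axis i 1) z (0, axis i 1) * \<phi> z) = N z * \<phi> z"
        by (simp add: N_def left_diff_distrib sum_distrib_right)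
    qed
    finally show "(\<integral>z. N z * \<phi> z \<partial>lborel) = 0" by simp
  qed
  then show ?thesis unfolding N_def w''_def by simp
qed

section \<open>Rescaling and choice of a good point\<close>

lemma nn_integral_parabolic_scaling:
  fixes f :: "real \<times> 'a::euclidean_space \<Rightarrow> ennreal"
  assumes f: "f \<in> borel_measurable borel" and a: "0 < a" and l: "0 < l"
  shows "(\<integral>\<^sup>+z. f z \<partial>lborel)
    = ennreal (a * l ^ DIM('a)) * (\<integral>\<^sup>+z. f (t1 + a * fst z, x1 + l *\<^sub>R snd z) \<partial>lborel)"
proof -
  define c where "c j = (if j = (1, 0) then a else l)" for j :: "real \<times> 'a"
  define T where "T z = (t1, x1) + (\<Sum>j\<in>Basis. (c j * (z \<bullet> j)) *\<^sub>R j)" for z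
  have T: "T z = (t1 + a * fst z, x1 + l *\<^sub>R snd z)" for z
  proof -
    have "(\<Sum>j\<in>Basis. (c j * (z \<bullet> j)) *\<^sub>R j)
        = (\<Sum>j\<in>Basis. (c (j, 0) * (z \<bullet> (j, 0))) *\<^sub>R (j, 0)) + (\<Sum>j\<in>Basis. (c (0, j) * (z \<bullet> (0, j))) *\<^sub>R (0, j))"
      by (rule sum_Basis_prod_eq)
    also have "(\<Sum>j\<in>Basis. (c (j, 0) * (z \<bullet> (j, 0))) *\<^sub>R (j, 0::'a)) = (a * fst z, 0)"
      by (cases z) (simp add: c_def)
    also have "(\<Sum>j\<in>Basis. (c (0, j) * (z \<bullet> (0, j))) *\<^sub>R (0::real, j::'a)) = (0, \<Sum>j\<in>Basis. (l * (snd z \<bullet> j)) *\<^sub>R j)"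
    proof -
      have "(\<Sum>j\<in>Basis. (c (0, j) * (z \<bullet> (0, j))) *\<^sub>R (0::real, j::'a))
          = (\<Sum>j\<in>Basis. (0, (l * (snd z \<bullet> j)) *\<^sub>R j))"
        by (rule sum.cong) (auto simp: c_def inner_prod_def)
      then show ?thesis by (simp add: sum_prod)
    qed
    also have "(\<Sum>j\<in>Basis. (l * (snd z \<bullet> j)) *\<^sub>R j) = l *\<^sub>R snd z"
      by (simp only: scaleR_scaleR[symmetric] scaleR_sum_right[symmetric] euclidean_representation)
    finally show ?thesis by (simp add: T_def)
  qed
  have c0: "c j \<noteq> 0" for j using a l by (simp add: c_def)
  have "(\<Prod>j\<in>(Basis :: (real \<times> 'a) set). \<bar>c j\<bar>) = a * l ^ DIM('a)"
  proof -
    have B: "(Basis :: (real \<times> 'a) set) = insert (1, 0) (Pair 0 ` Basis)" by (auto simp: Basis_prod_def)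
    have n: "(1, 0) \<notin> Pair 0 ` (Basis :: 'a set)" by auto
    have "(\<Prod>j\<in>Pair 0 ` (Basis :: 'a set). \<bar>c j\<bar>) = (\<Prod>j\<in>(Basis :: 'a set). l)"
      using l by (subst prod.reindex) (auto simp: inj_on_def c_def)
    then show ?thesis unfolding B using a n by (subst prod.insert) (simp_all add: c_def)
  qed
  then have L: "(lborel :: (real \<times> 'a) measure) = density (distr lborel borel T) (\<lambda>_. ennreal (a * l ^ DIM('a)))"
    using lborel_affine_euclidean[of c "(t1, x1)"] c0 unfolding T_def[abs_def] by simp
  have Tm: "T \<in> borel \<rightarrow>\<^sub>M borel" unfolding T_def[abs_def] by measurable
  have "(\<integral>\<^sup>+z. f z \<partial>lborel) = (\<integral>\<^sup>+z. f z \<partial>density (distr lborel borel T) (\<lambda>_. ennreal (a * l ^ DIM('a))))"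
    by (rule arg_cong[OF L, of "\<lambda>M. nn_integral M f"])
  also have "\<dots> = (\<integral>\<^sup>+z. ennreal (a * l ^ DIM('a)) * f z \<partial>distr lborel borel T)"
    by (rule nn_integral_density) (use f in simp_all)
  also have "\<dots> = (\<integral>\<^sup>+z. ennreal (a * l ^ DIM('a)) * f (T z) \<partial>lborel)"
    using f Tm by (subst nn_integral_distr) auto
  also have "\<dots> = ennreal (a * l ^ DIM('a)) * (\<integral>\<^sup>+z. f (T z) \<partial>lborel)"
    using f Tm by (intro nn_integral_cmult) auto
  finally show ?thesis unfolding T .
qed

text \<open>Maximise \<open>u\<close> times the power \<open>\<alpha>\<close> of the parabolic distance $\omega$ to the boundary, and take half that distance as $\sigma$. On the smaller cylinder $\omega$ is at least $\sigma$, which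
is half of its value at the maximum point, so that \<open>u\<close> can exceed its value there at most by the factor $2^\alpha$.\<close>
lemma parabolic_point_picking:
  fixes u :: "real \<times> 'a::euclidean_space \<Rightarrow> real"
  assumes \<rho>: "0 < \<rho>" and \<alpha>: "0 < \<alpha>"
    and cont: "continuous_on ({t0 - \<rho>\<^sup>2..t0} \<times> cball x0 \<rho>) u"
    and pos: "\<And>z. z \<in> {t0 - \<rho>\<^sup>2..t0} \<times> cball x0 \<rho> \<Longrightarrow> 0 < u z"
  obtains t1 x1 \<sigma> where "0 < \<sigma>" "2 * \<sigma> \<le> \<rho>"
    "{t1 - \<sigma>\<^sup>2..t1} \<times> cball x1 \<sigma> \<subseteq> {t0 - \<rho>\<^sup>2..t0} \<times> cball x0 \<rho>"
    "u (t0, x0) * \<rho> powr \<alpha> \<le> u (t1, x1) * (2 * \<sigma>) powr \<alpha>"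
    "\<And>z. z \<in> {t1 - \<sigma>\<^sup>2..t1} \<times> cball x1 \<sigma> \<Longrightarrow> u z \<le> 2 powr \<alpha> * u (t1, x1)"
proof -
  define Z where "Z = {t0 - \<rho>\<^sup>2..t0} \<times> cball x0 \<rho>"
  define \<omega> where "\<omega> z = \<rho> - max (dist x0 (snd z)) (sqrt (t0 - fst z))" for z :: "real \<times> 'a"
  define F where "F z = u z * \<omega> z powr \<alpha>" for z
  have \<omega>0: "0 \<le> \<omega> z" if "z \<in> Z" for z
  proof -
    have "sqrt (t0 - fst z) \<le> sqrt (\<rho>\<^sup>2)" using that by (intro real_sqrt_le_mono) (auto simp: Z_def)
    then have "sqrt (t0 - fst z) \<le> \<rho>" using \<rho> by simp
    moreover have "dist x0 (snd z) \<le> \<rho>" using that by (auto simp: Z_def)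
    ultimately show ?thesis unfolding \<omega>_def by (simp only: diff_ge_0_iff_ge max.bounded_iff)
  qed
  have c\<omega>: "continuous_on Z \<omega>" unfolding \<omega>_def by (intro continuous_intros)
  have cF: "continuous_on Z F"
    unfolding F_def
    by (intro continuous_on_mult continuous_on_powr' continuous_on_const c\<omega> cont[folded Z_def])
      (use \<omega>0 \<alpha> in auto)
  have z0: "(t0, x0) \<in> Z" using \<rho> by (simp add: Z_def)
  have "compact Z" unfolding Z_def by (intro compact_Times compact_Icc compact_cball)
  then obtain z1 where z1: "z1 \<in> Z" "\<And>z. z \<in> Z \<Longrightarrow> F z \<le> F z1"
    using continuous_attains_sup[OF _ _ cF] z0 by blast
  obtain t1 x1 where z1_eq: "z1 = (t1, x1)" by (cases z1)
  define \<sigma> where "\<sigma> = \<omega> z1 / 2"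
  have "0 < F (t0, x0)" using pos[folded Z_def, OF z0] \<rho> by (simp add: F_def \<omega>_def)
  then have "0 < F z1" using z1(2)[OF z0] by linarith
  then have "\<omega> z1 \<noteq> 0" by (auto simp: F_def)
  then have \<sigma>: "0 < \<sigma>" using \<omega>0[OF z1(1)] by (simp add: \<sigma>_def)
  have w1: "dist x0 x1 \<le> \<rho> - 2 * \<sigma>" "sqrt (t0 - t1) \<le> \<rho> - 2 * \<sigma>"
  proof -
    have "2 * \<sigma> = \<omega> (t1, x1)" unfolding \<sigma>_def z1_eq by simp
    then have "max (dist x0 x1) (sqrt (t0 - t1)) = \<rho> - 2 * \<sigma>" unfolding \<omega>_def fst_conv snd_conv by linarith
    note eq = this[symmetric]
    show "dist x0 x1 \<le> \<rho> - 2 * \<sigma>" unfolding eq by (rule max.cobounded1)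
    show "sqrt (t0 - t1) \<le> \<rho> - 2 * \<sigma>" unfolding eq by (rule max.cobounded2)
  qed
  have t1: "t1 \<le> t0"
    using z1(1) unfolding Z_def z1_eq by (simp only: mem_Times_iff atLeastAtMost_iff fst_conv)
  have near: "z \<in> Z" "\<sigma> \<le> \<omega> z" if z: "z \<in> {t1 - \<sigma>\<^sup>2..t1} \<times> cball x1 \<sigma>" for z
  proof -
    obtain t x where zx: "z = (t, x)" by (cases z)
    have t: "t1 - \<sigma>\<^sup>2 \<le> t" "t \<le> t1" and x: "dist x1 x \<le> \<sigma>" using z by (auto simp: zx)
    have d: "dist x0 x \<le> \<rho> - \<sigma>" using dist_triangle[of x0 x x1] x w1(1) by linarith
    have "sqrt (t0 - t) \<le> sqrt ((t0 - t1) + \<sigma>\<^sup>2)" using t by (intro real_sqrt_le_mono) linarith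
    also have "\<dots> \<le> sqrt (t0 - t1) + sqrt (\<sigma>\<^sup>2)" using t1 by (intro sqrt_add_le_add_sqrt) auto
    also have "\<dots> \<le> \<rho> - \<sigma>" using w1(2) \<sigma> by simp
    finally have s: "sqrt (t0 - t) \<le> \<rho> - \<sigma>" .
    then have "max (dist x0 x) (sqrt (t0 - t)) \<le> \<rho> - \<sigma>" using d by (simp only: max.bounded_iff)
    then show "\<sigma> \<le> \<omega> z" unfolding \<omega>_def zx fst_conv snd_conv by linarith
    have "sqrt (t0 - t) \<le> \<rho>" using s \<sigma> by linarith
    then have "t0 - t \<le> \<rho>\<^sup>2" by (rule sqrt_le_D)
    then show "z \<in> Z" using t t1 d \<sigma> by (simp add: Z_def zx)
  qed
  show thesis
  proof (rule that[of \<sigma> t1 x1])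
    show "0 < \<sigma>" by (rule \<sigma>)
    show "2 * \<sigma> \<le> \<rho>" using w1(1) zero_le_dist[of x0 x1] by linarith
    show "{t1 - \<sigma>\<^sup>2..t1} \<times> cball x1 \<sigma> \<subseteq> {t0 - \<rho>\<^sup>2..t0} \<times> cball x0 \<rho>"
      using near(1) unfolding Z_def by blast
    show "u (t0, x0) * \<rho> powr \<alpha> \<le> u (t1, x1) * (2 * \<sigma>) powr \<alpha>"
    proof -
      have "\<omega> (t0, x0) = \<rho>" "\<omega> (t1, x1) = 2 * \<sigma>" using \<rho> unfolding \<sigma>_def z1_eq by (simp_all add: \<omega>_def)
      then show ?thesis using z1(2)[OF z0] by (simp add: F_def z1_eq)
    qed
    show "u z \<le> 2 powr \<alpha> * u (t1, x1)" if z: "z \<in> {t1 - \<sigma>\<^sup>2..t1} \<times> cball x1 \<sigma>" for z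
    proof -
      have "u z * \<sigma> powr \<alpha> \<le> u z * \<omega> z powr \<alpha>"
        using near[OF z] \<sigma> \<alpha> pos[folded Z_def, of z] by (intro mult_left_mono powr_mono2) auto
      also have "\<dots> \<le> u (t1, x1) * (2 * \<sigma>) powr \<alpha>"
    proof -
      have "\<omega> (t1, x1) = 2 * \<sigma>" unfolding \<sigma>_def z1_eq by simp
      then show ?thesis using z1(2)[OF near(1)[OF z]] by (simp add: F_def z1_eq)
    qed
      also have "\<dots> = (2 powr \<alpha> * u (t1, x1)) * \<sigma> powr \<alpha>"
        by (subst powr_mult) (simp_all add: mult_ac)
      finally show ?thesis using \<sigma> by (simp add: mult_le_cancel_right)
    qed
  qed
qed

lemma linear_on_space_directions:
  fixes L :: "real \<times> 'a::euclidean_space \<Rightarrow> real"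
  assumes "linear L"
  shows "L (0, v) = (\<Sum>b\<in>Basis. (v \<bullet> b) * L (0, b))" and "L (0, r *\<^sub>R v) = r * L (0, v)" and "L (r, 0) = r * L (1, 0)"
proof -
  have "linear (L \<circ> Pair 0)" by (rule linear_compose[OF _ assms]) (simp add: linear_iff)
  then interpret S: linear "L \<circ> Pair 0" .
  have "(L \<circ> Pair 0) (\<Sum>b\<in>Basis. (v \<bullet> b) *\<^sub>R b) = (\<Sum>b\<in>Basis. (v \<bullet> b) *\<^sub>R (L \<circ> Pair 0) b)"
    unfolding S.sum S.scale ..
  then show "L (0, v) = (\<Sum>b\<in>Basis. (v \<bullet> b) * L (0, b))" by (simp add: euclidean_representation)
  show "L (0, r *\<^sub>R v) = r * L (0, v)" using linear_scale[OF assms, of r "(0, v)"] by simp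
  show "L (r, 0) = r * L (1, 0)" using linear_scale[OF assms, of r "(1, 0)"] by simp
qed

text \<open>Here \<open>u'' b\<close> is the derivative of the partial derivative of \<open>u\<close> in the direction \<open>b\<close>; the first component of space-time is time.\<close>
locale classical_fast_diffusion =
  fixes m :: real and D :: "(real \<times> 'a::euclidean_space) set" and u :: "real \<times> 'a \<Rightarrow> real"
    and u' :: "real \<times> 'a \<Rightarrow> real \<times> 'a \<Rightarrow> real" and u'' :: "real \<times> 'a \<Rightarrow> real \<times> 'a \<Rightarrow> real \<times> 'a \<Rightarrow> real"
  assumes pos: "\<And>z. z \<in> D \<Longrightarrow> 0 < u z"
    and u': "\<And>z. z \<in> D \<Longrightarrow> (u has_derivative u' z) (at z)"
    and u'': "\<And>z b. z \<in> D \<Longrightarrow> b \<in> Basis \<Longrightarrow> ((\<lambda>z. u' z b) has_derivative u'' b z) (at z)"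
    and cu': "\<And>b. b \<in> Basis \<Longrightarrow> continuous_on D (\<lambda>z. u' z b)"
    and cu'': "\<And>b b'. b \<in> Basis \<Longrightarrow> b' \<in> Basis \<Longrightarrow> continuous_on D (\<lambda>z. u'' b z b')"
    and pde: "\<And>z. z \<in> D \<Longrightarrow> u' z (1, 0) = (\<Sum>b\<in>Basis. u z powr (m - 1) * u'' (0, b) z (0, b)
           + (m - 1) * u z powr (m - 2) * u' z (0, b) * u' z (0, b))"
begin

lemma continuous_u: "continuous_on D u"
  by (rule has_derivative_continuous_on) (rule has_derivative_at_withinI[OF u'])

text \<open>The equation is invariant because the squared spatial scale is $l^2 = \sigma^2 M^{m-1}$: time derivatives of $u/M$ acquire the factor $\sigma^2/M$, and second spatial derivatives of the flux the factor $l^2 M^{-m}$, which is the same.\<close>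
lemma rescaled_unit_cylinder:
  assumes m: "m < 1" and K: "1 \<le> K" and M: "0 < M" and \<sigma>: "0 < \<sigma>"
  defines "l \<equiv> \<sigma> * M powr ((m - 1) / 2)"
  assumes sub: "{t1 - \<sigma>\<^sup>2..t1} \<times> ball x1 l \<subseteq> D"
    and le: "\<And>z. z \<in> {t1 - \<sigma>\<^sup>2..t1} \<times> ball x1 l \<Longrightarrow> u z \<le> K * M"
  shows "\<exists>ut g Q. fast_diffusion_unit_cylinder m K (\<lambda>t x. u (t1 + \<sigma>\<^sup>2 * t, x1 + l *\<^sub>R x) / M) ut g Q"
proof -
  have l: "0 < l" using \<sigma> M by (simp add: l_def)
  have l2: "l * l = \<sigma>\<^sup>2 * M powr (m - 1)"
  proof -
    have "M powr ((m - 1) / 2) * M powr ((m - 1) / 2) = M powr (m - 1)"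
      unfolding powr_add[symmetric] by simp
    then show ?thesis unfolding l_def power2_eq_square by (simp only: mult_ac)
  qed
  define P where "P t x = (t1 + \<sigma>\<^sup>2 * t, x1 + l *\<^sub>R x)" for t and x :: 'a
  define U where "U t x = u (P t x) / M" for t x
  define ut where "ut t x = u' (P t x) (1, 0) * \<sigma>\<^sup>2 / M" for t x
  define g where "g t x = (\<Sum>b\<in>Basis. (u' (P t x) (0, b) * l / M) *\<^sub>R b)" for t x
  define q' where "q' b t x v = U t x powr (m - 1) * (u'' (0, b) (P t x) (0, l *\<^sub>R v) * l / M)
    + (m - 1) * U t x powr (m - 1 - 1) * (g t x \<bullet> v) * (u' (P t x) (0, b) * l / M)" for b t x v
  define Q where "Q t x v = (\<Sum>b\<in>Basis. q' b t x v *\<^sub>R b)" for t x v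
  have PD: "P t x \<in> {t1 - \<sigma>\<^sup>2..t1} \<times> ball x1 l" if "t \<in> {-1..0}" "x \<in> ball 0 1" for t x
  proof -
    have "\<sigma>\<^sup>2 * (-1) \<le> \<sigma>\<^sup>2 * t" "\<sigma>\<^sup>2 * t \<le> 0"
      using that(1) mult_left_mono[of "-1" t "\<sigma>\<^sup>2"] mult_left_mono[of t 0 "\<sigma>\<^sup>2"] by simp_all
    moreover have "norm (l *\<^sub>R x) < l" using that(2) l by simp
    ultimately show ?thesis by (simp add: P_def dist_norm)
  qed
  have PD': "P t x \<in> D" if "t \<in> {-1..0}" "x \<in> ball 0 1" for t x by (rule subsetD[OF sub PD[OF that]])
  have Ppos: "0 < u (P t x)" if "t \<in> {-1..0}" "x \<in> ball 0 1" for t x by (rule pos[OF PD'[OF that]])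
  have cP: "continuous_on S (\<lambda>z. P (fst z) (snd z))" for S
    unfolding P_def by (intro continuous_intros)
  have img: "(\<lambda>z. P (fst z) (snd z)) ` ({-1..0} \<times> ball 0 1) \<subseteq> D"
  proof (rule image_subsetI)
    fix z :: "real \<times> 'a" assume "z \<in> {-1..0} \<times> ball 0 1"
    then have "fst z \<in> {-1..0}" "snd z \<in> ball 0 1" unfolding mem_Times_iff by blast+
    then show "P (fst z) (snd z) \<in> D" by (rule PD')
  qed
  have comp: "continuous_on ({-1..0} \<times> ball 0 1) (\<lambda>z. f (P (fst z) (snd z)))" if "continuous_on D f" for f :: "_ \<Rightarrow> real"
    by (rule continuous_on_compose2[OF that cP img])
  have grad: "g t x \<bullet> v = u' (P t x) (0, l *\<^sub>R v) / M" if "t \<in> {-1..0}" "x \<in> ball 0 1" for t x v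
  proof -
    note L = linear_on_space_directions[OF has_derivative_linear[OF u'[OF PD'[OF that]]]]
    have "g t x \<bullet> v = (\<Sum>b\<in>Basis. l / M * ((v \<bullet> b) * u' (P t x) (0, b)))"
      unfolding g_def inner_sum_left inner_scaleR_left
      by (rule sum.cong[OF refl]) (simp add: inner_commute[of _ v])
    also have "\<dots> = l / M * u' (P t x) (0, v)" unfolding L(1)[of v] sum_distrib_left ..
    also have "\<dots> = u' (P t x) (0, l *\<^sub>R v) / M" unfolding L(2) by simp
    finally show ?thesis .
  qed
  have dx: "((\<lambda>x. P t x) has_derivative (\<lambda>v. (0, l *\<^sub>R v))) (at x)" for t x
    unfolding P_def
    by (rule has_derivative_eq_rhs[OF has_derivative_Pair[OF has_derivative_const has_derivative_add[OF
          has_derivative_const has_derivative_scaleR_right[OF has_derivative_ident]]]]) simp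
  have Ux: "((\<lambda>x. U t x) has_derivative (\<lambda>v. g t x \<bullet> v)) (at x)" if "t \<in> {-1..0}" "x \<in> ball 0 1" for t x
  proof -
    have "((\<lambda>x. u (P t x)) has_derivative (\<lambda>v. u' (P t x) (0, l *\<^sub>R v))) (at x)"
      by (rule has_derivative_compose[OF dx u'[OF PD'[OF that]]])
    from bounded_linear.has_derivative[OF bounded_linear_divide[of M] this] show ?thesis unfolding U_def grad[OF that] .
  qed
  have Ut: "((\<lambda>t. U t x) has_real_derivative ut t x) (at t within {-1..0})" if "t \<in> {-1..0}" "x \<in> ball 0 1" for t x
  proof -
    note L = linear_on_space_directions[OF has_derivative_linear[OF u'[OF PD'[OF that]]]]
    have dt: "((\<lambda>t. P t x) has_derivative (\<lambda>h. (\<sigma>\<^sup>2 * h, 0))) (at t within {-1..0})"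
      unfolding P_def
      by (rule has_derivative_eq_rhs[OF has_derivative_Pair[OF has_derivative_add[OF has_derivative_const
            has_derivative_mult_right[OF has_derivative_ident]] has_derivative_const]]) simp
    have "((\<lambda>t. u (P t x)) has_derivative (\<lambda>h. u' (P t x) (\<sigma>\<^sup>2 * h, 0))) (at t within {-1..0})"
      by (rule has_derivative_compose[OF dt u'[OF PD'[OF that]]])
    then have "((\<lambda>t. u (P t x)) has_real_derivative u' (P t x) (1, 0) * \<sigma>\<^sup>2) (at t within {-1..0})"
      unfolding has_field_derivative_def by (rule has_derivative_eq_rhs) (simp add: fun_eq_iff L(3)[of "\<sigma>\<^sup>2 * _"])
    from DERIV_cdivide[OF this, of M] show ?thesis unfolding U_def ut_def .
  qed
  have Qx: "((\<lambda>x. U t x powr (m - 1) *\<^sub>R g t x) has_derivative Q t x) (at x)" if "t \<in> {-1..0}" "x \<in> ball 0 1" for t x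
  proof -
    have Upos: "0 < U t x" using Ppos[OF that] M by (simp add: U_def)
    have p: "((\<lambda>s. s powr (m - 1)) has_derivative (*) ((m - 1) * U t x powr (m - 1 - 1))) (at (U t x))"
      using has_real_derivative_powr[OF Upos, of "m - 1"] by (simp only: has_field_derivative_def)
    have pU: "((\<lambda>x. U t x powr (m - 1)) has_derivative (\<lambda>v. (m - 1) * U t x powr (m - 1 - 1) * (g t x \<bullet> v))) (at x)"
      by (rule has_derivative_compose[OF Ux[OF that] p])
    note PDx = PD'[OF that]
    have gb: "((\<lambda>x. u' (P t x) (0, b) * l / M) has_derivative (\<lambda>v. u'' (0, b) (P t x) (0, l *\<^sub>R v) * l / M)) (at x)"
      if b: "b \<in> Basis" for b
    proof -
      have "((\<lambda>x. u' (P t x) (0, b)) has_derivative (\<lambda>v. u'' (0, b) (P t x) (0, l *\<^sub>R v))) (at x)"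
        by (rule has_derivative_compose[OF dx u''[OF PDx spacetime_Basis(2)[OF b]]])
      from bounded_linear.has_derivative[OF bounded_linear_divide[of M] has_derivative_mult_left[OF this, of l]] show ?thesis .
    qed
    have "((\<lambda>x. \<Sum>b\<in>Basis. (U t x powr (m - 1) * (u' (P t x) (0, b) * l / M)) *\<^sub>R b) has_derivative
        (\<lambda>v. \<Sum>b\<in>Basis. q' b t x v *\<^sub>R b)) (at x)"
      unfolding q'_def
      by (intro has_derivative_sum has_derivative_scaleR_left has_derivative_mult[OF pU gb])
    then show ?thesis unfolding Q_def[abs_def] g_def scaleR_sum_right scaleR_scaleR .
  qed
  define R where "R b t x = U t x powr (m - 1) * (u'' (0, b) (P t x) (0, b) * (l * l) / M)
    + (m - 1) * U t x powr (m - 2) * (u' (P t x) (0, b) * l / M) * (u' (P t x) (0, b) * l / M)" for b t x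
  have Qb: "Q t x b \<bullet> b = R b t x" if "t \<in> {-1..0}" "x \<in> ball 0 1" "b \<in> Basis" for t x b
  proof -
    note L1 = linear_on_space_directions(2)[OF has_derivative_linear[OF u'[OF PD'[OF that(1,2)]]]]
    note L2 = linear_on_space_directions(2)[OF has_derivative_linear[OF u''[OF PD'[OF that(1,2)] spacetime_Basis(2)[OF that(3)]]]]
    have "Q t x b \<bullet> b = q' b t x b" unfolding Q_def by (rule inner_sum_left_Basis[OF that(3)])
    also have "\<dots> = R b t x"
      unfolding q'_def R_def grad[OF that(1,2)] L1 L2 by (simp add: mult_ac diff_diff_eq)
    finally show ?thesis .
  qed
  have eq: "ut t x = (\<Sum>b\<in>Basis. Q t x b \<bullet> b)" if "t \<in> {-1..0}" "x \<in> ball 0 1" for t x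
  proof -
    have "R b t x = \<sigma>\<^sup>2 / M * (u (P t x) powr (m - 1) * u'' (0, b) (P t x) (0, b)
           + (m - 1) * u (P t x) powr (m - 2) * u' (P t x) (0, b) * u' (P t x) (0, b))" for b
    proof -
      have U1: "U t x powr (m - 1) * (l * l) = \<sigma>\<^sup>2 * u (P t x) powr (m - 1)"
        unfolding U_def l2 using Ppos[OF that] M by (simp add: powr_divide)
      have "U t x powr (m - 2) * (l * l) = \<sigma>\<^sup>2 * u (P t x) powr (m - 2) * (M powr (m - 1) / M powr (m - 2))"
        unfolding U_def l2 using Ppos[OF that] M by (simp add: powr_divide)
      also have "M powr (m - 1) / M powr (m - 2) = M" using M by (simp flip: powr_diff)
      finally have U2: "U t x powr (m - 2) * (l * l) = \<sigma>\<^sup>2 * u (P t x) powr (m - 2) * M" .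
      have "R b t x = (U t x powr (m - 1) * (l * l)) * u'' (0, b) (P t x) (0, b) / M
        + (m - 1) * (U t x powr (m - 2) * (l * l)) * u' (P t x) (0, b) * u' (P t x) (0, b) / (M * M)"
        unfolding R_def by (simp add: mult_ac)
      also have "\<dots> = \<sigma>\<^sup>2 / M * (u (P t x) powr (m - 1) * u'' (0, b) (P t x) (0, b)
           + (m - 1) * u (P t x) powr (m - 2) * u' (P t x) (0, b) * u' (P t x) (0, b))"
        unfolding U1 U2 using M by (simp add: field_simps)
      finally show ?thesis .
    qed
    then have "(\<Sum>b\<in>Basis. R b t x) = \<sigma>\<^sup>2 / M * u' (P t x) (1, 0)"
      unfolding pde[OF PD'[OF that]] sum_distrib_left by simp
    then show ?thesis using Qb[OF that] by (simp add: ut_def)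
  qed
  have cU: "continuous_on ({-1..0} \<times> ball 0 1) (\<lambda>z. U (fst z) (snd z))"
    unfolding U_def by (intro continuous_on_divide comp continuous_u continuous_on_const) (use M in simp)
  have Upos: "0 < U t x" if "t \<in> {-1..0}" "x \<in> ball 0 1" for t x using Ppos[OF that] M by (simp add: U_def)
  have cpow: "continuous_on ({-1..0} \<times> ball 0 1) (\<lambda>z. U (fst z) (snd z) powr a)" for a
    by (intro continuous_on_powr cU continuous_on_const) (use Upos in force)
  have "fast_diffusion_unit_cylinder m K U ut g Q"
  proof
    show "m < 1" "1 \<le> K" by (rule m, rule K)
    show "0 < U t x" if "t \<in> {-1..0}" "x \<in> ball 0 1" for t x by (rule Upos[OF that])
    show "U t x \<le> K" if "t \<in> {-1..0}" "x \<in> ball 0 1" for t x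
      unfolding U_def pos_divide_le_eq[OF M] by (rule le[OF PD[OF that]])
    show "((\<lambda>t. U t x) has_real_derivative ut t x) (at t within {-1..0})" if "t \<in> {-1..0}" "x \<in> ball 0 1" for t x
      by (rule Ut[OF that])
    show "((\<lambda>x. U t x) has_derivative (\<lambda>v. g t x \<bullet> v)) (at x)" if "t \<in> {-1..0}" "x \<in> ball 0 1" for t x
      by (rule Ux[OF that])
    show "((\<lambda>x. U t x powr (m - 1) *\<^sub>R g t x) has_derivative Q t x) (at x)" if "t \<in> {-1..0}" "x \<in> ball 0 1" for t x
      by (rule Qx[OF that])
    show "ut t x = (\<Sum>b\<in>Basis. Q t x b \<bullet> b)" if "t \<in> {-1..0}" "x \<in> ball 0 1" for t x
      by (rule eq[OF that])
    show "continuous_on ({-1..0} \<times> ball 0 1) (\<lambda>z. U (fst z) (snd z))" by (rule cU)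
    show "continuous_on ({-1..0} \<times> ball 0 1) (\<lambda>z. ut (fst z) (snd z))"
      unfolding ut_def
      by (intro continuous_on_divide continuous_on_mult comp cu' spacetime_Basis continuous_on_const) (use M in simp)
    show "continuous_on ({-1..0} \<times> ball 0 1) (\<lambda>z. g (fst z) (snd z))"
      unfolding g_def
      by (intro continuous_on_sum continuous_on_scaleR continuous_on_divide continuous_on_mult comp cu'
          spacetime_Basis continuous_on_const) (use M in simp_all)
    show "continuous_on ({-1..0} \<times> ball 0 1) (\<lambda>z. Q (fst z) (snd z) b \<bullet> b)" if b: "b \<in> Basis" for b
    proof (rule continuous_on_eq)
      show "continuous_on ({-1..0} \<times> ball 0 1) (\<lambda>z. R b (fst z) (snd z))"
        unfolding R_def
        by (intro continuous_on_add continuous_on_divide continuous_on_mult comp cu' cu'' cpow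
          spacetime_Basis b continuous_on_const) (use M in simp_all)
      show "R b (fst z) (snd z) = Q (fst z) (snd z) b \<bullet> b" if "z \<in> {-1..0} \<times> ball 0 1" for z
        by (rule Qb[symmetric]) (use that b in auto)
    qed
  qed
  then show ?thesis unfolding U_def[abs_def] P_def by blast
qed

end

text \<open>The Jacobian of the rescaling and the factor $M^p$ from $u = M \cdot (u/M)$ combine to $\sigma^{d+2} M^{N/2}$; raising the inequality of \<open>parabolic_point_picking\<close> to the power $N/2$ bounds this from below by the data at the centre.\<close>
lemma classical_solution_lower_bound:
  fixes m p d N :: real
  assumes m: "m < 1" and p: "0 \<le> p" and d: "d = real DIM('a::euclidean_space)"
    and N: "N = 2 * p + d * (m - 1)" "0 < N"
  obtains c where "0 < c"
    "\<And>D u u' u'' t0 x0 \<rho>. classical_fast_diffusion m (D :: (real \<times> 'a) set) u u' u'' \<Longrightarrow> 0 < \<rho> \<Longrightarrow>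
      {t0 - \<rho>\<^sup>2..t0} \<times> cball x0 \<rho> \<subseteq> D \<Longrightarrow> 1 \<le> u (t0, x0) \<Longrightarrow>
      ennreal (c * u (t0, x0) powr (N / 2) * \<rho> powr (d + 2))
        \<le> (\<integral>\<^sup>+z \<in> {t0 - \<rho>\<^sup>2..t0} \<times> cball x0 \<rho>. ennreal (u z powr p) \<partial>lborel)"
proof -
  define \<alpha> where "\<alpha> = 2 * (d + 2) / N"
  have d0: "0 \<le> d" using d by simp
  have \<alpha>: "0 < \<alpha>" using N(2) d0 by (simp add: \<alpha>_def)
  define K :: real where "K = 2 powr \<alpha>"
  have K: "1 \<le> K" unfolding K_def using \<alpha> by (intro ge_one_powr_ge_zero) auto
  obtain c0 where c0: "0 < c0" "\<And>u ut g Q. fast_diffusion_unit_cylinder m K u ut g (Q :: real \<Rightarrow> 'a \<Rightarrow> 'a \<Rightarrow> 'a) \<Longrightarrow> 1 \<le> u 0 0 \<Longrightarrow>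
     ennreal c0 \<le> (\<integral>\<^sup>+z \<in> {-1..0} \<times> ball 0 1. ennreal (u (fst z) (snd z) powr p) \<partial>lborel)"
    using unit_cylinder_lower_bound[where 'a='a, OF m K p] by blast
  define c where "c = c0 * 2 powr (- (d + 2))"
  show thesis
  proof (rule that)
    show "0 < c" using c0(1) by (simp add: c_def)
    fix D :: "(real \<times> 'a) set" and u u' u'' t0 x0 and \<rho> :: real
    assume sol: "classical_fast_diffusion m D u u' u''" and \<rho>: "0 < \<rho>"
      and sub: "{t0 - \<rho>\<^sup>2..t0} \<times> cball x0 \<rho> \<subseteq> D" and u0: "1 \<le> u (t0, x0)"
    interpret classical_fast_diffusion m D u u' u'' by (rule sol)
    obtain t1 x1 \<sigma> where \<sigma>: "0 < \<sigma>" "2 * \<sigma> \<le> \<rho>"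
      and cyl: "{t1 - \<sigma>\<^sup>2..t1} \<times> cball x1 \<sigma> \<subseteq> {t0 - \<rho>\<^sup>2..t0} \<times> cball x0 \<rho>"
      and pick: "u (t0, x0) * \<rho> powr \<alpha> \<le> u (t1, x1) * (2 * \<sigma>) powr \<alpha>"
      and le: "\<And>z. z \<in> {t1 - \<sigma>\<^sup>2..t1} \<times> cball x1 \<sigma> \<Longrightarrow> u z \<le> 2 powr \<alpha> * u (t1, x1)"
    proof (rule parabolic_point_picking[OF \<rho> \<alpha> continuous_on_subset[OF continuous_u sub]])
      show "0 < u z" if "z \<in> {t0 - \<rho>\<^sup>2..t0} \<times> cball x0 \<rho>" for z
        by (rule pos[OF subsetD[OF sub that]])
    qed (rule that, assumption, assumption, assumption, assumption, blast)
    define M where "M = u (t1, x1)"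
    have M1: "1 \<le> M"
    proof -
      have "(2 * \<sigma>) powr \<alpha> \<le> \<rho> powr \<alpha>" using \<sigma> \<alpha> by (intro powr_mono2) auto
      moreover have "(t1, x1) \<in> {t1 - \<sigma>\<^sup>2..t1} \<times> cball x1 \<sigma>" using \<sigma>(1) by simp
      then have "0 < M" unfolding M_def by (intro pos subsetD[OF sub] subsetD[OF cyl])
      ultimately have "u (t1, x1) * (2 * \<sigma>) powr \<alpha> \<le> M * \<rho> powr \<alpha>"
        unfolding M_def[symmetric] by (rule mult_left_mono[OF _ less_imp_le])
      with pick have "u (t0, x0) * \<rho> powr \<alpha> \<le> M * \<rho> powr \<alpha>" by linarith
      moreover have "0 < \<rho> powr \<alpha>" using \<rho> by simp
      ultimately have "u (t0, x0) \<le> M" by (rule mult_right_le_imp_le)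
      then show ?thesis using u0 by linarith
    qed
    then have M: "0 < M" by linarith
    define l where "l = \<sigma> * M powr ((m - 1) / 2)"
    have l: "0 < l" using \<sigma>(1) M by (simp add: l_def)
    have "M powr ((m - 1) / 2) \<le> M powr 0" using m M1 by (intro powr_mono) auto
    then have "M powr ((m - 1) / 2) \<le> 1" using M by simp
    then have l\<sigma>: "l \<le> \<sigma>" unfolding l_def by (rule mult_left_le[OF _ less_imp_le[OF \<sigma>(1)]])
    define A where "A = {t1 - \<sigma>\<^sup>2..t1} \<times> ball x1 l"
    have A_sub: "A \<subseteq> {t1 - \<sigma>\<^sup>2..t1} \<times> cball x1 \<sigma>"
      unfolding A_def using l\<sigma> by (intro Sigma_mono) auto
    have AD: "A \<subseteq> D" using A_sub cyl sub by blast
    have le': "u z \<le> K * M" if "z \<in> {t1 - \<sigma>\<^sup>2..t1} \<times> ball x1 l" for z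
      unfolding K_def M_def by (rule le[OF subsetD[OF A_sub[unfolded A_def] that]])
    obtain ut g Q where UC: "fast_diffusion_unit_cylinder m K (\<lambda>t x. u (t1 + \<sigma>\<^sup>2 * t, x1 + l *\<^sub>R x) / M) ut g Q"
      using rescaled_unit_cylinder[OF m K M \<sigma>(1), of t1 x1, folded l_def, OF AD[unfolded A_def] le'] by blast
    have U0: "1 \<le> u (t1 + \<sigma>\<^sup>2 * 0, x1 + l *\<^sub>R 0) / M" using M by (simp add: M_def[symmetric])
    note low = c0(2)[OF UC U0]
    define f where "f z = ennreal (indicator A z *\<^sub>R (u z powr p))" for z
    have fm: "f \<in> borel_measurable borel"
    proof -
      have "(\<lambda>z. indicator A z *\<^sub>R (u z powr p)) \<in> borel_measurable borel"
      proof (rule borel_measurable_continuous_on_indicator)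
        show "A \<in> sets borel" unfolding A_def by (intro borel_Times) auto
        show "continuous_on A (\<lambda>z. u z powr p)"
          by (intro continuous_on_powr continuous_on_subset[OF continuous_u AD] continuous_on_const)
            (use pos[OF subsetD[OF AD]] in fastforce)
      qed
      then show ?thesis unfolding f_def[abs_def] by measurable
    qed
    define I where "I = (\<integral>\<^sup>+z. f (t1 + \<sigma>\<^sup>2 * fst z, x1 + l *\<^sub>R snd z) \<partial>lborel)"
    have Pm: "(\<lambda>z. f (t1 + \<sigma>\<^sup>2 * fst z, x1 + l *\<^sub>R snd z)) \<in> borel_measurable lborel"
    proof -
      have "(\<lambda>z::real \<times> 'a. (t1 + \<sigma>\<^sup>2 * fst z, x1 + l *\<^sub>R snd z)) \<in> borel \<rightarrow>\<^sub>M borel"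
        by (intro borel_measurable_continuous_onI continuous_intros)
      from measurable_compose[OF this fm] show ?thesis by simp
    qed
    have low2: "ennreal c0 \<le> ennreal (M powr (- p)) * I"
    proof -
      have "(\<integral>\<^sup>+z \<in> {-1..0} \<times> ball 0 1. ennreal ((u (t1 + \<sigma>\<^sup>2 * fst z, x1 + l *\<^sub>R snd z) / M) powr p) \<partial>lborel)
        \<le> (\<integral>\<^sup>+z. ennreal (M powr (- p)) * f (t1 + \<sigma>\<^sup>2 * fst z, x1 + l *\<^sub>R snd z) \<partial>lborel)"
      proof (rule nn_integral_mono)
        fix z :: "real \<times> 'a"
        show "ennreal ((u (t1 + \<sigma>\<^sup>2 * fst z, x1 + l *\<^sub>R snd z) / M) powr p) * indicator ({-1..0} \<times> ball 0 1) z
          \<le> ennreal (M powr (- p)) * f (t1 + \<sigma>\<^sup>2 * fst z, x1 + l *\<^sub>R snd z)"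
        proof (cases "z \<in> {-1..0} \<times> ball 0 1")
          case True
          obtain t x where z: "z = (t, x)" by (cases z)
          have t: "-1 \<le> t" "t \<le> 0" and x: "norm x < 1" using True by (auto simp: z)
          have "\<sigma>\<^sup>2 * (-1) \<le> \<sigma>\<^sup>2 * t" "\<sigma>\<^sup>2 * t \<le> \<sigma>\<^sup>2 * 0" by (intro mult_left_mono t zero_le_power2)+
          moreover have "l * norm x < l" using x l by simp
          ultimately have "(t1 + \<sigma>\<^sup>2 * t, x1 + l *\<^sub>R x) \<in> A" using l by (simp add: A_def dist_norm)
          then have inA: "(t1 + \<sigma>\<^sup>2 * fst z, x1 + l *\<^sub>R snd z) \<in> A" by (simp only: z fst_conv snd_conv)
          have "(u (t1 + \<sigma>\<^sup>2 * fst z, x1 + l *\<^sub>R snd z) / M) powr p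
             = M powr (- p) * u (t1 + \<sigma>\<^sup>2 * fst z, x1 + l *\<^sub>R snd z) powr p"
            using M pos[OF subsetD[OF AD inA]] by (simp add: powr_divide powr_minus_divide)
          then show ?thesis using True inA unfolding f_def by (simp add: ennreal_mult')
        qed simp
      qed
      also have "\<dots> = ennreal (M powr (- p)) * I" unfolding I_def by (rule nn_integral_cmult[OF Pm])
      finally show ?thesis using low by (rule order_trans[rotated])
    qed
    define B where "B = \<sigma>\<^sup>2 * l ^ DIM('a)"
    have B: "0 < B" using \<sigma>(1) l by (simp add: B_def)
    have "ennreal (B * M powr p) * ennreal c0 \<le> ennreal (B * M powr p) * (ennreal (M powr (- p)) * I)"
      by (rule mult_left_mono[OF low2]) simp
    also have "\<dots> = ennreal B * I"
    proof -
      have "ennreal (B * M powr p) * ennreal (M powr (- p)) = ennreal (B * (M powr p * M powr (- p)))"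
        using B by (simp add: ennreal_mult[symmetric] mult.assoc)
      also have "M powr p * M powr (- p) = 1" using M unfolding powr_add[symmetric] by simp
      finally show ?thesis by (simp add: mult.assoc[symmetric])
    qed
    also have "ennreal B * I = (\<integral>\<^sup>+z. f z \<partial>lborel)"
      unfolding B_def I_def using nn_integral_parabolic_scaling[OF fm, of "\<sigma>\<^sup>2" l t1 x1] \<sigma>(1) l by simp
    also have "\<dots> \<le> (\<integral>\<^sup>+z \<in> {t0 - \<rho>\<^sup>2..t0} \<times> cball x0 \<rho>. ennreal (u z powr p) \<partial>lborel)"
    proof (rule nn_integral_mono)
      show "f z \<le> ennreal (u z powr p) * indicator ({t0 - \<rho>\<^sup>2..t0} \<times> cball x0 \<rho>) z" for z
      proof (cases "z \<in> A")
        case True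
        have "z \<in> {t0 - \<rho>\<^sup>2..t0} \<times> cball x0 \<rho>" by (rule subsetD[OF cyl subsetD[OF A_sub True]])
        then show ?thesis using True unfolding f_def by (simp only: indicator_simps) simp
      qed (simp add: f_def)
    qed
    finally have main: "ennreal (B * M powr p * c0) \<le> (\<integral>\<^sup>+z \<in> {t0 - \<rho>\<^sup>2..t0} \<times> cball x0 \<rho>. ennreal (u z powr p) \<partial>lborel)"
      using B c0(1) by (simp add: ennreal_mult)
    have BM: "B * M powr p = \<sigma> powr (d + 2) * M powr (N / 2)"
    proof -
      have "l ^ DIM('a) = l powr d" using l d by (simp add: powr_realpow)
      also have "\<dots> = \<sigma> powr d * M powr ((m - 1) / 2 * d)"
        unfolding l_def by (simp add: powr_mult powr_powr)
      finally have "B * M powr p = (\<sigma> powr d * \<sigma> powr 2) * (M powr ((m - 1) / 2 * d) * M powr p)"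
        using \<sigma>(1) by (simp add: B_def powr_numeral mult_ac)
      also have "\<dots> = \<sigma> powr (d + 2) * M powr ((m - 1) / 2 * d + p)" by (simp only: powr_add)
      also have "(m - 1) / 2 * d + p = N / 2" unfolding N(1) by (simp add: field_simps)
      finally show ?thesis .
    qed
    have aN: "\<alpha> * (N / 2) = d + 2" using N(2) by (simp add: \<alpha>_def)
    have "(u (t0, x0) * \<rho> powr \<alpha>) powr (N / 2) \<le> (M * (2 * \<sigma>) powr \<alpha>) powr (N / 2)"
      using pick u0 N(2) unfolding M_def by (intro powr_mono2) auto
    then have "u (t0, x0) powr (N / 2) * \<rho> powr (d + 2) \<le> M powr (N / 2) * (2 * \<sigma>) powr (d + 2)"
      unfolding powr_mult powr_powr aN .
    also have "(2 * \<sigma>) powr (d + 2) = 2 powr (d + 2) * \<sigma> powr (d + 2)" by (rule powr_mult)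
    finally have "c * (u (t0, x0) powr (N / 2) * \<rho> powr (d + 2))
      \<le> c * (M powr (N / 2) * (2 powr (d + 2) * \<sigma> powr (d + 2)))"
      using \<open>0 < c\<close> by (intro mult_left_mono) auto
    also have "\<dots> = (2 powr (- (d + 2)) * 2 powr (d + 2)) * (c0 * (\<sigma> powr (d + 2) * M powr (N / 2)))"
      unfolding c_def by (simp only: mult_ac)
    also have "\<dots> = B * M powr p * c0"
      unfolding BM powr_add[symmetric] by simp
    finally have "ennreal (c * u (t0, x0) powr (N / 2) * \<rho> powr (d + 2)) \<le> ennreal (B * M powr p * c0)"
      by (intro ennreal_leI) (simp add: mult.assoc)
    then show "ennreal (c * u (t0, x0) powr (N / 2) * \<rho> powr (d + 2))
        \<le> (\<integral>\<^sup>+z \<in> {t0 - \<rho>\<^sup>2..t0} \<times> cball x0 \<rho>. ennreal (u z powr p) \<partial>lborel)"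
      using main by (rule order_trans)
  qed
qed

section \<open>The local smoothing estimate\<close>

lemma solution_is_classical:
  fixes u :: "real \<times> (real ^ 'n) \<Rightarrow> real"
  assumes sol: "nonneg_weak_solution m T c R u"
    and pos: "\<And>z. z \<in> ({0<..T} \<inter> {..<Te}) \<times> ball c R \<Longrightarrow> 0 < u z"
    and smooth: "smooth_fun_on (({0<..T} \<inter> {..<Te}) \<times> ball c R) u"
  obtains u' u'' where "classical_fast_diffusion m ({0<..<min T Te} \<times> ball c R) u u' u''"
proof -
  define D where "D = {0<..<min T Te} \<times> ball c R"
  have D: "open D" unfolding D_def by (intro open_Times open_greaterThanLessThan open_ball)
  have sub: "D \<subseteq> ({0<..T} \<inter> {..<Te}) \<times> ball c R" "D \<subseteq> {0<..<T} \<times> ball c R"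
    unfolding D_def by (intro Sigma_mono subsetI; simp)+
  have "Ck_on 2 D u" using smooth sub(1) unfolding smooth_fun_on_def by (blast intro: Ck_on_subset)
  then obtain u' u'' where d: "\<And>z. z \<in> D \<Longrightarrow> (u has_derivative u' z) (at z)"
    "\<And>z b. z \<in> D \<Longrightarrow> b \<in> Basis \<Longrightarrow> ((\<lambda>z. u' z b) has_derivative u'' b z) (at z)"
    "\<And>b. b \<in> Basis \<Longrightarrow> continuous_on D (\<lambda>z. u' z b)"
    "\<And>b b'. b \<in> Basis \<Longrightarrow> b' \<in> Basis \<Longrightarrow> continuous_on D (\<lambda>z. u'' b z b')"
    using Ck_on_2_open[OF D] by blast
  have p: "0 < u z" if "z \<in> D" for z by (rule pos[OF subsetD[OF sub(1) that]])
  have "classical_fast_diffusion m D u u' u''"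
  proof
    show "u' z (1, 0) = (\<Sum>b\<in>Basis. u z powr (m - 1) * u'' (0, b) z (0, b)
           + (m - 1) * u z powr (m - 2) * u' z (0, b) * u' z (0, b))" if "z \<in> D" for z
      by (rule weak_solution_imp_classical[OF sol D sub(2) p d that])
  qed (fact p d)+
  then show thesis unfolding D_def by (rule that)
qed

lemma continuous_upto_final_time:
  fixes u :: "real \<times> 'a::euclidean_space \<Rightarrow> real"
  assumes cont: "continuous_on ({0<..T} \<times> ball c R) u" and x: "x \<in> ball c R" and T: "0 \<le> T1" "T1 < T"
    and le: "\<And>t. T1 < t \<Longrightarrow> t < T \<Longrightarrow> u (t, x) \<le> b"
  shows "u (T, x) \<le> b"
proof -
  have "continuous_on {0<..T} (\<lambda>t. u (t, x))"
    by (rule continuous_on_slices(2)[where F="\<lambda>t x. u (t, x)" and X="ball c R"]) (use cont x in simp_all)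
  then have "((\<lambda>t. u (t, x)) \<longlongrightarrow> u (T, x)) (at T within {0<..T})"
    unfolding continuous_on_def using T by auto
  then have "((\<lambda>t. u (t, x)) \<longlongrightarrow> u (T, x)) (at T within {(T1 + T) / 2..T})"
    by (rule tendsto_within_subset) (use T in auto)
  moreover have "at T within {(T1 + T) / 2..T} = at_left T"
    by (rule at_within_Icc_at_left) (use T in simp)
  ultimately have "((\<lambda>t. u (t, x)) \<longlongrightarrow> u (T, x)) (at_left T)" by simp
  moreover have "\<forall>\<^sub>F t in at_left T. u (t, x) \<le> b"
    by (rule eventually_at_leftI[OF _ T(2)]) (use le in simp)
  ultimately show ?thesis by (rule tendsto_upperbound) simp
qed

lemma emeasure_parabolic_cylinder:
  fixes x0 :: "'a::euclidean_space"
  assumes "0 \<le> \<rho>"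
  shows "emeasure lborel ({t0 - \<rho>\<^sup>2..t0} \<times> cball x0 \<rho>) = ennreal (unit_ball_vol (real DIM('a)) * \<rho> powr (real DIM('a) + 2))"
proof -
  have "emeasure lborel ({t0 - \<rho>\<^sup>2..t0} \<times> cball x0 \<rho>)
      = emeasure lborel {t0 - \<rho>\<^sup>2..t0} * emeasure lborel (cball x0 \<rho>)"
    unfolding lborel_prod[symmetric] by (rule lborel.emeasure_pair_measure_Times) auto
  also have "\<dots> = ennreal (\<rho>\<^sup>2) * ennreal (unit_ball_vol (real DIM('a)) * \<rho> ^ DIM('a))"
    using assms by (simp add: emeasure_cball)
  also have "\<dots> = ennreal (\<rho>\<^sup>2 * (unit_ball_vol (real DIM('a)) * \<rho> ^ DIM('a)))"
    using assms by (subst ennreal_mult) simp_all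
  also have "\<rho>\<^sup>2 * (unit_ball_vol (real DIM('a)) * \<rho> ^ DIM('a)) = unit_ball_vol (real DIM('a)) * \<rho> powr (real DIM('a) + 2)"
  proof (cases "\<rho> = 0")
    case False
    then have "\<rho> powr (real DIM('a) + 2) = \<rho> ^ DIM('a) * \<rho>\<^sup>2"
      using assms by (simp add: powr_add powr_realpow powr_numeral)
    then show ?thesis by (simp only: mult_ac)
  qed simp
  finally show ?thesis .
qed

theorem theorem2p4:
  fixes d m p :: real
  assumes "d = real CARD('n::finite)" and "3 \<le> CARD('n)"
    and "m < 1"
    and "m_c d < m \<Longrightarrow> 1 \<le> p"
    and "m \<le> m_c d \<Longrightarrow> p_c d m < p"
  shows "\<exists>C_loc>0. \<forall>(T::real) (R::real) (c :: real ^ 'n) u T\<^sub>0 T\<^sub>1 R\<^sub>0 R\<^sub>1.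
     0 < T \<longrightarrow> 0 < R \<longrightarrow>
     nonneg_weak_solution m T c R u \<longrightarrow>
     positive_smooth_until_extinction T c R u \<longrightarrow>
     0 < R\<^sub>1 \<longrightarrow> R\<^sub>1 < R\<^sub>0 \<longrightarrow> R\<^sub>0 \<le> R \<longrightarrow>
     0 \<le> T\<^sub>0 \<longrightarrow> T\<^sub>0 < T\<^sub>1 \<longrightarrow> T\<^sub>1 < T \<longrightarrow>
     (SUP z \<in> cyl T\<^sub>1 T c R\<^sub>1. ennreal \<bar>u z\<bar>)
       \<le> ennreal (C_loc * (1 / (R\<^sub>0 - R\<^sub>1)\<^sup>2 + 1 / (T\<^sub>1 - T\<^sub>0)) powr ((d + 2) / (2 * p + d * (m - 1))))
         * ennpowr ((\<integral>\<^sup>+ z \<in> cyl T\<^sub>0 T c R\<^sub>0. ennreal (u z powr p) \<partial>lborel)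
                      + emeasure lborel (cyl T\<^sub>0 T c R\<^sub>0))
                   (2 / (2 * p + d * (m - 1)))"
proof -
  define N where "N = 2 * p + d * (m - 1)"
  have d3: "3 \<le> d" using assms(1,2) by simp
  have dD: "d = real DIM(real ^ 'n)" using assms(1) by simp
  have pN: "0 \<le> p \<and> 0 < N"
  proof (cases "m_c d < m")
    case True
    then have "(d - 2) / d < m" by (simp add: m_c_def)
    then have "d - 2 < m * d" using d3 by (simp add: pos_divide_less_eq)
    then show ?thesis using assms(4)[OF True] by (simp add: N_def algebra_simps)
  next
    case False
    then have pc: "p_c d m < p" using assms(5) by simp
    have "0 \<le> d * (1 - m)" using d3 assms(3) by simp
    then show ?thesis using pc by (simp add: N_def p_c_def algebra_simps)
  qed
  then have p0: "0 \<le> p" and N: "0 < N" by simp_all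
  obtain c0 where c0: "0 < c0"
    "\<And>D u u' u'' t0 x0 \<rho>. classical_fast_diffusion m (D :: (real \<times> (real ^ 'n)) set) u u' u'' \<Longrightarrow> 0 < \<rho> \<Longrightarrow>
      {t0 - \<rho>\<^sup>2..t0} \<times> cball x0 \<rho> \<subseteq> D \<Longrightarrow> 1 \<le> u (t0, x0) \<Longrightarrow>
      ennreal (c0 * u (t0, x0) powr (N / 2) * \<rho> powr (d + 2))
        \<le> (\<integral>\<^sup>+z \<in> {t0 - \<rho>\<^sup>2..t0} \<times> cball x0 \<rho>. ennreal (u z powr p) \<partial>lborel)"
    using classical_solution_lower_bound[where 'a="real ^ 'n", OF assms(3) p0 dD N_def N] by blast
  define \<omega> where "\<omega> = unit_ball_vol (real DIM(real ^ 'n))"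
  have \<omega>: "0 < \<omega>" by (simp add: \<omega>_def)
  define c1 where "c1 = min c0 \<omega>"
  have c1: "0 < c1" "c1 \<le> c0" "c1 \<le> \<omega>" unfolding c1_def using c0(1) \<omega> by (simp_all only: min_less_iff_conj min.cobounded1 min.cobounded2)
  \<comment> \<open>Solve $c_1 u^{N/2} \rho^{d+2} \le X$ for $u$.\<close>
  define C where "C = c1 powr (- (2 / N))"
  show ?thesis
  proof (intro exI conjI allI impI)
    show "0 < C" using c1(1) by (simp add: C_def)
    fix T R :: real and c :: "real ^ 'n" and u :: "real \<times> (real ^ 'n) \<Rightarrow> real" and T\<^sub>0 T\<^sub>1 R\<^sub>0 R\<^sub>1 :: real
    assume T: "0 < T" and R: "0 < R" and sol: "nonneg_weak_solution m T c R u"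
      and reg: "positive_smooth_until_extinction T c R u"
      and R1: "0 < R\<^sub>1" "R\<^sub>1 < R\<^sub>0" "R\<^sub>0 \<le> R" and T1: "0 \<le> T\<^sub>0" "T\<^sub>0 < T\<^sub>1" "T\<^sub>1 < T"
    from reg obtain Te where pos: "\<And>z. z \<in> ({0<..T} \<inter> {..<Te}) \<times> ball c R \<Longrightarrow> 0 < u z"
      and smooth: "smooth_fun_on (({0<..T} \<inter> {..<Te}) \<times> ball c R) u"
      and ext: "\<And>z. z \<in> ({0<..T} \<inter> {Te..}) \<times> ball c R \<Longrightarrow> u z = 0"
      unfolding positive_smooth_until_extinction_def by blast
    obtain u' u'' where cl: "classical_fast_diffusion m ({0<..<min T Te} \<times> ball c R) u u' u''"
      by (rule solution_is_classical[OF sol pos smooth])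
    define a where "a = 1 / (R\<^sub>0 - R\<^sub>1)\<^sup>2 + 1 / (T\<^sub>1 - T\<^sub>0)"
    define X where "X = (\<integral>\<^sup>+ z \<in> cyl T\<^sub>0 T c R\<^sub>0. ennreal (u z powr p) \<partial>lborel) + emeasure lborel (cyl T\<^sub>0 T c R\<^sub>0)"
    have a_pos: "0 < 1 / (R\<^sub>0 - R\<^sub>1)\<^sup>2" "0 < 1 / (T\<^sub>1 - T\<^sub>0)" using R1 T1 by simp_all
    then have a: "0 < a" unfolding a_def by (rule add_pos_pos)
    have a_gt: "1 / (R\<^sub>0 - R\<^sub>1)\<^sup>2 < a" "1 / (T\<^sub>1 - T\<^sub>0) < a"
      using a_pos unfolding a_def by linarith+
    define \<rho> where "\<rho> = a powr (- (1/2))"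
    have \<rho>: "0 < \<rho>" using a by (simp add: \<rho>_def)
    have \<rho>2: "\<rho>\<^sup>2 = 1 / a"
    proof -
      have "\<rho>\<^sup>2 = \<rho> powr real 2" by (rule powr_realpow[OF \<rho>, symmetric])
      also have "\<dots> = a powr (- 1)" unfolding \<rho>_def powr_powr by simp
      finally show ?thesis using a by (simp add: powr_minus_divide)
    qed
    have "\<rho>\<^sup>2 < 1 / (1 / (T\<^sub>1 - T\<^sub>0))"
      unfolding \<rho>2 by (rule divide_strict_left_mono[OF a_gt(2) zero_less_one mult_pos_pos[OF a a_pos(2)]])
    then have \<rho>T: "\<rho>\<^sup>2 < T\<^sub>1 - T\<^sub>0" by simp
    have "\<rho>\<^sup>2 < 1 / (1 / (R\<^sub>0 - R\<^sub>1)\<^sup>2)"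
      unfolding \<rho>2 by (rule divide_strict_left_mono[OF a_gt(1) zero_less_one mult_pos_pos[OF a a_pos(1)]])
    then have "\<rho>\<^sup>2 < (R\<^sub>0 - R\<^sub>1)\<^sup>2" by simp
    then have \<rho>R: "\<rho> < R\<^sub>0 - R\<^sub>1" by (rule power_less_imp_less_base) (use R1 in simp)
    define B where "B = ennreal (C * a powr ((d + 2) / N)) * ennpowr X (2 / N)"
    have interior: "ennreal (u (t0, x0)) \<le> B"
      if t0: "T\<^sub>1 < t0" "t0 < min T Te" and x0: "x0 \<in> ball c R\<^sub>1" for t0 x0
    proof -
      let ?Z = "{t0 - \<rho>\<^sup>2..t0} \<times> cball x0 \<rho>"
      have near: "x \<in> ball c R\<^sub>0" if "x \<in> cball x0 \<rho>" for x
      proof -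
        have "dist c x \<le> dist c x0 + dist x0 x" by (rule dist_triangle)
        moreover have "dist c x0 < R\<^sub>1" "dist x0 x \<le> \<rho>" using x0 that by (simp_all only: mem_ball mem_cball)
        ultimately have "dist c x < R\<^sub>0" using \<rho>R by linarith
        then show ?thesis by (simp only: mem_ball)
      qed
      have tt: "T\<^sub>0 < t \<and> t \<le> T \<and> t < min T Te" if "t \<in> {t0 - \<rho>\<^sup>2..t0}" for t
      proof -
        have "t0 - \<rho>\<^sup>2 \<le> t" "t \<le> t0" using that by simp_all
        moreover have "t0 < T" "t0 < Te" using t0(2) by simp_all
        ultimately have "T\<^sub>0 < t" "t < T" "t < Te" using t0(1) \<rho>T by linarith+
        then show ?thesis by simp
      qed
      have ZQ: "?Z \<subseteq> cyl T\<^sub>0 T c R\<^sub>0"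
        unfolding cyl_def
      proof (rule Sigma_mono)
        show "{t0 - \<rho>\<^sup>2..t0} \<subseteq> {T\<^sub>0<..T}"
          by (rule subsetI) (use tt in \<open>simp only: greaterThanAtMost_iff\<close>)
        show "cball x0 \<rho> \<subseteq> ball c R\<^sub>0" using near by (rule subsetI)
      qed
      have ZD: "?Z \<subseteq> {0<..<min T Te} \<times> ball c R"
      proof (rule Sigma_mono)
        show "{t0 - \<rho>\<^sup>2..t0} \<subseteq> {0<..<min T Te}"
        proof
          fix t assume "t \<in> {t0 - \<rho>\<^sup>2..t0}"
          note t = tt[OF this]
          then have "0 < t" using T1(1) by linarith
          then show "t \<in> {0<..<min T Te}" using t by (simp only: greaterThanLessThan_iff)
        qed
        show "cball x0 \<rho> \<subseteq> ball c R"
          by (rule subsetI) (rule subsetD[OF subset_ball[OF R1(3)] near])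
      qed
      have z0: "(t0, x0) \<in> ?Z" using \<rho> by simp
      have u0: "0 < u (t0, x0)" by (rule classical_fast_diffusion.pos[OF cl subsetD[OF ZD z0]])
      define y where "y = c1 * u (t0, x0) powr (N / 2) * \<rho> powr (d + 2)"
      have y: "0 < y" using c1 u0 \<rho> by (simp add: y_def)
      have yX: "ennreal y \<le> X"
      proof (cases "1 \<le> u (t0, x0)")
        case True
        have "ennreal y \<le> ennreal (c0 * u (t0, x0) powr (N / 2) * \<rho> powr (d + 2))"
          unfolding y_def using c1(2) by (intro ennreal_leI mult_right_mono) auto
        also have "\<dots> \<le> (\<integral>\<^sup>+z \<in> ?Z. ennreal (u z powr p) \<partial>lborel)"
          by (rule c0(2)[OF cl \<rho> ZD True])
        also have "\<dots> \<le> (\<integral>\<^sup>+ z \<in> cyl T\<^sub>0 T c R\<^sub>0. ennreal (u z powr p) \<partial>lborel)"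
        proof (rule nn_integral_mono)
          fix z
          have "indicator ?Z z \<le> (indicator (cyl T\<^sub>0 T c R\<^sub>0) z :: ennreal)"
          proof (cases "z \<in> ?Z")
            case True
            show ?thesis
              unfolding indicator_simps(1)[OF True] indicator_simps(1)[OF subsetD[OF ZQ True]] by (rule order_refl)
          next
            case False
            show ?thesis unfolding indicator_simps(2)[OF False] by (rule zero_le)
          qed
          then show "ennreal (u z powr p) * indicator ?Z z \<le> ennreal (u z powr p) * indicator (cyl T\<^sub>0 T c R\<^sub>0) z"
            by (rule mult_left_mono) simp
        qed
        also have "\<dots> \<le> X" unfolding X_def by simp
        finally show ?thesis .
      next
        case False
        then have "u (t0, x0) powr (N / 2) \<le> 1 powr (N / 2)" using u0 N by (intro powr_mono2) auto
        then have "u (t0, x0) powr (N / 2) \<le> 1" by simp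
        then have "c1 * u (t0, x0) powr (N / 2) \<le> \<omega> * 1" using c1 \<omega> by (intro mult_mono) auto
        then have "y \<le> \<omega> * \<rho> powr (d + 2)" unfolding y_def by (intro mult_right_mono) auto
        then have "ennreal y \<le> emeasure lborel ?Z"
          using emeasure_parabolic_cylinder[of \<rho> t0 x0] \<rho> unfolding \<omega>_def dD by (simp add: ennreal_leI)
        also have "\<dots> \<le> emeasure lborel (cyl T\<^sub>0 T c R\<^sub>0)"
        proof (rule emeasure_mono[OF ZQ])
          have "cyl T\<^sub>0 T c R\<^sub>0 \<in> sets borel" unfolding cyl_def by (intro borel_Times) auto
          then show "cyl T\<^sub>0 T c R\<^sub>0 \<in> sets lborel" by simp
        qed
        also have "\<dots> \<le> X" unfolding X_def by simp
        finally show ?thesis .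
      qed
      show ?thesis
      proof (cases "X = \<infinity>")
        case True
        have "0 < C * a powr ((d + 2) / N)" using \<open>0 < C\<close> a by simp
        then have "ennreal (C * a powr ((d + 2) / N)) \<noteq> 0" unfolding ennreal_eq_0_iff by linarith
        moreover have e: "ennpowr X (2 / N) = top" unfolding ennpowr_def if_P[OF True] by simp
        ultimately have "B = top" unfolding B_def e by (intro ennreal_top_mult_left)
        then show ?thesis by simp
      next
        case False
        define x where "x = enn2real X"
        have Xx: "X = ennreal x" unfolding x_def
          by (rule ennreal_enn2real[symmetric]) (use False in \<open>simp only: infinity_ennreal_def less_top\<close>)
        have x0': "0 \<le> x" by (simp add: x_def)
        have yx: "y \<le> x" using yX x0' unfolding Xx by (simp add: ennreal_le_iff)
        have u_eq: "u (t0, x0) = C * a powr ((d + 2) / N) * y powr (2 / N)"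
        proof -
          have e: "N / 2 * (2 / N) = 1" using N by simp
          have "y powr (2 / N) = c1 powr (2 / N) * (u (t0, x0) powr (N / 2 * (2 / N)) * \<rho> powr ((d + 2) * (2 / N)))"
            unfolding y_def powr_mult powr_powr by (simp only: mult.assoc)
          also have "u (t0, x0) powr (N / 2 * (2 / N)) = u (t0, x0)" unfolding e using u0 by simp
          also have "\<rho> powr ((d + 2) * (2 / N)) = a powr (- ((d + 2) / N))"
          proof -
            have e2: "- (1/2) * ((d + 2) * (2 / N)) = - ((d + 2) / N)"
              using N by (simp add: field_simps)
            show ?thesis unfolding \<rho>_def powr_powr e2 ..
          qed
          finally have yy: "y powr (2 / N) = c1 powr (2 / N) * (u (t0, x0) * a powr (- ((d + 2) / N)))" .
          have "C * c1 powr (2 / N) = 1" unfolding C_def powr_add[symmetric] using c1(1) by simp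
          moreover have "a powr ((d + 2) / N) * a powr (- ((d + 2) / N)) = 1"
            unfolding powr_add[symmetric] using a by simp
          moreover have "C * a powr ((d + 2) / N) * y powr (2 / N)
             = (C * c1 powr (2 / N)) * (a powr ((d + 2) / N) * a powr (- ((d + 2) / N))) * u (t0, x0)"
            unfolding yy by (simp only: mult_ac)
          ultimately show ?thesis by simp
        qed
        also have "\<dots> \<le> C * a powr ((d + 2) / N) * x powr (2 / N)"
          using yx y N \<open>0 < C\<close> by (intro mult_left_mono powr_mono2) auto
        finally have "ennreal (u (t0, x0)) \<le> ennreal (C * a powr ((d + 2) / N) * x powr (2 / N))"
          by (rule ennreal_leI)
        also have "\<dots> = B"
        proof -
          have e: "ennpowr X (2 / N) = ennreal (x powr (2 / N))"
            unfolding ennpowr_def if_not_P[OF False] x_def ..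
          show ?thesis unfolding B_def e by (rule ennreal_mult) (use \<open>0 < C\<close> in simp_all)
        qed
        finally show ?thesis .
      qed
    qed
    have "(SUP z \<in> cyl T\<^sub>1 T c R\<^sub>1. ennreal \<bar>u z\<bar>) \<le> B"
    proof (rule SUP_least)
      fix z assume z: "z \<in> cyl T\<^sub>1 T c R\<^sub>1"
      obtain t x where zz: "z = (t, x)" by (cases z)
      have t: "T\<^sub>1 < t" "t \<le> T" and x: "x \<in> ball c R\<^sub>1" using z unfolding zz cyl_def by simp_all
      have xR: "x \<in> ball c R" using x R1 subset_ball[of "R\<^sub>1" R c] by auto
      have t0: "0 < t" using t T1 by linarith
      consider "Te \<le> t" | "t < Te" "t < T" | "t < Te" "t = T" using t(2) by linarith
      then show "ennreal \<bar>u z\<bar> \<le> B"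
      proof cases
        case 1
        then have "u z = 0" by (intro ext) (use t t0 xR in \<open>simp add: zz\<close>)
        then show ?thesis by simp
      next
        case 2
        have "z \<in> ({0<..T} \<inter> {..<Te}) \<times> ball c R" using 2 t t0 xR by (simp add: zz)
        then have "0 < u z" by (rule pos)
        moreover have "ennreal (u (t, x)) \<le> B" by (rule interior[OF t(1) _ x]) (use 2 in simp)
        ultimately show ?thesis by (simp add: zz)
      next
        case 3
        have "z \<in> ({0<..T} \<inter> {..<Te}) \<times> ball c R" using 3 t t0 xR by (simp add: zz)
        then have uz: "0 < u z" by (rule pos)
        show ?thesis
        proof (cases "B = \<infinity>")
          case False
          have BB: "ennreal (enn2real B) = B"
            by (rule ennreal_enn2real) (use False in \<open>simp only: infinity_ennreal_def less_top\<close>)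
          have S: "{0<..T} \<inter> {..<Te} = {0<..T}" using 3 by auto
          have "Ck_on 0 ({0<..T} \<times> ball c R) u" using smooth unfolding smooth_fun_on_def S by blast
          then have cont: "continuous_on ({0<..T} \<times> ball c R) u" by simp
          have "u (T, x) \<le> enn2real B"
          proof (rule continuous_upto_final_time[OF cont xR _ T1(3)])
            show "0 \<le> T\<^sub>1" using T1 by linarith
            fix s assume s: "T\<^sub>1 < s" "s < T"
            have "ennreal (u (s, x)) \<le> B" by (rule interior[OF s(1) _ x]) (use s 3 in simp)
            then have "ennreal (u (s, x)) \<le> ennreal (enn2real B)" unfolding BB .
            then show "u (s, x) \<le> enn2real B" by (simp add: ennreal_le_iff)
          qed
          then have "ennreal (u (T, x)) \<le> ennreal (enn2real B)" by (rule ennreal_leI)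
          then have "ennreal (u (t, x)) \<le> B" unfolding BB 3(2) .
          moreover have "\<bar>u z\<bar> = u (t, x)" using uz by (simp add: zz)
          ultimately show ?thesis by (simp only:)
        qed simp
      qed
    qed
    then show "(SUP z \<in> cyl T\<^sub>1 T c R\<^sub>1. ennreal \<bar>u z\<bar>)
       \<le> ennreal (C * (1 / (R\<^sub>0 - R\<^sub>1)\<^sup>2 + 1 / (T\<^sub>1 - T\<^sub>0)) powr ((d + 2) / (2 * p + d * (m - 1))))
         * ennpowr ((\<integral>\<^sup>+ z \<in> cyl T\<^sub>0 T c R\<^sub>0. ennreal (u z powr p) \<partial>lborel)
                      + emeasure lborel (cyl T\<^sub>0 T c R\<^sub>0))
                   (2 / (2 * p + d * (m - 1)))"
      unfolding B_def X_def a_def N_def .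
  qed
qed

end
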